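(* Let $g \in \mathrm{BMOA}$ and $1 \le p < \infty$. Suppose $(f_n)$ is a sequence in $H^p$ with $\|f_n\|_{H^p}=1$ for all $n$ and $f_n\to 0$ uniformly on compact subsets of $\mathbb{D}$. If $\liminf_{n\to\infty}\|T_g f_n\|_{H^p}>0$, then there is a subsequence $(f_{n_j})$ such that $(T_g f_{n_j})$ is equivalent to the unit vector basis of $\ell^p$, i.e. there is a constant $c>0$ with \[ c^{-1}\Bigl(\sum_j|\alpha_j|^p\Bigr)^{1/p}\le\Bigl\|\sum_j\alpha_j T_g f_{n_j}\Bigr\|_{H^p}\le c\Bigl(\sum_j|\alpha_j|^p\Bigr)^{1/p}\] for all $(\alpha_j)\in\ell^p$.
   Context: $\mathbb{D}$ is the open unit disc. For $0<p<\infty$, $H^p$ is the Hardy space on $\mathbb{D}$. For $a\in\mathbb{D}$ let $\sigma_a(z)=\frac{a-z}{1-\bar a z}$. $\mathrm{BMOA}$ is the space of analytic $f\colon\mathbb{D}\to\mathbb{C}$ with $\sup_{a\in\mathbb{D}}\|f\circ\sigma_a-f(a)\|_{H^2}<\infty$. For analytic $g$ on $\mathbb{D}$, $T_g f(z)=\int_0^z f(w)g'(w)\,dw$. *)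

theory Defs
  imports "HOL-Analysis.Analysis"
begin

definition hardy_mean :: "real \<Rightarrow> (complex \<Rightarrow> complex) \<Rightarrow> real \<Rightarrow> real" where
  "hardy_mean p f r = integral {0..2*pi} (\<lambda>t. cmod (f (complex_of_real r * cis t)) powr p) / (2*pi)"

definition in_Hardy :: "real \<Rightarrow> (complex \<Rightarrow> complex) \<Rightarrow> bool" where
  "in_Hardy p f \<longleftrightarrow> f holomorphic_on ball 0 1 \<and> bdd_above (hardy_mean p f ` {0<..<1})"

definition hardy_norm :: "real \<Rightarrow> (complex \<Rightarrow> complex) \<Rightarrow> real" where
  "hardy_norm p f = (SUP r\<in>{0<..<1}. hardy_mean p f r powr (1/p))"

definition disc_aut :: "complex \<Rightarrow> complex \<Rightarrow> complex" where
  "disc_aut a z = (a - z) / (1 - cnj a * z)"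

definition BMOA :: "(complex \<Rightarrow> complex) set" where
  "BMOA = {f. f holomorphic_on ball 0 1 \<and>
     (\<forall>a\<in>ball 0 1. in_Hardy 2 (\<lambda>z. f (disc_aut a z) - f a)) \<and>
     bdd_above ((\<lambda>a. hardy_norm 2 (\<lambda>z. f (disc_aut a z) - f a)) ` ball 0 1)}"

text \<open>Volterra-type operator: T_g f z = integral of f g' along the segment [0,z],
  written out via the parametrisation w = t z, t in [0,1].\<close>
definition volterra :: "(complex \<Rightarrow> complex) \<Rightarrow> (complex \<Rightarrow> complex) \<Rightarrow> complex \<Rightarrow> complex" where
  "volterra g f z = integral {0..1} (\<lambda>t::real. f (complex_of_real t * z) * deriv g (complex_of_real t * z) * z)"

end

theory Submission
  imports Defs "HOL-Complex_Analysis.Complex_Analysis"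
begin

text \<open>The theorem rests on two facts.

  \<^item> \<open>T\<^sub>g\<close> is bounded on \<open>H\<^sup>p\<close>. Let \<open>u\<close> be the harmonic majorant of \<open>\<bar>g\<bar>\<^sup>2\<close> on a disc. The \<open>BMOA\<close>
    condition says that \<open>\<psi> = \<bar>g\<bar>\<^sup>2 - u\<close> is bounded, and \<open>\<partial>\<partial>' \<psi> = \<bar>g'\<bar>\<^sup>2\<close> (with \<open>\<partial>'\<close> the conjugate derivative).
    Hence \<open>exp \<psi> \<cdot> (\<bar>f\<bar>\<^sup>2 + 1)\<^sup>s\<close> dominates \<open>(\<bar>f\<bar>\<^sup>2 + 1)\<^sup>s \<cdot> \<bar>g'\<bar>\<^sup>2\<close> in Laplacian, with no maximal function needed.
    Comparing the Laplacian of \<open>(\<bar>F\<bar>\<^sup>2 + \<bar>f\<bar>\<^sup>2 + 1)\<^sup>s\<close>, \<open>F = T\<^sub>g f\<close>, with such functions bounds the means of \<open>\<bar>F\<bar>\<^sup>p\<close>;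
    comparing between two circles close to the boundary shows moreover that \<open>T\<^sub>g f\<^sub>n\<close> tends to \<open>0\<close> in \<open>H\<^sup>1\<^sup>/\<^sup>2\<close>,
    that is, in measure.

  \<^item> For \<open>h\<close> in \<open>H\<^sup>p\<close> the functions \<open>\<bar>h\<bar>\<^sup>p\<close> on the circles of radius \<open>r < 1\<close> are equi-integrable (again by comparing
    Laplacians). So \<open>min \<bar>h\<bar> \<bar>T\<^sub>g f\<^sub>n\<bar>\<close> tends to \<open>0\<close> in \<open>L\<^sup>p\<close> uniformly in \<open>r\<close>, and a gliding hump produces a
    subsequence that is almost disjointly supported on each circle. Working on circles avoids boundary values.\<close>

section \<open>Laplacians and circle means\<close>

text \<open>By hypothesis \<open>T_g f_n\<close> does not tend to 0 in the \<open>p\<close>-norm, so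
  smallness must come from a lower exponent. With \<open>Q = |f|^2 + 1\<close> and
  \<open>s < p/2\<close>, one has \<open>Q^s <= k Q^(p/2) + C\<close> with \<open>k\<close> as small
  as desired. Against \<open>|g'|^2\<close> the first term costs \<open>k\<close> times a bounded
  mean. The second meets \<open>|g'|^2\<close> alone, and its contribution between two circles is
  the increase of the mean of \<open>|g|^2\<close>, small near the boundary because these means are
  bounded. Inside the smaller circle locally uniform convergence takes over. The Laplacian of
  \<open>|F|^2\<close> is \<open>|f|^2 |g'|^2\<close>, but a power of \<open>|F|^2\<close> with
  exponent below 1 is singular at zeros of \<open>F\<close>. Adding \<open>l Q\<close> cures this,
  and \<open>l\<close> prices the cure: \<open>l = 1\<close> serves boundedness, small
  \<open>l\<close> serves smallness. In the gliding hump only pairwise minima need control: at each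
  point, all terms except a dominant one add up to at most the sum of the pairwise minima. A minimum
  of a fixed \<open>|h|\<close> and \<open>|F_n|\<close> is small in \<open>L^p\<close> since
  \<open>|h|^p\<close> is equi-integrable and \<open>F_n\<close> is small in measure. The liminf
  hypothesis then supplies the lower bound on each term that lets the total error be
  absorbed.\<close>

text \<open>\<open>a\<close> is the Wirtinger derivative of the real function \<open>A\<close> with respect to \<open>z\<close>, and \<open>L\<close> is a quarter of
  its Laplacian.\<close>
definition has_lap :: "complex set \<Rightarrow> (complex \<Rightarrow> real) \<Rightarrow> (complex \<Rightarrow> complex) \<Rightarrow> (complex \<Rightarrow> real) \<Rightarrow> bool" where
  "has_lap S A a L \<longleftrightarrow> continuous_on S L \<and>
     (\<exists>b. continuous_on S b \<and> (\<forall>z\<in>S.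
        (A has_derivative (\<lambda>w. 2 * Re (a z * w))) (at z) \<and>
        (a has_derivative (\<lambda>w. b z * w + of_real (L z) * cnj w)) (at z)))"

lemma has_lap_continuous:
  assumes "has_lap S A a L"
  shows "continuous_on S A" "continuous_on S a" "continuous_on S L"
  using assms unfolding has_lap_def
  by (meson has_derivative_continuous continuous_at_imp_continuous_on)+

lemma has_lap_const: "has_lap S (\<lambda>_. c) (\<lambda>_. 0) (\<lambda>_. 0)"
  unfolding has_lap_def by (intro conjI exI[of _ "\<lambda>_. 0"]) auto

lemma has_lap_add:
  assumes "has_lap S A a L" "has_lap S B b K"
  shows "has_lap S (\<lambda>z. A z + B z) (\<lambda>z. a z + b z) (\<lambda>z. L z + K z)"
proof -
  obtain a' b' where "continuous_on S a'" "continuous_on S b'"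
    and *: "\<forall>z\<in>S. (A has_derivative (\<lambda>w. 2 * Re (a z * w))) (at z) \<and>
        (a has_derivative (\<lambda>w. a' z * w + of_real (L z) * cnj w)) (at z)"
      "\<forall>z\<in>S. (B has_derivative (\<lambda>w. 2 * Re (b z * w))) (at z) \<and>
        (b has_derivative (\<lambda>w. b' z * w + of_real (K z) * cnj w)) (at z)"
    using assms unfolding has_lap_def by auto
  moreover have "((\<lambda>z. A z + B z) has_derivative (\<lambda>w. 2 * Re ((a z + b z) * w))) (at z)" if "z \<in> S" for z
    by (rule has_derivative_eq_rhs[OF has_derivative_add]) (use * that in \<open>auto simp: algebra_simps fun_eq_iff\<close>)
  moreover have "((\<lambda>z. a z + b z) has_derivative (\<lambda>w. (a' z + b' z) * w + of_real (L z + K z) * cnj w)) (at z)" if "z \<in> S" for z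
    by (rule has_derivative_eq_rhs[OF has_derivative_add]) (use * that in \<open>auto simp: algebra_simps fun_eq_iff\<close>)
  ultimately show ?thesis
    using assms unfolding has_lap_def
    by (intro conjI exI[of _ "\<lambda>z. a' z + b' z"]) (auto intro!: continuous_intros)
qed

lemma has_lap_cmult:
  assumes "has_lap S A a L"
  shows "has_lap S (\<lambda>z. c * A z) (\<lambda>z. of_real c * a z) (\<lambda>z. c * L z)"
proof -
  obtain b where "continuous_on S b"
    and *: "\<forall>z\<in>S. (A has_derivative (\<lambda>w. 2 * Re (a z * w))) (at z) \<and>
        (a has_derivative (\<lambda>w. b z * w + of_real (L z) * cnj w)) (at z)"
    using assms unfolding has_lap_def by auto
  moreover have "((\<lambda>z. c * A z) has_derivative (\<lambda>w. 2 * Re ((of_real c * a z) * w))) (at z)" if "z \<in> S" for z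
    by (rule has_derivative_eq_rhs[OF has_derivative_mult_right]) (use * that in \<open>auto simp: algebra_simps fun_eq_iff\<close>)
  moreover have "((\<lambda>z. of_real c * a z) has_derivative (\<lambda>w. (of_real c * b z) * w + of_real (c * L z) * cnj w)) (at z)" if "z \<in> S" for z
    by (rule has_derivative_eq_rhs[OF has_derivative_mult_right]) (use * that in \<open>auto simp: algebra_simps fun_eq_iff\<close>)
  ultimately show ?thesis
    using assms unfolding has_lap_def
    by (intro conjI exI[of _ "\<lambda>z. of_real c * b z"]) (auto intro!: continuous_intros)
qed

lemma has_lap_compose:
  fixes \<psi> \<psi>' \<psi>'' :: "real \<Rightarrow> real"
  assumes A: "has_lap S A a L" and T: "A ` S \<subseteq> T"
    and d1: "\<And>x. x \<in> T \<Longrightarrow> (\<psi> has_real_derivative \<psi>' x) (at x)"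
    and d2: "\<And>x. x \<in> T \<Longrightarrow> (\<psi>' has_real_derivative \<psi>'' x) (at x)"
    and c: "continuous_on T \<psi>''"
  shows "has_lap S (\<lambda>z. \<psi> (A z)) (\<lambda>z. of_real (\<psi>' (A z)) * a z)
           (\<lambda>z. \<psi>' (A z) * L z + \<psi>'' (A z) * (cmod (a z))\<^sup>2)"
proof -
  obtain b where cb: "continuous_on S b"
    and *: "\<forall>z\<in>S. (A has_derivative (\<lambda>w. 2 * Re (a z * w))) (at z) \<and>
        (a has_derivative (\<lambda>w. b z * w + of_real (L z) * cnj w)) (at z)"
    using A unfolding has_lap_def by auto
  have c1: "continuous_on S (\<lambda>z. \<psi>'' (A z))"
    by (rule continuous_on_compose2[OF c has_lap_continuous(1)[OF A] T])
  have "continuous_on T \<psi>'"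
    by (meson d2 DERIV_isCont continuous_at_imp_continuous_on)
  then have c2: "continuous_on S (\<lambda>z. \<psi>' (A z))"
    by (rule continuous_on_compose2[OF _ has_lap_continuous(1)[OF A] T])
  have "((\<lambda>z. \<psi> (A z)) has_derivative (\<lambda>w. 2 * Re ((of_real (\<psi>' (A z)) * a z) * w))) (at z)" if "z \<in> S" for z
  proof -
    have "(\<psi> has_derivative (\<lambda>x. \<psi>' (A z) * x)) (at (A z))"
      using d1[of "A z"] T that by (auto simp: has_field_derivative_def)
    then show ?thesis
      by (rule has_derivative_eq_rhs[OF has_derivative_compose[rotated]])
         (use * that in \<open>auto simp: algebra_simps fun_eq_iff\<close>)
  qed
  moreover have "((\<lambda>z. of_real (\<psi>' (A z)) * a z) has_derivative
       (\<lambda>w. (of_real (\<psi>'' (A z)) * (a z)\<^sup>2 + of_real (\<psi>' (A z)) * b z) * w +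
         of_real (\<psi>' (A z) * L z + \<psi>'' (A z) * (cmod (a z))\<^sup>2) * cnj w)) (at z)" if "z \<in> S" for z
  proof -
    have "(\<psi>' has_derivative (\<lambda>x. \<psi>'' (A z) * x)) (at (A z))"
      using d2[of "A z"] T that by (auto simp: has_field_derivative_def)
    then have "((\<lambda>z. \<psi>' (A z)) has_derivative (\<lambda>w. \<psi>'' (A z) * (2 * Re (a z * w)))) (at z)"
      by (rule has_derivative_compose[rotated]) (use * that in auto)
    then have 1: "((\<lambda>z. complex_of_real (\<psi>' (A z))) has_derivative (\<lambda>w. of_real (\<psi>'' (A z) * (2 * Re (a z * w))))) (at z)"
      by (rule has_derivative_of_real)
    \<comment> \<open>Writing \<open>2 * Re x\<close> as \<open>x + cnj x\<close> splits the
      real-linear derivative into a linear and a conjugate-linear half; only the latter enters the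
      Laplacian, with coefficient \<open>|a|^2\<close>.\<close>
    have 2: "complex_of_real (2 * Re (a z * w)) * a z = (a z)\<^sup>2 * w + of_real ((cmod (a z))\<^sup>2) * cnj w" for w
    proof -
      have "complex_of_real (2 * Re (a z * w)) * a z = (a z * w + cnj (a z) * cnj w) * a z"
        by (metis complex_add_cnj complex_cnj_mult)
      then show ?thesis
        unfolding complex_norm_square by (simp add: algebra_simps power2_eq_square)
    qed
    show ?thesis
    proof (rule has_derivative_eq_rhs[OF has_derivative_mult[OF 1 conjunct2[OF bspec[OF * that]]]], rule ext)
      fix w
      have "complex_of_real (\<psi>' (A z)) * (b z * w + of_real (L z) * cnj w) + of_real (\<psi>'' (A z) * (2 * Re (a z * w))) * a z
        = of_real (\<psi>' (A z)) * (b z * w + of_real (L z) * cnj w) + of_real (\<psi>'' (A z)) * (of_real (2 * Re (a z * w)) * a z)"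
        by simp
      also have "\<dots> = (of_real (\<psi>'' (A z)) * (a z)\<^sup>2 + of_real (\<psi>' (A z)) * b z) * w +
         of_real (\<psi>' (A z) * L z + \<psi>'' (A z) * (cmod (a z))\<^sup>2) * cnj w"
        unfolding 2 by (simp add: algebra_simps)
      finally show "complex_of_real (\<psi>' (A z)) * (b z * w + of_real (L z) * cnj w) + of_real (\<psi>'' (A z) * (2 * Re (a z * w))) * a z = \<dots>" .
    qed
  qed
  ultimately show ?thesis
    unfolding has_lap_def
    by (intro conjI exI[of _ "\<lambda>z. of_real (\<psi>'' (A z)) * (a z)\<^sup>2 + of_real (\<psi>' (A z)) * b z"] ballI)
       (use c1 c2 cb has_lap_continuous[OF A] in \<open>auto intro!: continuous_intros\<close>)
qed

lemma has_derivative_holomorphic: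
  assumes "k holomorphic_on S" "open S" "z \<in> S"
  shows "(k has_derivative (\<lambda>w. deriv k z * w)) (at z)"
  using holomorphic_derivI[OF assms] by (simp add: has_field_derivative_def)

lemma has_lap_cmod_square:
  assumes k: "k holomorphic_on S" and S: "open S"
  shows "has_lap S (\<lambda>z. (cmod (k z))\<^sup>2) (\<lambda>z. deriv k z * cnj (k z)) (\<lambda>z. (cmod (deriv k z))\<^sup>2)"
proof -
  have k': "deriv k holomorphic_on S" by (rule holomorphic_deriv[OF k S])
  have k'': "deriv (deriv k) holomorphic_on S" by (rule holomorphic_deriv[OF k' S])
  note c = holomorphic_on_imp_continuous_on[OF k] holomorphic_on_imp_continuous_on[OF k'] holomorphic_on_imp_continuous_on[OF k'']
  note d = has_derivative_holomorphic[OF k S] has_derivative_holomorphic[OF k' S]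
  have "((\<lambda>z. (cmod (k z))\<^sup>2) has_derivative (\<lambda>w. 2 * Re (deriv k z * cnj (k z) * w))) (at z)" if "z \<in> S" for z
    unfolding power2_norm_eq_inner
    by (rule has_derivative_eq_rhs[OF has_derivative_inner[OF d(1)[OF that] d(1)[OF that]]])
       (auto simp: inner_complex_def fun_eq_iff algebra_simps)
  moreover have "((\<lambda>z. deriv k z * cnj (k z)) has_derivative
      (\<lambda>w. deriv (deriv k) z * cnj (k z) * w + of_real ((cmod (deriv k z))\<^sup>2) * cnj w)) (at z)" if "z \<in> S" for z
    by (rule has_derivative_eq_rhs[OF has_derivative_mult[OF d(2)[OF that] has_derivative_cnj[OF d(1)[OF that]]]])
       (unfold complex_norm_square, simp add: fun_eq_iff algebra_simps)
  ultimately show ?thesis unfolding has_lap_def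
    by (intro conjI exI[of _ "\<lambda>z. deriv (deriv k) z * cnj (k z)"] ballI) (use c in \<open>auto intro!: continuous_intros\<close>)
qed

lemma has_lap_Re:
  assumes k: "k holomorphic_on S" and S: "open S"
  shows "has_lap S (\<lambda>z. Re (k z)) (\<lambda>z. deriv k z / 2) (\<lambda>z. 0)"
proof -
  have k': "deriv k holomorphic_on S" by (rule holomorphic_deriv[OF k S])
  have k'': "deriv (deriv k) holomorphic_on S" by (rule holomorphic_deriv[OF k' S])
  note d = has_derivative_holomorphic[OF k S] has_derivative_holomorphic[OF k' S]
  have "((\<lambda>z. Re (k z)) has_derivative (\<lambda>w. 2 * Re (deriv k z / 2 * w))) (at z)" if "z \<in> S" for z
    by (rule has_derivative_eq_rhs[OF has_derivative_Re[OF d(1)[OF that]]]) (auto simp: fun_eq_iff)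
  moreover have "((\<lambda>z. deriv k z / 2) has_derivative
      (\<lambda>w. deriv (deriv k) z / 2 * w + of_real 0 * cnj w)) (at z)" if "z \<in> S" for z
    using has_derivative_mult_right[OF d(2)[OF that], of "1/2"] by (simp add: field_simps)
  ultimately show ?thesis unfolding has_lap_def
    by (intro conjI exI[of _ "\<lambda>z. deriv (deriv k) z / 2"] ballI)
       (use holomorphic_on_imp_continuous_on[OF k''] in \<open>auto intro!: continuous_intros\<close>)
qed

section \<open>Circle integrals: monotonicity and comparison\<close>

definition circ_int :: "(complex \<Rightarrow> real) \<Rightarrow> real \<Rightarrow> real" where
  "circ_int A R = integral {0..2*pi} (\<lambda>t. A (of_real R * cis t))"

text \<open>Polar coordinates: with \<open>m\<close> the circle integral,
  \<open>K x = x * m' x\<close> has derivative \<open>4 * x\<close> times the circle integral of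
  \<open>L\<close>, since the angular part of the Laplacian integrates to 0 over a full turn. As
  \<open>K 0 = 0\<close>, first \<open>K\<close> and then \<open>m'\<close> is nonnegative.\<close>

lemma circ_int_mono_lap:
  assumes A: "has_lap (ball 0 r) A a L" and L: "\<And>z. z \<in> ball 0 r \<Longrightarrow> 0 \<le> L z"
    and \<rho>: "0 \<le> \<rho>" "\<rho> \<le> R" "R < r"
  shows "circ_int A \<rho> \<le> circ_int A R"
proof -
  obtain b where cb: "continuous_on (ball 0 r) b"
    and dA: "\<And>z. z \<in> ball 0 r \<Longrightarrow> (A has_derivative (\<lambda>w. 2 * Re (a z * w))) (at z)"
    and da: "\<And>z. z \<in> ball 0 r \<Longrightarrow> (a has_derivative (\<lambda>w. b z * w + of_real (L z) * cnj w)) (at z)"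
    using A unfolding has_lap_def by auto
  note cA = has_lap_continuous[OF A]
  define U where "U = {-r<..<r}"
  have U: "open U" "convex U" by (auto simp: U_def)
  have zin: "of_real x * cis t \<in> ball 0 r" if "x \<in> U" for x t
    using that by (auto simp: U_def norm_mult)
  have cz: "continuous_on (U \<times> T) (\<lambda>(x,t). k (of_real x * cis t))"
    if "continuous_on (ball 0 r) k" for k :: "complex \<Rightarrow> 'b::topological_space" and T
    unfolding case_prod_beta
    by (rule continuous_on_compose2[OF that]) (use zin in \<open>auto intro!: continuous_intros\<close>)
  have cz1: "continuous_on T (\<lambda>t. k (of_real x * cis t))"
    if "continuous_on (ball 0 r) k" "x \<in> U" for k :: "complex \<Rightarrow> 'b::topological_space" and T x
    by (rule continuous_on_compose2[OF that(1)]) (use zin that in \<open>auto intro!: continuous_intros\<close>)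
  have dz: "((\<lambda>x. of_real x * cis t) has_derivative (\<lambda>h. of_real h * cis t)) (at x)" for x t
    by (auto intro!: derivative_eq_intros)
  have dzt: "((\<lambda>t. of_real x * cis t) has_derivative (\<lambda>h. of_real h * (\<i> * (of_real x * cis t)))) (at t)" for x t
    using has_derivative_mult_right[OF has_derivative_cis[OF has_derivative_ident], of "of_real x"]
    by (rule has_derivative_eq_rhs) (auto simp: fun_eq_iff complex_eq_iff)
  have cc: "cis t * cnj (cis t) = 1" "cis t * (cnj (cis t) * c) = c" for t c
    by (simp_all add: cis_cnj cis_mult flip: mult.assoc)
  have R: "2 * Re (of_real h * K + of_real (l * (h * x))) = (2 * Re K + 2 * x * l) * h" for h K l x
    by (simp add: algebra_simps)
  have I: "Im (\<i> * (of_real (h * x) * (K - of_real (l * x)))) = h * (x * (Re K - x * l))" for h K l x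
    by (simp add: algebra_simps)
  define K where "K x = integral {0..2*pi} (\<lambda>t. 2 * Re (a (of_real x * cis t) * (of_real x * cis t)))" for x
  have DA: "(circ_int A has_real_derivative integral {0..2*pi} (\<lambda>t. 2 * Re (a (of_real x * cis t) * cis t))) (at x)"
    if "x \<in> U" for x
  proof -
    have "((\<lambda>x. integral (cbox 0 (2*pi)) (\<lambda>t. A (of_real x * cis t))) has_field_derivative
            integral (cbox 0 (2*pi)) (\<lambda>t. 2 * Re (a (of_real x * cis t) * cis t))) (at x within U)"
    proof (rule leibniz_rule_field_derivative[where fx = "\<lambda>x t. 2 * Re (a (of_real x * cis t) * cis t)"])
      fix x t assume "x \<in> U"
      have "((\<lambda>x. A (of_real x * cis t)) has_derivative (\<lambda>h. 2 * Re (a (of_real x * cis t) * (of_real h * cis t)))) (at x)"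
        by (rule has_derivative_compose[OF dz dA]) (use zin \<open>x \<in> U\<close> in auto)
      moreover have "(\<lambda>h. 2 * Re (a (of_real x * cis t) * (of_real h * cis t))) = (\<lambda>h. 2 * Re (a (of_real x * cis t) * cis t) * h)"
        by (auto simp: fun_eq_iff algebra_simps)
      ultimately show "((\<lambda>x. A (of_real x * cis t)) has_real_derivative 2 * Re (a (of_real x * cis t) * cis t)) (at x within U)"
        by (simp add: has_field_derivative_def has_derivative_at_withinI)
    next
      fix x assume "x \<in> U"
      show "(\<lambda>t. A (of_real x * cis t)) integrable_on cbox 0 (2*pi)"
        by (intro integrable_continuous cz1[OF cA(1)] \<open>x \<in> U\<close>)
    next
      show "continuous_on (U \<times> cbox 0 (2*pi)) (\<lambda>(x,t). 2 * Re (a (of_real x * cis t) * cis t))"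
        using cz[OF cA(2), of "cbox 0 (2*pi)"] unfolding case_prod_beta by (auto intro!: continuous_intros)
    qed (use that U in auto)
    then show ?thesis using at_within_open[OF that U(1)] by (simp add: circ_int_def[abs_def])
  qed
  have DK: "(K has_real_derivative 4 * x * integral {0..2*pi} (\<lambda>t. L (of_real x * cis t))) (at x)"
    if "x \<in> U" "0 < x" for x
  proof -
    let ?k = "\<lambda>x t. (b (of_real x * cis t) * (of_real x * cis t) + a (of_real x * cis t)) * cis t"
    have "((\<lambda>x. integral (cbox 0 (2*pi)) (\<lambda>t. 2 * Re (a (of_real x * cis t) * (of_real x * cis t)))) has_field_derivative
            integral (cbox 0 (2*pi)) (\<lambda>t. 2 * Re (?k x t) + 2 * x * L (of_real x * cis t))) (at x within U)"
    proof (rule leibniz_rule_field_derivative[where fx = "\<lambda>x t. 2 * Re (?k x t) + 2 * x * L (of_real x * cis t)"])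
      fix x t assume "x \<in> U"
      let ?z = "of_real x * cis t"
      have "((\<lambda>x. a (of_real x * cis t)) has_derivative (\<lambda>h. b ?z * (of_real h * cis t) + of_real (L ?z) * cnj (of_real h * cis t))) (at x)"
        by (rule has_derivative_compose[OF dz da]) (use zin \<open>x \<in> U\<close> in auto)
      note D = has_derivative_mult_right[OF has_derivative_Re[OF has_derivative_mult[OF this dz[of t]]], of 2]
      have E: "2 * Re (a ?z * (of_real h * cis t) + (b ?z * (of_real h * cis t) + of_real (L ?z) * cnj (of_real h * cis t)) * ?z)
          = (2 * Re (?k x t) + 2 * x * L ?z) * h" for h
      proof -
        have "cnj (of_real h * cis t) * ?z = of_real (h * x)"
          by (simp add: algebra_simps cc)
        then have "a ?z * (of_real h * cis t) + (b ?z * (of_real h * cis t) + of_real (L ?z) * cnj (of_real h * cis t)) * ?z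
            = of_real h * ?k x t + of_real (L ?z * (h * x))"
          by (simp add: algebra_simps cc)
        then show ?thesis by (simp only: R)
      qed
      show "((\<lambda>x. 2 * Re (a (of_real x * cis t) * (of_real x * cis t))) has_real_derivative (2 * Re (?k x t) + 2 * x * L ?z)) (at x within U)"
        unfolding has_field_derivative_def
        using D unfolding E by (rule has_derivative_at_withinI)
    next
      fix x assume "x \<in> U"
      show "(\<lambda>t. 2 * Re (a (of_real x * cis t) * (of_real x * cis t))) integrable_on cbox 0 (2*pi)"
        by (intro integrable_continuous continuous_intros cz1[OF cA(2)] \<open>x \<in> U\<close>)
    next
      show "continuous_on (U \<times> cbox 0 (2*pi)) (\<lambda>(x,t). 2 * Re (?k x t) + 2 * x * L (of_real x * cis t))"
        using cz[OF cA(2), of "cbox 0 (2*pi)"] cz[OF cA(3), of "cbox 0 (2*pi)"] cz[OF cb, of "cbox 0 (2*pi)"]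
        unfolding case_prod_beta by (auto intro!: continuous_intros)
    qed (use that U in auto)
    moreover have "integral {0..2*pi} (\<lambda>t. 2 * Re (?k x t) + 2 * x * L (of_real x * cis t))
        = 4 * x * integral {0..2*pi} (\<lambda>t. L (of_real x * cis t))"
    proof -
      \<comment> \<open>The coefficient \<open>b\<close> has no sign and must disappear. It occurs
        identically in this angular derivative, whose integral vanishes by periodicity, so the
        radial term containing \<open>b\<close> can be traded for a second copy of the
        \<open>L\<close> term.\<close>
      have D: "((\<lambda>t. Im (a (of_real x * cis t) * (of_real x * cis t))) has_vector_derivative
            x * (Re (?k x t) - x * L (of_real x * cis t))) (at t within {0..2*pi})" for t
      proof -
        let ?z = "of_real x * cis t"
        have "((\<lambda>t. a (of_real x * cis t)) has_derivative (\<lambda>h. b ?z * (of_real h * (\<i> * ?z)) + of_real (L ?z) * cnj (of_real h * (\<i> * ?z)))) (at t)"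
          by (rule has_derivative_compose[OF dzt da]) (use zin \<open>x \<in> U\<close> in auto)
        note D = has_derivative_Im[OF has_derivative_mult[OF this dzt[of x]]]
        have E: "Im (a ?z * (of_real h * (\<i> * ?z)) + (b ?z * (of_real h * (\<i> * ?z)) + of_real (L ?z) * cnj (of_real h * (\<i> * ?z))) * ?z)
          = h * (x * (Re (?k x t) - x * L ?z))" for h
        proof -
          have "cnj (of_real h * (\<i> * ?z)) * ?z = - (\<i> * of_real (h * x * x))"
            by (simp add: algebra_simps cc)
          then have "a ?z * (of_real h * (\<i> * ?z)) + (b ?z * (of_real h * (\<i> * ?z)) + of_real (L ?z) * cnj (of_real h * (\<i> * ?z))) * ?z
            = \<i> * (of_real (h * x) * (?k x t - of_real (L ?z * x)))"
            by (simp add: algebra_simps cc)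
          then show ?thesis by (simp only: I)
        qed
        show ?thesis
          unfolding has_vector_derivative_def real_scaleR_def
          using D unfolding E by (rule has_derivative_at_withinI)
      qed
      have "((\<lambda>t. x * (Re (?k x t) - x * L (of_real x * cis t))) has_integral
          Im (a (of_real x * cis (2*pi)) * (of_real x * cis (2*pi))) - Im (a (of_real x * cis 0) * (of_real x * cis 0))) {0..2*pi}"
        by (rule fundamental_theorem_of_calculus) (use D in auto)
      then have "((\<lambda>t. x * (Re (?k x t) - x * L (of_real x * cis t))) has_integral 0) {0..2*pi}" by simp
      from has_integral_mult_right[OF this, of "2/x"]
      have 1: "((\<lambda>t. 2 * (Re (?k x t) - x * L (of_real x * cis t))) has_integral 0) {0..2*pi}"
        using \<open>0 < x\<close> by simp
      have "(\<lambda>t. L (of_real x * cis t)) integrable_on {0..2*pi}"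
        by (intro integrable_continuous_real cz1[OF cA(3)] \<open>x \<in> U\<close>)
      then have 2: "((\<lambda>t. 4 * x * L (of_real x * cis t)) has_integral 4 * x * integral {0..2*pi} (\<lambda>t. L (of_real x * cis t))) {0..2*pi}"
        by (intro has_integral_mult_right integrable_integral)
      show ?thesis
        using has_integral_add[OF 1 2] by (intro integral_unique) (simp add: algebra_simps)
    qed
    ultimately show ?thesis using at_within_open[OF that(1) U(1)] by (simp add: K_def[abs_def])
  qed
  have cK: "continuous_on {0..x} K" if "x \<in> U" for x
    unfolding K_def
  proof (rule integral_continuous_on_param[where a=0 and b="2*pi", unfolded cbox_interval])
    show "continuous_on ({0..x} \<times> {0..2*pi}) (\<lambda>(x,t). 2 * Re (a (of_real x * cis t) * (of_real x * cis t)))"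
      using cz[OF cA(2), of "{0..2*pi}"] unfolding case_prod_beta
      by (intro continuous_intros continuous_on_subset[where s = "U \<times> {0..2*pi}" and t = "{0..x} \<times> {0..2*pi}"]) (use that in \<open>auto simp: U_def\<close>)
  qed
  have Lint: "0 \<le> integral {0..2*pi} (\<lambda>t. L (of_real x * cis t))" if "x \<in> U" for x
    by (rule integral_nonneg) (use L zin[OF that] that in \<open>auto intro!: integrable_continuous_real cz1[OF cA(3)]\<close>)
  have K0: "0 \<le> K x" if "0 < x" "x < r" for x
  proof -
    have "K 0 \<le> K x"
    proof (rule DERIV_nonneg_imp_increasing_open[OF _ _ cK])
      fix y assume y: "0 < y" "y < x"
      then have "y \<in> U" using that by (auto simp: U_def)
      then show "\<exists>d. (K has_real_derivative d) (at y) \<and> 0 \<le> d"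
        using DK[of y] Lint[of y] y
        by (intro exI[of _ "4 * y * integral {0..2*pi} (\<lambda>t. L (of_real y * cis t))"]) auto
    qed (use that in \<open>auto simp: U_def\<close>)
    then show ?thesis by (simp add: K_def)
  qed
  have N0: "0 \<le> integral {0..2*pi} (\<lambda>t. 2 * Re (a (of_real x * cis t) * cis t))" if "0 < x" "x < r" for x
  proof -
    have "K x = integral {0..2*pi} (\<lambda>t. x * (2 * Re (a (of_real x * cis t) * cis t)))"
      unfolding K_def by (intro integral_cong) (simp add: algebra_simps)
    then have "K x = x * integral {0..2*pi} (\<lambda>t. 2 * Re (a (of_real x * cis t) * cis t))" by simp
    then show ?thesis using K0[OF that] that by (simp add: zero_le_mult_iff)
  qed
  show ?thesis
  proof (rule DERIV_nonneg_imp_increasing_open[OF \<rho>(2)])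
    fix x assume "\<rho> < x" "x < R"
    then show "\<exists>y. (circ_int A has_real_derivative y) (at x) \<and> 0 \<le> y"
      using DA[of x] N0[of x] \<rho>
      by (intro exI[of _ "integral {0..2*pi} (\<lambda>t. 2 * Re (a (of_real x * cis t) * cis t))"]) (auto simp: U_def)
  next
    show "continuous_on {\<rho>..R} (circ_int A)"
      by (intro continuous_at_imp_continuous_on ballI DERIV_isCont[OF DA]) (use \<rho> in \<open>auto simp: U_def\<close>)
  qed
qed

lemma continuous_on_circle:
  assumes "continuous_on (ball 0 r) A" "0 \<le> R" "R < r"
  shows "continuous_on T (\<lambda>t. A (of_real R * cis t))"
  by (rule continuous_on_compose2[OF assms(1)]) (use assms in \<open>auto intro!: continuous_intros simp: norm_mult\<close>)

lemma circ_int_integrable: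
  fixes A :: "complex \<Rightarrow> real"
  assumes "continuous_on (ball 0 r) A" "0 \<le> R" "R < r"
  shows "(\<lambda>t. A (of_real R * cis t)) integrable_on {0..2*pi}"
  by (intro integrable_continuous_real continuous_on_circle[OF assms])

lemma circ_int_mono:
  assumes "continuous_on (ball 0 r) A" "continuous_on (ball 0 r) B" "0 \<le> R" "R < r"
    and "\<And>z. cmod z = R \<Longrightarrow> A z \<le> B z"
  shows "circ_int A R \<le> circ_int B R"
  unfolding circ_int_def
  by (rule integral_le) (use assms in \<open>auto intro!: circ_int_integrable simp: norm_mult\<close>)

lemma circ_int_add:
  assumes "continuous_on (ball 0 r) A" "continuous_on (ball 0 r) B" "0 \<le> R" "R < r"
  shows "circ_int (\<lambda>z. A z + B z) R = circ_int A R + circ_int B R"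
  unfolding circ_int_def
  by (rule integral_add) (use assms in \<open>auto intro!: circ_int_integrable\<close>)

lemma circ_int_cmult: "circ_int (\<lambda>z. c * A z) R = c * circ_int A R"
  unfolding circ_int_def by (rule integral_mult_right)

lemma circ_int_const: "circ_int (\<lambda>z. c) R = 2 * pi * c"
  unfolding circ_int_def by simp

lemma circ_int_0: "circ_int A 0 = 2 * pi * A 0"
  unfolding circ_int_def by simp

lemma circ_int_nonneg:
  assumes "continuous_on (ball 0 r) A" "0 \<le> R" "R < r" "\<And>z. cmod z = R \<Longrightarrow> 0 \<le> A z"
  shows "0 \<le> circ_int A R"
  using circ_int_mono[of r "\<lambda>_. 0" A R] assms by (simp add: circ_int_const)

text \<open>Monotonicity of circle integrals for \<open>B - A\<close>. This is the only way in which
  Laplacian inequalities are turned into inequalities between means.\<close>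

lemma lap_compare:
  assumes A: "has_lap (ball 0 r) A a L" and B: "has_lap (ball 0 r) B b K"
    and le: "\<And>z. z \<in> ball 0 r \<Longrightarrow> L z \<le> K z"
    and \<rho>: "0 \<le> \<rho>" "\<rho> \<le> R" "R < r"
  shows "circ_int A R - circ_int A \<rho> \<le> circ_int B R - circ_int B \<rho>"
proof -
  have "circ_int (\<lambda>z. B z + (-1) * A z) \<rho> \<le> circ_int (\<lambda>z. B z + (-1) * A z) R"
    by (rule circ_int_mono_lap[OF has_lap_add[OF B has_lap_cmult[OF A]]]) (use le \<rho> in auto)
  moreover have "circ_int (\<lambda>z. B z + (-1) * A z) x = circ_int B x - circ_int A x" if "0 \<le> x" "x < r" for x
    using circ_int_add[of r B "\<lambda>z. (-1) * A z" x] circ_int_cmult[of "-1" A x]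
      has_lap_continuous(1)[OF A] has_lap_continuous(1)[OF B] that by (auto intro!: continuous_intros)
  ultimately show ?thesis using \<rho> by simp
qed

text \<open>The inequality says that \<open>ln A\<close> is subharmonic where \<open>A > 0\<close>.\<close>
definition log_lap :: "complex set \<Rightarrow> (complex \<Rightarrow> real) \<Rightarrow> (complex \<Rightarrow> complex) \<Rightarrow> (complex \<Rightarrow> real) \<Rightarrow> bool" where
  "log_lap S A a L \<longleftrightarrow> has_lap S A a L \<and> (\<forall>z\<in>S. 0 \<le> A z \<and> 0 \<le> L z \<and> (cmod (a z))\<^sup>2 \<le> A z * L z)"

lemma log_lapD:
  assumes "log_lap S A a L"
  shows "has_lap S A a L" "z \<in> S \<Longrightarrow> 0 \<le> A z" "z \<in> S \<Longrightarrow> 0 \<le> L z"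
    "z \<in> S \<Longrightarrow> (cmod (a z))\<^sup>2 \<le> A z * L z"
  using assms by (auto simp: log_lap_def)

lemma log_lap_cong:
  assumes "log_lap S A a L" and eq: "\<And>z. z \<in> S \<Longrightarrow> L z = K z"
  shows "log_lap S A a K"
proof -
  have "continuous_on S L \<longleftrightarrow> continuous_on S K" by (intro continuous_on_cong eq refl)
  with assms show ?thesis unfolding log_lap_def has_lap_def by (simp cong: ball_cong)
qed

lemma log_lap_const: "0 \<le> c \<Longrightarrow> log_lap S (\<lambda>_. c) (\<lambda>_. 0) (\<lambda>_. 0)"
  by (simp add: log_lap_def has_lap_const)

text \<open>The cross term is the only issue: \<open>|a| |b|\<close> is at most the geometric mean
  of \<open>A K\<close> and \<open>B L\<close>, hence at most their arithmetic mean. Stability under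
  sums is the reason to work with this class, since it admits
  \<open>|F|^2 + l |f|^2 + l\<close>.\<close>

lemma log_lap_add:
  assumes "log_lap S A a L" "log_lap S B b K"
  shows "log_lap S (\<lambda>z. A z + B z) (\<lambda>z. a z + b z) (\<lambda>z. L z + K z)"
  unfolding log_lap_def
proof (intro conjI ballI has_lap_add log_lapD(1)[OF assms(1)] log_lapD(1)[OF assms(2)])
  fix z assume z: "z \<in> S"
  note * = log_lapD(2-4)[OF assms(1) z] log_lapD(2-4)[OF assms(2) z]
  show "0 \<le> A z + B z" "0 \<le> L z + K z" using * by auto
  have "(cmod (a z) * cmod (b z))\<^sup>2 \<le> (A z * L z) * (B z * K z)"
    unfolding power_mult_distrib by (rule mult_mono) (use * in auto)
  also have "\<dots> = (A z * K z) * (B z * L z)" by simp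
  also have "\<dots> \<le> ((A z * K z + B z * L z) / 2)\<^sup>2"
    using sum_squares_ge_zero[of "A z * K z - B z * L z" 0] by (simp add: power2_eq_square field_simps)
  finally have "cmod (a z) * cmod (b z) \<le> (A z * K z + B z * L z) / 2"
    by (rule power2_le_imp_le) (use * in auto)
  moreover have "(cmod (a z + b z))\<^sup>2 \<le> (cmod (a z) + cmod (b z))\<^sup>2"
    by (intro power_mono norm_triangle_ineq) auto
  ultimately show "(cmod (a z + b z))\<^sup>2 \<le> (A z + B z) * (L z + K z)"
    using * by (simp add: power2_sum algebra_simps)
qed

lemma log_lap_cmult:
  assumes "log_lap S A a L" "0 \<le> c"
  shows "log_lap S (\<lambda>z. c * A z) (\<lambda>z. of_real c * a z) (\<lambda>z. c * L z)"
  unfolding log_lap_def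
proof (intro conjI ballI has_lap_cmult log_lapD(1)[OF assms(1)])
  fix z assume z: "z \<in> S"
  note * = log_lapD(2-4)[OF assms(1) z]
  show "0 \<le> c * A z" "0 \<le> c * L z" using * assms by auto
  show "(cmod (of_real c * a z))\<^sup>2 \<le> c * A z * (c * L z)"
    using mult_left_mono[OF *(3), of "c * c"] assms(2)
    by (simp add: norm_mult power_mult_distrib power2_eq_square algebra_simps)
qed

lemma log_lap_cmod_square:
  assumes "k holomorphic_on S" "open S"
  shows "log_lap S (\<lambda>z. (cmod (k z))\<^sup>2) (\<lambda>z. deriv k z * cnj (k z)) (\<lambda>z. (cmod (deriv k z))\<^sup>2)"
  using has_lap_cmod_square[OF assms] by (simp add: log_lap_def norm_mult power_mult_distrib algebra_simps)

lemma has_lap_cong: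
  assumes A: "has_lap S A a L" and S: "open S" and eq: "\<And>z. z \<in> S \<Longrightarrow> A z = B z"
  shows "has_lap S B a L"
proof -
  have "(B has_derivative D) (at z)" if "(A has_derivative D) (at z)" "z \<in> S" for D z
    by (rule has_derivative_transform_within_open[OF that(1) S that(2)]) (rule eq)
  with A show ?thesis unfolding has_lap_def by blast
qed

text \<open>The Laplacian of \<open>A^s\<close> is \<open>s X + s (s - 1) Y\<close> with
  \<open>X = A^(s-1) L\<close> and \<open>Y = A^(s-2) |a|^2\<close>, and the logarithmic condition
  says \<open>Y <= X\<close>. The extreme cases \<open>Y = 0\<close> and \<open>Y = X\<close> give
  the factors \<open>s\<close> and \<open>s^2\<close>. The lower bound stays positive for
  \<open>s < 1\<close>, although the power is then concave.\<close>

lemma has_lap_powr: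
  assumes A: "log_lap S A a L" and pos: "\<And>z. z \<in> S \<Longrightarrow> 0 < A z" and s: "0 < s"
  obtains a' L' where "has_lap S (\<lambda>z. A z powr s) a' L'"
    "\<And>z. z \<in> S \<Longrightarrow> min s (s\<^sup>2) * (A z powr (s - 1) * L z) \<le> L' z"
    "\<And>z. z \<in> S \<Longrightarrow> L' z \<le> max s (s\<^sup>2) * (A z powr (s - 1) * L z)"
proof -
  let ?L = "\<lambda>z. s * A z powr (s - 1) * L z + s * ((s - 1) * A z powr (s - 1 - 1)) * (cmod (a z))\<^sup>2"
  have "has_lap S (\<lambda>z. A z powr s) (\<lambda>z. of_real (s * A z powr (s - 1)) * a z) ?L"
  proof (rule has_lap_compose[OF log_lapD(1)[OF A], where T = "{0<..}"])
    show "continuous_on {0<..} (\<lambda>x::real. s * ((s - 1) * x powr (s - 1 - 1)))"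
      by (auto intro!: continuous_intros)
  qed (use pos in \<open>auto intro!: derivative_eq_intros\<close>)
  moreover have "min s (s\<^sup>2) * (A z powr (s - 1) * L z) \<le> ?L z \<and> ?L z \<le> max s (s\<^sup>2) * (A z powr (s - 1) * L z)"
    if z: "z \<in> S" for z
  proof -
    define X where "X = A z powr (s - 1) * L z"
    define Y where "Y = A z powr (s - 1 - 1) * (cmod (a z))\<^sup>2"
    have "Y \<le> A z powr (s - 1 - 1) * (A z * L z)"
      unfolding Y_def by (intro mult_left_mono log_lapD(4)[OF A z]) auto
    also have "\<dots> = X"
      using pos[OF z] powr_add[of "A z" "s - 1 - 1" 1] by (simp add: X_def)
    finally have XY: "0 \<le> Y" "Y \<le> X" by (auto simp: Y_def)
    have eq: "?L z = s * X + s * (s - 1) * Y" by (simp add: X_def Y_def)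
    show ?thesis
    proof (cases "s \<le> 1")
      case True
      then have "s\<^sup>2 \<le> s" using s by (simp add: power2_eq_square)
      moreover have "s * (s - 1) * X \<le> s * (s - 1) * Y"
        by (rule mult_left_mono_neg[OF XY(2)]) (use s True in \<open>simp add: mult_nonneg_nonpos\<close>)
      moreover have "s * (s - 1) * Y \<le> 0"
        using s True XY by (intro mult_nonpos_nonneg mult_nonneg_nonpos) auto
      ultimately show ?thesis unfolding X_def[symmetric] eq by (simp add: power2_eq_square algebra_simps min_def max_def)
    next
      case False
      then have "s \<le> s\<^sup>2" using s by (simp add: power2_eq_square)
      moreover have "s * (s - 1) * Y \<le> s * (s - 1) * X"
        by (rule mult_left_mono[OF XY(2)]) (use s False in simp)
      moreover have "0 \<le> s * (s - 1) * Y" using s False XY by simp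
      ultimately show ?thesis unfolding X_def[symmetric] eq by (simp add: power2_eq_square algebra_simps min_def max_def)
    qed
  qed
  ultimately show ?thesis using that by blast
qed

text \<open>The function is \<open>exp X\<close> with \<open>X = \<psi> + s ln A\<close>. Its
  Laplacian is \<open>exp X\<close> times the Laplacian of \<open>X\<close> plus the square of the
  gradient term; that square and the contribution of \<open>ln A\<close> are nonnegative. Working in
  the exponent avoids the mixed first-order terms of the product rule.\<close>

lemma has_lap_exp_powr:
  assumes S: "open S" and P: "has_lap S \<psi> b K" and A: "log_lap S A a L" and pos: "\<And>z. z \<in> S \<Longrightarrow> 0 < A z" and s: "0 \<le> s"
  obtains a' L' where "has_lap S (\<lambda>z. exp (\<psi> z) * A z powr s) a' L'"
    "\<And>z. z \<in> S \<Longrightarrow> exp (\<psi> z) * A z powr s * K z \<le> L' z"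
proof -
  define l where "l z = inverse (A z) * L z + (- inverse (A z) * inverse (A z)) * (cmod (a z))\<^sup>2" for z
  define X where "X z = \<psi> z + s * ln (A z)" for z
  define x where "x z = b z + of_real s * (of_real (inverse (A z)) * a z)" for z
  have "has_lap S (\<lambda>z. ln (A z)) (\<lambda>z. of_real (inverse (A z)) * a z) l" unfolding l_def
  proof (rule has_lap_compose[OF log_lapD(1)[OF A], where T = "{0<..}"])
    show "continuous_on {0<..} (\<lambda>x::real. - inverse x * inverse x)"
      by (auto intro!: continuous_intros)
  qed (use pos in \<open>auto intro!: derivative_eq_intros simp: field_simps\<close>)
  from has_lap_add[OF P has_lap_cmult[OF this, of s]]
  have X: "has_lap S X x (\<lambda>z. K z + s * l z)" by (simp add: X_def[abs_def] x_def[abs_def])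
  have D: "has_lap S (\<lambda>z. exp (X z)) (\<lambda>z. of_real (exp (X z)) * x z)
         (\<lambda>z. exp (X z) * (K z + s * l z) + exp (X z) * (cmod (x z))\<^sup>2)"
    by (rule has_lap_compose[OF X, where T = UNIV]) (auto intro!: derivative_eq_intros continuous_intros)
  have E: "exp (X z) = exp (\<psi> z) * A z powr s" if "z \<in> S" for z
    using pos[OF that] by (simp add: X_def exp_add powr_def mult.commute)
  have le: "exp (\<psi> z) * A z powr s * K z \<le> exp (X z) * (K z + s * l z) + exp (X z) * (cmod (x z))\<^sup>2" if z: "z \<in> S" for z
  proof -
    have "inverse (A z) * inverse (A z) * (cmod (a z))\<^sup>2 \<le> inverse (A z) * inverse (A z) * (A z * L z)"
      by (intro mult_left_mono log_lapD(4)[OF A z]) auto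
    then have "0 \<le> l z" using pos[OF z] by (simp add: l_def field_simps)
    then show ?thesis using s unfolding E[OF z, symmetric] by (simp add: algebra_simps)
  qed
  show ?thesis
    by (rule that[OF has_lap_cong[OF D S E] le])
qed

section \<open>Growth of Volterra transforms in terms of a harmonic majorant\<close>

text \<open>To be instantiated on discs of radius \<open>r < 1\<close>. \<open>H\<close> completes a
  harmonic majorant of \<open>|g|^2\<close> to an analytic function, and it may change with
  \<open>r\<close>, whereas \<open>M\<close> is meant to stay fixed. Only the derivative of
  \<open>F\<close> is prescribed; \<open>F 0 = 0\<close> enters where a comparison starts at the
  origin.\<close>

locale volterra_disc =
  fixes r M :: real and f g F H :: "complex \<Rightarrow> complex"
  assumes holo: "f holomorphic_on ball 0 r" "g holomorphic_on ball 0 r"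
      "F holomorphic_on ball 0 r" "H holomorphic_on ball 0 r"
    and deriv_F: "z \<in> ball 0 r \<Longrightarrow> deriv F z = f z * deriv g z"
    and H_ge: "z \<in> ball 0 r \<Longrightarrow> (cmod (g z))\<^sup>2 \<le> Re (H z)"
    and H_le: "z \<in> ball 0 r \<Longrightarrow> Re (H z) \<le> (cmod (g z))\<^sup>2 + M"
begin

text \<open>The summand 1 keeps \<open>Q\<close> away from 0, so \<open>Q^s\<close> and
  \<open>ln Q\<close> are smooth for all exponents, and \<open>Q >= 1\<close> makes powers of
  \<open>Q\<close> increase with the exponent.\<close>

definition Q :: "complex \<Rightarrow> real" where "Q z = (cmod (f z))\<^sup>2 + 1"
definition \<psi> :: "complex \<Rightarrow> real" where "\<psi> z = (cmod (g z))\<^sup>2 - Re (H z)"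

lemma Q_ge_1: "1 \<le> Q z" and Q_pos: "0 < Q z" and Q_ge: "(cmod (f z))\<^sup>2 \<le> Q z"
  by (auto simp: Q_def add_nonneg_pos)

lemma Q_ne: "Q z \<noteq> 0" using Q_pos[of z] by simp

lemma \<psi>_bounds:
  assumes "z \<in> ball 0 r"
  shows "exp (\<psi> z) \<le> 1" "exp (- M) \<le> exp (\<psi> z)"
  using H_ge[OF assms] H_le[OF assms] by (auto simp: \<psi>_def)

lemma log_lap_Q:
  "log_lap (ball 0 r) Q (\<lambda>z. deriv f z * cnj (f z) + 0) (\<lambda>z. (cmod (deriv f z))\<^sup>2 + 0)"
  unfolding Q_def[abs_def]
  by (intro log_lap_add log_lap_cmod_square log_lap_const holo) auto

lemma log_lap_F:
  assumes "0 \<le> l"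
  obtains a where "log_lap (ball 0 r) (\<lambda>z. (cmod (F z))\<^sup>2 + l * Q z) a
     (\<lambda>z. (cmod (f z))\<^sup>2 * (cmod (deriv g z))\<^sup>2 + l * (cmod (deriv f z))\<^sup>2)"
proof -
  have "log_lap (ball 0 r) (\<lambda>z. (cmod (F z))\<^sup>2 + l * Q z)
      (\<lambda>z. deriv F z * cnj (F z) + of_real l * (deriv f z * cnj (f z) + 0))
      (\<lambda>z. (cmod (f z))\<^sup>2 * (cmod (deriv g z))\<^sup>2 + l * (cmod (deriv f z))\<^sup>2)"
    by (rule log_lap_cong[OF log_lap_add[OF log_lap_cmod_square[OF holo(3) open_ball] log_lap_cmult[OF log_lap_Q assms]]])
       (simp add: deriv_F norm_mult power_mult_distrib)
  then show ?thesis by (rule that)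
qed

lemma has_lap_\<psi>:
  obtains b where "has_lap (ball 0 r) \<psi> b (\<lambda>z. (cmod (deriv g z))\<^sup>2)"
  using has_lap_add[OF has_lap_cmod_square[OF holo(2) open_ball] has_lap_cmult[OF has_lap_Re[OF holo(4) open_ball], of "-1"]]
  by (simp add: \<psi>_def[abs_def])

text \<open>This replaces the Carleson measure property of \<open>\<bar>g'\<bar>\<^sup>2\<close> by a pointwise inequality.\<close>
lemma carleson_lap:
  fixes A :: "complex \<Rightarrow> real"
  assumes A: "log_lap (ball 0 r) A a L" and pos: "\<And>z. z \<in> ball 0 r \<Longrightarrow> 0 < A z" and s: "0 \<le> s"
  obtains a' K where "has_lap (ball 0 r) (\<lambda>z. exp (\<psi> z) * A z powr s) a' K"
    "\<And>z. z \<in> ball 0 r \<Longrightarrow> A z powr s * (cmod (deriv g z))\<^sup>2 \<le> exp M * K z"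
proof -
  obtain b where b: "has_lap (ball 0 r) \<psi> b (\<lambda>z. (cmod (deriv g z))\<^sup>2)" by (rule has_lap_\<psi>)
  obtain a' K where K: "has_lap (ball 0 r) (\<lambda>z. exp (\<psi> z) * A z powr s) a' K"
    "\<And>z. z \<in> ball 0 r \<Longrightarrow> exp (\<psi> z) * A z powr s * (cmod (deriv g z))\<^sup>2 \<le> K z"
    by (rule has_lap_exp_powr[OF open_ball b A pos s]) auto
  show ?thesis
  proof (rule that[OF K(1)])
    fix z :: complex assume z: "z \<in> ball 0 r"
    have "exp (- M) * (A z powr s * (cmod (deriv g z))\<^sup>2) \<le> exp (\<psi> z) * (A z powr s * (cmod (deriv g z))\<^sup>2)"
      by (intro mult_right_mono \<psi>_bounds z) auto
    also have "\<dots> \<le> K z" using K(2)[OF z] by (simp add: mult.assoc)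
    finally show "A z powr s * (cmod (deriv g z))\<^sup>2 \<le> exp M * K z"
      by (simp add: exp_minus field_simps)
  qed
qed

lemma cont: "continuous_on (ball 0 r) f" "continuous_on (ball 0 r) g" "continuous_on (ball 0 r) F"
    "continuous_on (ball 0 r) Q" "continuous_on (ball 0 r) \<psi>"
  by (auto intro!: continuous_intros holomorphic_on_imp_continuous_on holo simp: Q_def[abs_def] \<psi>_def[abs_def])

lemma cont_Q_powr: "continuous_on (ball 0 r) (\<lambda>z. Q z powr s)"
  using cont(4) Q_pos by (auto intro!: continuous_intros simp: Q_ne)

lemma circ_int_exp_le:
  assumes A: "continuous_on (ball 0 r) A" "\<And>z. 0 \<le> A z" and R: "0 \<le> R" "R < r"
  shows "circ_int (\<lambda>z. exp (\<psi> z) * A z) R \<le> circ_int A R" "0 \<le> circ_int (\<lambda>z. exp (\<psi> z) * A z) R"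
proof -
  have c: "continuous_on (ball 0 r) (\<lambda>z. exp (\<psi> z) * A z)"
    by (intro continuous_intros cont A)
  show "circ_int (\<lambda>z. exp (\<psi> z) * A z) R \<le> circ_int A R"
    by (rule circ_int_mono[OF c A(1) R], rule mult_left_le_one_le) (use A \<psi>_bounds R in auto)
  show "0 \<le> circ_int (\<lambda>z. exp (\<psi> z) * A z) R"
    by (rule circ_int_nonneg[OF c R]) (use A in auto)
qed

lemma circ_int_Q_ge:
  assumes R: "0 \<le> R" "R < r" and s: "0 < s"
  shows "2 * pi * Q 0 powr s \<le> circ_int (\<lambda>z. Q z powr s) R" "2 * pi \<le> circ_int (\<lambda>z. Q z powr s) R"
proof -
  obtain a' L' where L: "has_lap (ball 0 r) (\<lambda>z. Q z powr s) a' L'"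
    "\<And>z. z \<in> ball 0 r \<Longrightarrow> min s (s\<^sup>2) * (Q z powr (s - 1) * ((cmod (deriv f z))\<^sup>2 + 0)) \<le> L' z"
    by (rule has_lap_powr[OF log_lap_Q Q_pos s]) auto
  have "0 \<le> L' z" if "z \<in> ball 0 r" for z
    by (rule order_trans[OF _ L(2)[OF that]]) (use s in auto)
  from circ_int_mono_lap[OF L(1) this, of 0 R] R
  show "2 * pi * Q 0 powr s \<le> circ_int (\<lambda>z. Q z powr s) R" by (simp add: circ_int_0)
  moreover have "1 \<le> Q 0 powr s" using Q_ge_1[of 0] s by (simp add: ge_one_powr_ge_zero)
  ultimately show "2 * pi \<le> circ_int (\<lambda>z. Q z powr s) R"
    by (smt (verit, best) mult_left_le pi_gt_zero mult_less_cancel_left2)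
qed

text \<open>Let \<open>A = |F|^2 + l Q\<close>. Since \<open>s - 1 <= 0\<close> and
  \<open>A >= l Q\<close>, the factor \<open>A^(s-1)\<close> in the Laplacian of \<open>A^s\<close>
  is at most \<open>(l Q)^(s-1)\<close>. What remains splits into a multiple of
  \<open>Q^s |g'|^2\<close>, handled by \<open>K\<close>, and a multiple of
  \<open>Q^(s-1) |f'|^2\<close>, handled by the Laplacian of \<open>Q^s\<close>. The increase of
  \<open>B\<close> is kept as a difference because the growth of the mean of \<open>|g|^2\<close>
  will be used in that form.\<close>

lemma volterra_growth:
  assumes s: "0 < s" "s \<le> 1" and l: "0 < l" and R: "0 \<le> \<rho>" "\<rho> \<le> R" "R < r"
    and B: "has_lap (ball 0 r) B b K"
    and K: "\<And>z. z \<in> ball 0 r \<Longrightarrow> Q z powr s * (cmod (deriv g z))\<^sup>2 \<le> K z"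
  shows "circ_int (\<lambda>z. ((cmod (F z))\<^sup>2 + l * Q z) powr s) R - circ_int (\<lambda>z. ((cmod (F z))\<^sup>2 + l * Q z) powr s) \<rho>
    \<le> l powr s / s * circ_int (\<lambda>z. Q z powr s) R
       + s * l powr (s - 1) * (circ_int B R - circ_int B \<rho>)"
proof -
  let ?A = "\<lambda>z. (cmod (F z))\<^sup>2 + l * Q z"
  have A_pos: "0 < ?A z" for z using l Q_pos[of z] by (simp add: add_nonneg_pos)
  obtain a where A: "log_lap (ball 0 r) ?A a
     (\<lambda>z. (cmod (f z))\<^sup>2 * (cmod (deriv g z))\<^sup>2 + l * (cmod (deriv f z))\<^sup>2)"
    by (rule log_lap_F[OF less_imp_le[OF l]])
  obtain a1 L1 where L1: "has_lap (ball 0 r) (\<lambda>z. ?A z powr s) a1 L1"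
    "\<And>z. z \<in> ball 0 r \<Longrightarrow> L1 z \<le> max s (s\<^sup>2) * (?A z powr (s - 1) *
        ((cmod (f z))\<^sup>2 * (cmod (deriv g z))\<^sup>2 + l * (cmod (deriv f z))\<^sup>2))"
    by (rule has_lap_powr[OF A A_pos s(1)]) auto
  obtain a2 L2 where L2: "has_lap (ball 0 r) (\<lambda>z. Q z powr s) a2 L2"
    "\<And>z. z \<in> ball 0 r \<Longrightarrow> min s (s\<^sup>2) * (Q z powr (s - 1) * ((cmod (deriv f z))\<^sup>2 + 0)) \<le> L2 z"
    by (rule has_lap_powr[OF log_lap_Q Q_pos s(1)]) auto
  have ss: "s\<^sup>2 \<le> s" using s by (simp add: power2_eq_square)
  have le: "L1 z \<le> l powr s / s * L2 z + s * l powr (s - 1) * K z" if z: "z \<in> ball 0 r" for z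
  proof -
    let ?q = "Q z powr (s - 1)" and ?d = "(cmod (deriv f z))\<^sup>2" and ?e = "(cmod (deriv g z))\<^sup>2"
    have "L1 z \<le> s * (?A z powr (s - 1) * ((cmod (f z))\<^sup>2 * ?e + l * ?d))"
      using L1(2)[OF z] ss by (simp add: max_def)
    also have "\<dots> \<le> s * ((l powr (s - 1) * ?q) * (Q z * ?e + l * ?d))"
    proof (intro mult_left_mono mult_mono add_right_mono mult_right_mono Q_ge)
      have "?A z powr (s - 1) \<le> (l * Q z) powr (s - 1)"
        by (rule powr_mono2') (use s l Q_pos[of z] in auto)
      also have "(l * Q z) powr (s - 1) = l powr (s - 1) * ?q"
        using l Q_pos[of z] by (simp add: powr_mult)
      finally show "?A z powr (s - 1) \<le> l powr (s - 1) * ?q" .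
    qed (use s l Q_pos[of z] in auto)
    also have "\<dots> = s * l powr (s - 1) * ((?q * Q z) * ?e) + s * (l powr (s - 1) * l) * (?q * ?d)"
      by (simp add: algebra_simps)
    also have "?q * Q z = Q z powr s" using powr_add[of "Q z" "s - 1" 1] Q_pos[of z] by simp
    also have "l powr (s - 1) * l = l powr s" using powr_add[of l "s - 1" 1] l by simp
    also have "s * l powr s * (?q * ?d) = l powr s / s * (s\<^sup>2 * (?q * ?d))"
      using s by (simp add: power2_eq_square)
    also have "s * l powr (s - 1) * (Q z powr s * ?e) + l powr s / s * (s\<^sup>2 * (?q * ?d))
        \<le> s * l powr (s - 1) * K z + l powr s / s * L2 z"
      using L2(2)[OF z] K[OF z] ss s
      by (intro add_mono mult_left_mono) (auto simp: min_def split: if_splits)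
    finally show ?thesis by simp
  qed
  have cc: "continuous_on (ball 0 r) (\<lambda>z. c * Q z powr s)" "continuous_on (ball 0 r) (\<lambda>z. c * B z)" for c
    by (intro continuous_intros cont_Q_powr has_lap_continuous(1)[OF B])+
  have "circ_int (\<lambda>z. ?A z powr s) R - circ_int (\<lambda>z. ?A z powr s) \<rho>
    \<le> circ_int (\<lambda>z. l powr s / s * Q z powr s + s * l powr (s - 1) * B z) R
       - circ_int (\<lambda>z. l powr s / s * Q z powr s + s * l powr (s - 1) * B z) \<rho>"
    by (rule lap_compare[OF L1(1) has_lap_add[OF has_lap_cmult[OF L2(1)] has_lap_cmult[OF B]] le R])
  also have "\<dots> = (l powr s / s * circ_int (\<lambda>z. Q z powr s) R + s * l powr (s - 1) * circ_int B R)
      - (l powr s / s * circ_int (\<lambda>z. Q z powr s) \<rho> + s * l powr (s - 1) * circ_int B \<rho>)"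
    using circ_int_add[OF cc(1)[of "l powr s / s"] cc(2)[of "s * l powr (s - 1)"]] R
    by (simp only: circ_int_cmult)
  also have "\<dots> \<le> l powr s / s * circ_int (\<lambda>z. Q z powr s) R
       + s * l powr (s - 1) * (circ_int B R - circ_int B \<rho>)"
  proof -
    have "0 \<le> circ_int (\<lambda>z. Q z powr s) \<rho>"
      by (rule circ_int_nonneg[OF cont_Q_powr]) (use R in auto)
    then have "0 \<le> l powr s / s * circ_int (\<lambda>z. Q z powr s) \<rho>" using s by simp
    then show ?thesis by (simp add: algebra_simps)
  qed
  finally show ?thesis .
qed

text \<open>For \<open>s <= 1\<close> the summands come from the value at the origin, from the
  Laplacian of \<open>Q^s\<close>, and from the Carleson-type bound. For \<open>s > 1\<close> they
  are the value at the origin and the \<open>Q^s\<close> term, both doubled by an absorption. Only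
  \<open>s\<close> and \<open>M\<close> occur, so the bound is uniform in \<open>f\<close> and
  \<open>r\<close>.\<close>

definition bound_const :: "real \<Rightarrow> real" where
  "bound_const s = (if s \<le> 1 then 1 + 1 / s + s * exp M
     else 2 + 2 * (exp M * (s\<^sup>2 * (2 * s\<^sup>2 * exp M) powr (s - 1))))"

lemma volterra_bounded_small:
  assumes s: "0 < s" "s \<le> 1" and R: "0 \<le> R" "R < r" and F0: "F 0 = 0"
  shows "circ_int (\<lambda>z. ((cmod (F z))\<^sup>2 + 1) powr s) R \<le> bound_const s * circ_int (\<lambda>z. Q z powr s) R"
proof -
  let ?A = "\<lambda>z. (cmod (F z))\<^sup>2 + 1 * Q z"
  have A_ne: "?A z \<noteq> 0" "(cmod (F z))\<^sup>2 + 1 \<noteq> 0" for z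
    using add_nonneg_pos[OF zero_le_power2 Q_pos] by (auto simp: add_nonneg_eq_0_iff less_le)
  obtain a K where K: "has_lap (ball 0 r) (\<lambda>z. exp (\<psi> z) * Q z powr s) a K"
    "\<And>z. z \<in> ball 0 r \<Longrightarrow> Q z powr s * (cmod (deriv g z))\<^sup>2 \<le> exp M * K z"
    by (rule carleson_lap[OF log_lap_Q Q_pos less_imp_le[OF s(1)]]) auto
  let ?q = "circ_int (\<lambda>z. Q z powr s) R"
  have "circ_int (\<lambda>z. ?A z powr s) R - circ_int (\<lambda>z. ?A z powr s) 0
    \<le> 1 powr s / s * ?q + s * 1 powr (s - 1) *
      (circ_int (\<lambda>z. exp M * (exp (\<psi> z) * Q z powr s)) R - circ_int (\<lambda>z. exp M * (exp (\<psi> z) * Q z powr s)) 0)"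
    by (rule volterra_growth[OF s _ _ _ _ has_lap_cmult[OF K(1)] K(2)]) (use R in auto)
  also have "\<dots> \<le> 1 / s * ?q + s * (exp M * ?q)"
  proof -
    have "circ_int (\<lambda>z. exp M * (exp (\<psi> z) * Q z powr s)) R - circ_int (\<lambda>z. exp M * (exp (\<psi> z) * Q z powr s)) 0
      \<le> exp M * ?q - exp M * 0"
      unfolding circ_int_cmult
      by (intro diff_mono mult_left_mono circ_int_exp_le cont_Q_powr) (use R in auto)
    then show ?thesis using s by (simp add: mult_left_mono)
  qed
  finally have "circ_int (\<lambda>z. ?A z powr s) R - circ_int (\<lambda>z. ?A z powr s) 0 \<le> 1 / s * ?q + s * (exp M * ?q)" .
  moreover have "circ_int (\<lambda>z. ?A z powr s) 0 \<le> ?q"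
    using circ_int_Q_ge(1)[OF R s(1)] by (simp add: circ_int_0 F0)
  ultimately have "circ_int (\<lambda>z. ?A z powr s) R \<le> ?q + (1 / s * ?q + s * (exp M * ?q))" by simp
  moreover have "circ_int (\<lambda>z. ((cmod (F z))\<^sup>2 + 1) powr s) R \<le> circ_int (\<lambda>z. ?A z powr s) R"
  proof (rule circ_int_mono[OF _ _ R])
    show "continuous_on (ball 0 r) (\<lambda>z. ((cmod (F z))\<^sup>2 + 1) powr s)"
      "continuous_on (ball 0 r) (\<lambda>z. ?A z powr s)"
      using A_ne by (auto intro!: continuous_intros cont)
    show "((cmod (F z))\<^sup>2 + 1) powr s \<le> ?A z powr s" for z
      by (rule powr_mono2) (use s Q_ge_1[of z] in auto)
  qed
  ultimately show ?thesis using s by (simp add: bound_const_def algebra_simps)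
qed

text \<open>For \<open>s > 1\<close> the factor \<open>A^(s-1)\<close>, now with
  \<open>A = |F|^2 + 1\<close>, cannot be bounded through \<open>Q\<close> alone. Where
  \<open>c Q <= A\<close>, the Laplacian is a small multiple of \<open>A^s |g'|^2\<close>, which
  \<open>carleson_lap\<close> applied to \<open>A\<close> itself dominates; elsewhere it is a
  multiple of \<open>Q^s |g'|^2\<close>.\<close>

lemma volterra_bounded_big:
  assumes s: "1 < s" and R: "0 \<le> R" "R < r" and F0: "F 0 = 0"
  shows "circ_int (\<lambda>z. ((cmod (F z))\<^sup>2 + 1) powr s) R \<le> bound_const s * circ_int (\<lambda>z. Q z powr s) R"
proof -
  let ?A = "\<lambda>z. (cmod (F z))\<^sup>2 + 1"
  \<comment> \<open>Chosen so that \<open>s^2 / c = exp (- M) / 2\<close>; the factor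
    \<open>exp M\<close> from \<open>carleson_lap\<close> then leaves exactly \<open>1 / 2\<close>
    in front of \<open>K'\<close>.\<close>
  define c where "c = 2 * s\<^sup>2 * exp M"
  define C where "C = s\<^sup>2 * c powr (s - 1)"
  have s0: "0 \<le> s" using s by simp
  have c: "0 < c" "0 \<le> C" using s by (auto simp: c_def C_def)
  have A_pos: "0 < ?A z" for z by (simp add: add_nonneg_pos)
  have A: "log_lap (ball 0 r) ?A (\<lambda>z. deriv F z * cnj (F z) + 0) (\<lambda>z. (cmod (deriv F z))\<^sup>2 + 0)"
    by (intro log_lap_add log_lap_cmod_square log_lap_const holo) auto
  obtain a1 L1 where L1: "has_lap (ball 0 r) (\<lambda>z. ?A z powr s) a1 L1"
    "\<And>z. z \<in> ball 0 r \<Longrightarrow> L1 z \<le> max s (s\<^sup>2) * (?A z powr (s - 1) * ((cmod (deriv F z))\<^sup>2 + 0))"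
    by (rule has_lap_powr[OF A A_pos, of s]) (use s in auto)
  obtain a K where K: "has_lap (ball 0 r) (\<lambda>z. exp (\<psi> z) * Q z powr s) a K"
    "\<And>z. z \<in> ball 0 r \<Longrightarrow> Q z powr s * (cmod (deriv g z))\<^sup>2 \<le> exp M * K z"
    by (rule carleson_lap[OF log_lap_Q Q_pos s0]) auto
  obtain a' K' where K': "has_lap (ball 0 r) (\<lambda>z. exp (\<psi> z) * ?A z powr s) a' K'"
    "\<And>z. z \<in> ball 0 r \<Longrightarrow> ?A z powr s * (cmod (deriv g z))\<^sup>2 \<le> exp M * K' z"
    by (rule carleson_lap[OF A A_pos s0]) auto
  have le: "L1 z \<le> 1 / 2 * K' z + exp M * C * K z" if z: "z \<in> ball 0 r" for z
  proof -
    let ?e = "(cmod (deriv g z))\<^sup>2"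
    have "s \<le> s\<^sup>2" using s by (simp add: power2_eq_square)
    then have "L1 z \<le> s\<^sup>2 * (?A z powr (s - 1) * ((cmod (f z))\<^sup>2 * ?e))"
      using L1(2)[OF z] by (simp add: max_def deriv_F[OF z] norm_mult power_mult_distrib split: if_splits)
    also have "\<dots> \<le> s\<^sup>2 * (?A z powr (s - 1) * (Q z * ?e))"
      by (intro mult_left_mono mult_right_mono Q_ge) auto
    also have "\<dots> = s\<^sup>2 * (?A z powr (s - 1) * Q z) * ?e" by simp
    also have "\<dots> \<le> (exp (- M) / 2 * ?A z powr s + C * Q z powr s) * ?e"
    proof (rule mult_right_mono)
      show "s\<^sup>2 * (?A z powr (s - 1) * Q z) \<le> exp (- M) / 2 * ?A z powr s + C * Q z powr s"
      proof (cases "c * Q z \<le> ?A z")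
        case True
        have "s\<^sup>2 * (?A z powr (s - 1) * Q z) = s\<^sup>2 / c * (?A z powr (s - 1) * (c * Q z))" using c by simp
        also have "\<dots> \<le> s\<^sup>2 / c * (?A z powr (s - 1) * ?A z)"
          using c True by (intro mult_left_mono) auto
        also have "?A z powr (s - 1) * ?A z = ?A z powr s"
          using powr_add[of "?A z" "s - 1" 1] A_pos[of z] by simp
        also have "s\<^sup>2 / c = exp (- M) / 2" using s by (simp add: c_def exp_minus field_simps)
        finally show ?thesis using c by (simp add: add_increasing2)
      next
        case False
        then have "?A z powr (s - 1) * Q z \<le> (c * Q z) powr (s - 1) * Q z"
          using s A_pos[of z] Q_pos[of z] by (intro mult_right_mono powr_mono2) auto
        also have "\<dots> = c powr (s - 1) * Q z powr s"
          using c Q_pos[of z] powr_add[of "Q z" "s - 1" 1] by (simp add: powr_mult)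
        finally have "s\<^sup>2 * (?A z powr (s - 1) * Q z) \<le> C * Q z powr s"
          unfolding C_def by (simp add: mult.assoc mult_left_mono)
        then show ?thesis by (simp add: add_increasing)
      qed
    qed simp
    also have "(exp (- M) / 2 * ?A z powr s + C * Q z powr s) * ?e
        = exp (- M) / 2 * (?A z powr s * ?e) + C * (Q z powr s * ?e)"
      by (simp add: algebra_simps)
    also have "\<dots> \<le> exp (- M) / 2 * (exp M * K' z) + C * (exp M * K z)"
      using c K(2)[OF z] K'(2)[OF z] by (intro add_mono mult_left_mono) auto
    also have "\<dots> = 1 / 2 * K' z + exp M * C * K z" by (simp add: exp_minus)
    finally show ?thesis .
  qed
  have cA: "continuous_on (ball 0 r) (\<lambda>z. ?A z powr s)"
    using A_pos by (auto intro!: continuous_intros cont simp: add_nonneg_eq_0_iff)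
  let ?E = "\<lambda>z. 1 / 2 * (exp (\<psi> z) * ?A z powr s)" and ?G = "\<lambda>z. exp M * C * (exp (\<psi> z) * Q z powr s)"
  have cE: "continuous_on (ball 0 r) ?E" "continuous_on (ball 0 r) ?G"
    by (intro continuous_intros cont_Q_powr cont cA)+
  have "circ_int (\<lambda>z. ?A z powr s) R - circ_int (\<lambda>z. ?A z powr s) 0
     \<le> circ_int (\<lambda>z. ?E z + ?G z) R - circ_int (\<lambda>z. ?E z + ?G z) 0"
    by (rule lap_compare[OF L1(1) has_lap_add[OF has_lap_cmult[OF K'(1)] has_lap_cmult[OF K(1)]] le]) (use R in auto)
  also have "\<dots> \<le> circ_int (\<lambda>z. ?E z + ?G z) R - 0"
    using c by (intro diff_left_mono circ_int_nonneg[of r]) (use R cE in \<open>auto intro!: continuous_intros\<close>)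
  also have "\<dots> = 1 / 2 * circ_int (\<lambda>z. exp (\<psi> z) * ?A z powr s) R + exp M * C * circ_int (\<lambda>z. exp (\<psi> z) * Q z powr s) R"
    using circ_int_add[OF cE R] by (simp only: circ_int_cmult)
  also have "\<dots> \<le> 1 / 2 * circ_int (\<lambda>z. ?A z powr s) R + exp M * C * circ_int (\<lambda>z. Q z powr s) R"
    using c by (intro add_mono mult_left_mono circ_int_exp_le cA cont_Q_powr R) auto
  \<comment> \<open>Half of the left side is absorbed, which is legitimate since the integrand is
    continuous on the circle. The constant is twice the value at the origin, where
    \<open>F 0 = 0\<close>.\<close>
  finally have "circ_int (\<lambda>z. ?A z powr s) R \<le> 2 * (2 * pi) + 2 * (exp M * C) * circ_int (\<lambda>z. Q z powr s) R"
    by (simp add: circ_int_0 F0)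
  also have "\<dots> \<le> 2 * circ_int (\<lambda>z. Q z powr s) R + 2 * (exp M * C) * circ_int (\<lambda>z. Q z powr s) R"
    using circ_int_Q_ge(2)[OF R] s by simp
  finally show ?thesis using s by (simp add: bound_const_def C_def c_def algebra_simps)
qed

lemma volterra_bounded:
  assumes "0 < s" "0 \<le> R" "R < r" "F 0 = 0"
  shows "circ_int (\<lambda>z. ((cmod (F z))\<^sup>2 + 1) powr s) R \<le> bound_const s * circ_int (\<lambda>z. Q z powr s) R"
  using volterra_bounded_small[of s R] volterra_bounded_big[of s R] assms by (cases "s \<le> 1") auto

text \<open>\<open>Q^s |g'|^2\<close> is split by the interpolation hypothesis. The
  \<open>Q^t\<close> part is paid for by \<open>carleson_lap\<close> with the small factor
  \<open>k\<close>; the constant part is \<open>C |g'|^2\<close>, the Laplacian of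
  \<open>C |g|^2\<close>, so that it costs only the increase of the mean of \<open>|g|^2\<close>
  from \<open>\<rho>\<close> to \<open>R\<close>.\<close>

lemma volterra_small_growth:
  assumes s: "0 < s" "s \<le> 1" "0 < t" and l: "0 < l" and R: "0 \<le> \<rho>" "\<rho> \<le> R" "R < r"
    and k: "0 \<le> k" "0 \<le> C" "\<And>x. 1 \<le> x \<Longrightarrow> x powr s \<le> k * x powr t + C"
  shows "circ_int (\<lambda>z. ((cmod (F z))\<^sup>2 + l * Q z) powr s) R - circ_int (\<lambda>z. ((cmod (F z))\<^sup>2 + l * Q z) powr s) \<rho>
    \<le> l powr s / s * circ_int (\<lambda>z. Q z powr s) R
       + s * l powr (s - 1) * (k * exp M * circ_int (\<lambda>z. Q z powr t) R
          + C * (circ_int (\<lambda>z. (cmod (g z))\<^sup>2) R - circ_int (\<lambda>z. (cmod (g z))\<^sup>2) \<rho>))"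
proof -
  obtain a K where K: "has_lap (ball 0 r) (\<lambda>z. exp (\<psi> z) * Q z powr t) a K"
    "\<And>z. z \<in> ball 0 r \<Longrightarrow> Q z powr t * (cmod (deriv g z))\<^sup>2 \<le> exp M * K z"
    by (rule carleson_lap[OF log_lap_Q Q_pos less_imp_le[OF s(3)]]) auto
  let ?E = "\<lambda>z. k * exp M * (exp (\<psi> z) * Q z powr t)" and ?G = "\<lambda>z. C * (cmod (g z))\<^sup>2"
  have cE: "continuous_on (ball 0 r) ?E" "continuous_on (ball 0 r) ?G"
    by (intro continuous_intros cont_Q_powr cont)+
  let ?X = "\<lambda>z. ((cmod (F z))\<^sup>2 + l * Q z) powr s"
  have "circ_int ?X R - circ_int ?X \<rho> \<le> l powr s / s * circ_int (\<lambda>z. Q z powr s) R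
       + s * l powr (s - 1) * (circ_int (\<lambda>z. ?E z + ?G z) R - circ_int (\<lambda>z. ?E z + ?G z) \<rho>)"
  proof (rule volterra_growth[OF s(1,2) l R has_lap_add[OF has_lap_cmult[OF K(1)] has_lap_cmult[OF has_lap_cmod_square[OF holo(2) open_ball]]]])
    fix z :: complex assume z: "z \<in> ball 0 r"
    let ?e = "(cmod (deriv g z))\<^sup>2"
    have "Q z powr s * ?e \<le> (k * Q z powr t + C) * ?e"
      by (intro mult_right_mono k(3) Q_ge_1) auto
    also have "\<dots> = k * (Q z powr t * ?e) + C * ?e" by (simp add: algebra_simps)
    also have "\<dots> \<le> k * (exp M * K z) + C * ?e"
      by (intro add_right_mono mult_left_mono K(2) z k)
    finally show "Q z powr s * ?e \<le> k * exp M * K z + C * ?e" by (simp add: mult.assoc)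
  qed
  also have "circ_int (\<lambda>z. ?E z + ?G z) R - circ_int (\<lambda>z. ?E z + ?G z) \<rho> =
     (k * exp M * circ_int (\<lambda>z. exp (\<psi> z) * Q z powr t) R + C * circ_int (\<lambda>z. (cmod (g z))\<^sup>2) R)
     - (k * exp M * circ_int (\<lambda>z. exp (\<psi> z) * Q z powr t) \<rho> + C * circ_int (\<lambda>z. (cmod (g z))\<^sup>2) \<rho>)"
    using circ_int_add[OF cE] R by (simp only: circ_int_cmult)
  also have "s * l powr (s - 1) * \<dots> \<le> s * l powr (s - 1) * ((k * exp M * circ_int (\<lambda>z. Q z powr t) R + C * circ_int (\<lambda>z. (cmod (g z))\<^sup>2) R)
     - (k * exp M * 0 + C * circ_int (\<lambda>z. (cmod (g z))\<^sup>2) \<rho>))"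
    by (intro mult_left_mono diff_mono add_mono mult_left_mono circ_int_exp_le cont_Q_powr) (use R k s in auto)
  finally show ?thesis by (simp add: algebra_simps)
qed

end

section \<open>Harmonic majorants for BMOA functions\<close>

lemma cmod_scaled_lt_1:
  assumes "0 < r" "r < 1" "cmod w \<le> 1"
  shows "cmod (of_real r * w) < 1"
proof -
  have "r * cmod w \<le> r * 1" using assms by (intro mult_left_mono) auto
  with assms have "r * cmod w < 1" by linarith
  then show ?thesis using assms(1) by (simp add: norm_mult)
qed

text \<open>Not divided by \<open>2 * pi\<close>: the kernel has total mass \<open>2 * pi\<close>,
  the source of that factor in the formulas below.\<close>

definition poisson :: "complex \<Rightarrow> real \<Rightarrow> real" where
  "poisson z t = (1 - (cmod z)\<^sup>2) / (cmod (cis t - z))\<^sup>2"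

lemma cis_ne: "cmod z < 1 \<Longrightarrow> cis t - z \<noteq> 0"
  using norm_cis[of t] by auto

lemma poisson_eq_Re:
  assumes "cmod z < 1"
  shows "poisson z t = Re ((cis t + z) / (cis t - z))"
proof -
  have "Re ((cis t + z) * cnj (cis t - z)) = 1 - (cmod z)\<^sup>2"
    using cmod_power2[of z] sin_cos_squared_add[of t] by (simp add: algebra_simps power2_eq_square)
  then show ?thesis unfolding poisson_def by (subst complex_div_cnj) simp
qed

lemma poisson_nonneg: "cmod z < 1 \<Longrightarrow> 0 \<le> poisson z t"
  unfolding poisson_def by (simp add: abs_square_le_1 less_imp_le)

lemma poisson_0: "poisson 0 t = 1" by (simp add: poisson_def)

lemma continuous_on_poisson:
  assumes "continuous_on T z" "continuous_on T u" "\<And>x. x \<in> T \<Longrightarrow> cmod (z x) < 1"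
  shows "continuous_on T (\<lambda>x. poisson (z x) (u x))"
  unfolding poisson_def using cis_ne[OF assms(3)] by (auto intro!: continuous_intros assms)

text \<open>Cauchy's formula for \<open>k u * (1 - |z|^2) / (1 - cnj z * u)\<close>: the extra
  factor is 1 at \<open>u = z\<close>, and on the unit circle
  \<open>1 - cnj z * u = u * cnj (u - z)\<close> turns the Cauchy kernel into the Poisson
  kernel.\<close>

lemma poisson_formula:
  fixes k :: "complex \<Rightarrow> complex"
  assumes c: "continuous_on (cball 0 1) k" and h: "k holomorphic_on ball 0 1" and z: "cmod z < 1"
  shows "((\<lambda>t. k (cis t) * of_real (poisson z t)) has_integral 2 * pi * k z) {0..2*pi}"
proof -
  have nz: "1 - cnj z * u \<noteq> 0" if "cmod u \<le> 1" for u
  proof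
    assume "1 - cnj z * u = 0"
    then have "1 = cmod z * cmod u" by (metis complex_mod_cnj norm_mult norm_one eq_iff_diff_eq_0)
    then show False using mult_left_le[OF that norm_ge_zero[of z]] z by simp
  qed
  let ?k = "\<lambda>u. k u * (1 - of_real ((cmod z)\<^sup>2)) / (1 - cnj z * u)"
  have "((\<lambda>u. ?k u / (u - z)) has_contour_integral (2 * of_real pi * \<i> * ?k z)) (circlepath 0 1)"
    by (rule Cauchy_integral_circlepath)
       (use nz z in \<open>auto intro!: continuous_intros holomorphic_intros c h\<close>)
  then have "((\<lambda>t. ?k (cis t) / (cis t - z) * \<i> * cis t) has_integral (2 * of_real pi * \<i> * ?k z)) {0..2*pi}"
    unfolding circlepath_def by (subst (asm) has_contour_integral_part_circlepath_iff) auto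
  from has_integral_mult_right[OF this, of "- \<i>"]
  have "((\<lambda>t. - \<i> * (?k (cis t) / (cis t - z) * \<i> * cis t)) has_integral (2 * of_real pi * ?k z)) {0..2*pi}"
    by (simp add: algebra_simps)
  moreover have E: "- \<i> * (?k (cis t) / (cis t - z) * \<i> * cis t) = k (cis t) * of_real (poisson z t)" for t
  proof -
    have e: "(1 - cnj z * cis t) = cis t * cnj (cis t - z)"
      by (simp add: algebra_simps cis_cnj cis_mult)
    have "of_real ((cmod (cis t - z))\<^sup>2) = (cis t - z) * cnj (cis t - z)"
      by (rule complex_norm_square)
    then have "of_real (poisson z t) = (1 - of_real ((cmod z)\<^sup>2)) / ((cis t - z) * cnj (cis t - z))"
      by (simp add: poisson_def)
    moreover have "- \<i> * (K * N / (c * d) / e * \<i> * c) = K * (N / (e * d))" if "c \<noteq> 0" for K N c d e :: complex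
      using that by (simp add: divide_simps) (simp add: algebra_simps)
    ultimately show ?thesis unfolding e by (metis cis_neq_zero)
  qed
  moreover have "?k z = k z"
    using nz[of z] z complex_norm_square[of z] by (simp add: mult.commute)
  ultimately show ?thesis by (simp only: of_real_mult of_real_numeral)
qed

lemma poisson_Re:
  fixes k :: "complex \<Rightarrow> complex"
  assumes "continuous_on (cball 0 1) k" "k holomorphic_on ball 0 1" "cmod z < 1"
  shows "((\<lambda>t. Re (k (cis t)) * poisson z t) has_integral 2 * pi * Re (k z)) {0..2*pi}"
  using has_integral_Re[OF poisson_formula[OF assms]] by simp

text \<open>The Poisson formula for the analytic function \<open>k^2\<close>, followed by the
  triangle inequality; the kernel is nonnegative.\<close>

lemma cmod_square_le_poisson:
  fixes k :: "complex \<Rightarrow> complex"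
  assumes c: "continuous_on (cball 0 1) k" and h: "k holomorphic_on ball 0 1" and z: "cmod z < 1"
  shows "2 * pi * (cmod (k z))\<^sup>2 \<le> integral {0..2*pi} (\<lambda>t. (cmod (k (cis t)))\<^sup>2 * poisson z t)"
proof -
  have I: "((\<lambda>t. (k (cis t))\<^sup>2 * of_real (poisson z t)) has_integral 2 * pi * (k z)\<^sup>2) {0..2*pi}"
    by (rule poisson_formula[of "\<lambda>z. (k z)\<^sup>2"]) (use c h z in \<open>auto intro!: continuous_intros holomorphic_intros\<close>)
  have "cmod (integral {0..2*pi} (\<lambda>t. (k (cis t))\<^sup>2 * of_real (poisson z t)))
      \<le> integral {0..2*pi} (\<lambda>t. (cmod (k (cis t)))\<^sup>2 * poisson z t)"
  proof (rule integral_norm_bound_integral)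
    have "continuous_on {0..2*pi} (\<lambda>t. k (cis t))"
      by (rule continuous_on_compose2[OF c]) (auto intro!: continuous_intros)
    then show "(\<lambda>t. (cmod (k (cis t)))\<^sup>2 * poisson z t) integrable_on {0..2*pi}"
      by (intro integrable_continuous_real continuous_intros continuous_on_poisson) (use z in auto)
  qed (use I poisson_nonneg[OF z] in \<open>auto simp: norm_mult norm_power\<close>)
  then show ?thesis using integral_unique[OF I] by (simp add: norm_mult norm_power)
qed

text \<open>\<open>H\<close> is the integral of \<open>v\<close> against the Schwarz kernel
  \<open>(cis t + z) / (cis t - z)\<close>, which is analytic in \<open>z\<close> and has the
  Poisson kernel as real part. An analytic completion is wanted because \<open>has_lap_Re\<close>
  then gives harmonicity at once.\<close>

lemma herglotz:
  fixes v :: "real \<Rightarrow> real"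
  assumes v: "continuous_on {0..2*pi} v"
  obtains H where "H holomorphic_on ball 0 1"
    "\<And>z. cmod z < 1 \<Longrightarrow> Re (H z) = integral {0..2*pi} (\<lambda>t. v t * poisson z t)"
proof -
  define h where "h z t = of_real (v t) * ((cis t + z) / (cis t - z))" for z t
  have c: "continuous_on {0..2*pi} (h z)" if "cmod z < 1" for z
    unfolding h_def by (intro continuous_intros v) (use cis_ne[OF that] in auto)
  have "(\<lambda>z. integral (cbox 0 (2*pi)) (h z)) holomorphic_on ball 0 1"
  proof (rule leibniz_rule_holomorphic[where fx = "\<lambda>z t. of_real (v t) * (2 * cis t / (cis t - z)\<^sup>2)"])
    fix z :: complex and t assume "z \<in> ball 0 1"
    then show "((\<lambda>z. h z t) has_field_derivative of_real (v t) * (2 * cis t / (cis t - z)\<^sup>2)) (at z within ball 0 1)"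
      unfolding h_def using cis_ne[of z t]
      by (auto intro!: derivative_eq_intros simp: power2_eq_square algebra_simps)
  next
    have "continuous_on (ball 0 1 \<times> cbox 0 (2*pi)) (\<lambda>x. v (snd x))"
      by (rule continuous_on_compose2[OF v]) (auto intro!: continuous_intros)
    then show "continuous_on (ball 0 1 \<times> cbox 0 (2*pi)) (\<lambda>(z,t). of_real (v t) * (2 * cis t / (cis t - z)\<^sup>2))"
      unfolding case_prod_beta using cis_ne by (auto intro!: continuous_intros)
  qed (use c in \<open>auto intro!: integrable_continuous_real\<close>)
  moreover have "Re (integral (cbox 0 (2*pi)) (h z)) = integral {0..2*pi} (\<lambda>t. v t * poisson z t)" if "cmod z < 1" for z
  proof -
    have "(h z has_integral integral {0..2*pi} (h z)) {0..2*pi}"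
      by (intro integrable_integral integrable_continuous_real c that)
    from has_integral_Re[OF this] show ?thesis

      by (simp add: h_def poisson_eq_Re[OF that] integral_unique del: times_divide_eq_right times_divide_eq_left Re_divide)
  qed
  ultimately show ?thesis by (intro that[of "\<lambda>z. integral (cbox 0 (2*pi)) (h z)"]) auto
qed

section \<open>Disc automorphisms, Hardy means and the BMOA condition\<close>

lemma disc_aut_eq: "disc_aut a z = - Moebius_function 0 a z"
  by (simp add: disc_aut_def Moebius_function_def minus_divide_left)

lemma disc_aut_lt_1: "cmod a < 1 \<Longrightarrow> cmod z < 1 \<Longrightarrow> cmod (disc_aut a z) < 1"
  by (simp add: disc_aut_eq Moebius_function_norm_lt_1)

lemma disc_aut_holomorphic: "cmod a < 1 \<Longrightarrow> disc_aut a holomorphic_on ball 0 1"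
  unfolding disc_aut_eq[abs_def] by (intro holomorphic_on_minus Moebius_function_holomorphic)

lemma disc_aut_involution:
  assumes a: "cmod a < 1" and z: "cmod z < 1"
  shows "disc_aut a (disc_aut a z) = z"
proof -
  have nz: "1 - cnj a * u \<noteq> 0" if "cmod u < 1" for u
  proof
    assume "1 - cnj a * u = 0"
    then have "1 = cmod a * cmod u" by (metis complex_mod_cnj norm_mult norm_one eq_iff_diff_eq_0)
    then show False using mult_left_le[OF less_imp_le[OF that] norm_ge_zero[of a]] a by simp
  qed
  have "(1 - cnj a * z) * (a - disc_aut a z) = z * (1 - cnj a * a)"
    using nz[OF z] by (simp add: disc_aut_def field_simps)
  moreover have "(1 - cnj a * z) * (1 - cnj a * disc_aut a z) = 1 - cnj a * a"
    using nz[OF z] by (simp add: disc_aut_def field_simps)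
  ultimately have "disc_aut a (disc_aut a z) = (z * (1 - cnj a * a)) / (1 - cnj a * a)"
    unfolding disc_aut_def[of a "disc_aut a z"]
    using nz[OF z] by (metis mult_divide_mult_cancel_left)
  then show ?thesis using nz[OF a] by simp
qed

lemma mean_value:
  fixes k :: "complex \<Rightarrow> complex"
  assumes h: "k holomorphic_on ball 0 1" and r: "0 < r" "r < 1"
  shows "((\<lambda>t. k (of_real r * cis t)) has_integral 2 * pi * k 0) {0..2*pi}"
proof -
  have "((\<lambda>t. k (of_real r * cis t) * of_real (poisson 0 t)) has_integral 2 * pi * k (of_real r * 0)) {0..2*pi}"
  proof (rule poisson_formula)
    have "continuous_on (ball 0 1) k" by (rule holomorphic_on_imp_continuous_on[OF h])
    then show "continuous_on (cball 0 1) (\<lambda>z. k (of_real r * z))"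
      by (rule continuous_on_compose2)
         (use cmod_scaled_lt_1[OF r] in \<open>auto intro!: continuous_intros\<close>)
    show "(\<lambda>z. k (of_real r * z)) holomorphic_on ball 0 1"
      by (rule holomorphic_on_compose_gen[unfolded o_def, OF _ h])
         (use cmod_scaled_lt_1[OF r] in \<open>auto intro!: holomorphic_intros\<close>)
  qed simp
  then show ?thesis by (simp add: poisson_0)
qed

text \<open>The cross term is evaluated by the mean value property. For
  \<open>k = g o disc_aut b\<close> this separates \<open>|g b|^2\<close> from the oscillation that
  the BMOA condition bounds.\<close>

lemma circ_int_variance:
  fixes k :: "complex \<Rightarrow> complex"
  assumes h: "k holomorphic_on ball 0 1" and r: "0 < r" "r < 1"
  shows "circ_int (\<lambda>z. (cmod (k z))\<^sup>2) r = circ_int (\<lambda>z. (cmod (k z - k 0))\<^sup>2) r + 2 * pi * (cmod (k 0))\<^sup>2"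
proof -
  have c: "continuous_on (ball 0 1) k" by (rule holomorphic_on_imp_continuous_on[OF h])
  have "((\<lambda>t. (cnj (k 0)) * k (of_real r * cis t)) has_integral cnj (k 0) * (2 * pi * k 0)) {0..2*pi}"
    by (intro has_integral_mult_right mean_value[OF h r])
  from has_integral_mult_right[OF has_integral_Re[OF this], of 2]
  have I: "((\<lambda>t. 2 * Re (cnj (k 0) * k (of_real r * cis t))) has_integral 4 * pi * (cmod (k 0))\<^sup>2) {0..2*pi}"
    unfolding cmod_power2 by (rule has_integral_eq_rhs) (simp add: power2_eq_square algebra_simps)
  have J: "((\<lambda>t. (cmod (k (of_real r * cis t)))\<^sup>2) has_integral circ_int (\<lambda>z. (cmod (k z))\<^sup>2) r) {0..2*pi}"
    unfolding circ_int_def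
    by (intro integrable_integral circ_int_integrable[of 1 "\<lambda>z. (cmod (k z))\<^sup>2"] continuous_intros c) (use r in auto)
  have K: "((\<lambda>t. (cmod (k 0))\<^sup>2) has_integral 2 * pi * (cmod (k 0))\<^sup>2) {0..2*pi}"
    using has_integral_const_real[of "(cmod (k 0))\<^sup>2" 0 "2*pi"] by simp
  have "(cmod (w - c))\<^sup>2 = (cmod w)\<^sup>2 - 2 * Re (cnj c * w) + (cmod c)\<^sup>2" for w c
    unfolding cmod_power2 by (simp add: power2_eq_square algebra_simps)
  then have "((\<lambda>t. (cmod (k (of_real r * cis t) - k 0))\<^sup>2) has_integral
      circ_int (\<lambda>z. (cmod (k z))\<^sup>2) r - 4 * pi * (cmod (k 0))\<^sup>2 + 2 * pi * (cmod (k 0))\<^sup>2) {0..2*pi}"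
    using has_integral_add[OF has_integral_diff[OF J I] K] by simp
  then show ?thesis by (simp add: circ_int_def integral_unique)
qed

lemma hardy_mean_eq: "hardy_mean p f r = circ_int (\<lambda>z. cmod (f z) powr p) r / (2 * pi)"
  by (simp add: hardy_mean_def circ_int_def)

lemma hardy_mean_nonneg: "0 \<le> hardy_mean p f r"
  unfolding hardy_mean_def
  by (cases "(\<lambda>t. cmod (f (of_real r * cis t)) powr p) integrable_on {0..2*pi}")
     (auto intro!: divide_nonneg_nonneg integral_nonneg simp: not_integrable_integral)

lemma in_Hardy_bdd:
  assumes "in_Hardy p f" "0 < p"
  shows "bdd_above ((\<lambda>r. hardy_mean p f r powr (1/p)) ` {0<..<1})"
proof -
  obtain B where B: "\<forall>r\<in>{0<..<1}. hardy_mean p f r \<le> B"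
    using assms(1) unfolding in_Hardy_def bdd_above_def by auto
  show ?thesis
    by (rule bdd_aboveI2[where M = "B powr (1/p)"])
       (use B assms in \<open>auto intro!: powr_mono2 hardy_mean_nonneg\<close>)
qed

lemma hardy_norm_upper:
  assumes "in_Hardy p f" "0 < p" "0 < r" "r < 1"
  shows "hardy_mean p f r powr (1/p) \<le> hardy_norm p f"
  unfolding hardy_norm_def by (rule cSUP_upper[OF _ in_Hardy_bdd]) (use assms in auto)

lemma hardy_mean_le_norm:
  assumes "in_Hardy p f" "0 < p" "0 < r" "r < 1"
  shows "hardy_mean p f r \<le> hardy_norm p f powr p"
proof -
  have "(hardy_mean p f r powr (1/p)) powr p \<le> hardy_norm p f powr p"
    using assms hardy_norm_upper[OF assms] by (intro powr_mono2) auto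
  then show ?thesis using hardy_mean_nonneg[of p f r] assms by (simp add: powr_powr)
qed

text \<open>Littlewood subordination: \<open>disc_aut b\<close> maps the circle of radius \<open>r\<close> inside a circle of radius \<open>\<rho>\<close>, and the
  Poisson kernel of the latter, averaged against that of the former, is \<open>1\<close>. Since \<open>disc_aut b\<close> is an involution, no
  change of variables on the circle is needed.\<close>
lemma BMOA_poisson_le:
  assumes g: "g \<in> BMOA"
  obtains M where "0 \<le> M" "\<And>r z. 0 < r \<Longrightarrow> r < 1 \<Longrightarrow> cmod z < 1 \<Longrightarrow>
     integral {0..2*pi} (\<lambda>t. (cmod (g (of_real r * cis t)))\<^sup>2 * poisson z t) \<le> 2 * pi * ((cmod (g (of_real r * z)))\<^sup>2 + M)"
proof -
  have gh: "g holomorphic_on ball 0 1" using g by (auto simp: BMOA_def)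
  obtain N where "\<forall>a\<in>ball 0 1. hardy_norm 2 (\<lambda>z. g (disc_aut a z) - g a) \<le> N"
    using g unfolding BMOA_def bdd_above_def by auto
  then have N: "hardy_norm 2 (\<lambda>z. g (disc_aut a z) - g a) \<le> N" if "cmod a < 1" for a
    using that by auto
  have H: "in_Hardy 2 (\<lambda>z. g (disc_aut a z) - g a)" if "cmod a < 1" for a
    using g that unfolding BMOA_def by auto
  have "integral {0..2*pi} (\<lambda>t. (cmod (g (of_real r * cis t)))\<^sup>2 * poisson z t) \<le> 2 * pi * ((cmod (g (of_real r * z)))\<^sup>2 + N\<^sup>2)"
    if r: "0 < r" "r < 1" and z: "cmod z < 1" for r z
  proof -
    define b where "b = of_real r * z"
    have b: "cmod b < 1" unfolding b_def using cmod_scaled_lt_1[OF r] z by simp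
    define G where "G w = g (disc_aut b w)" for w
    have Gh: "G holomorphic_on ball 0 1"
      unfolding G_def using holomorphic_on_compose_gen[OF disc_aut_holomorphic[OF b] gh] disc_aut_lt_1[OF b]
      by (auto simp: o_def image_subset_iff)
    have Gc: "continuous_on (ball 0 1) G" by (rule holomorphic_on_imp_continuous_on[OF Gh])
    have G0: "G 0 = g b" by (simp add: G_def disc_aut_def)
    define k where "k w = disc_aut b (of_real r * w)" for w
    have rw: "cmod (of_real r * w) < 1" if "cmod w \<le> 1" for w
      by (rule cmod_scaled_lt_1[OF r that])
    have kc: "continuous_on (cball 0 1) k" unfolding k_def
      by (rule continuous_on_compose2[OF holomorphic_on_imp_continuous_on[OF disc_aut_holomorphic[OF b]]])
         (use rw in \<open>auto intro!: continuous_intros\<close>)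
    have kh: "k holomorphic_on ball 0 1" unfolding k_def
      by (rule holomorphic_on_compose_gen[unfolded o_def, OF _ disc_aut_holomorphic[OF b]])
         (use rw in \<open>auto intro!: holomorphic_intros\<close>)
    have k1: "cmod (k w) < 1" if "cmod w \<le> 1" for w
      unfolding k_def by (rule disc_aut_lt_1[OF b rw[OF that]])
    have "continuous_on (cball 0 1) (\<lambda>w. cmod (k w))" by (intro continuous_intros kc)
    then obtain w0 where w0: "w0 \<in> cball 0 1" "\<forall>w\<in>cball 0 1. cmod (k w) \<le> cmod (k w0)"
      using continuous_attains_sup[of "cball 0 1" "\<lambda>w. cmod (k w)"] by auto
    obtain \<rho> where \<rho>: "cmod (k w0) < \<rho>" "\<rho> < 1" using dense[OF k1[of w0]] w0 by auto
    then have \<rho>0: "0 < \<rho>" using le_less_trans[OF norm_ge_zero] by blast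
    \<comment> \<open>Rescaling by \<open>\<rho>\<close> makes \<open>q\<close> map the closed unit
      disc into the open one, with \<open>q z = 0\<close>, so the kernel of the unit circle can be
      used for both circles.\<close>
    define q where "q w = k w / of_real \<rho>" for w
    have q1: "cmod (q w) < 1" if "cmod w \<le> 1" for w
      using bspec[OF w0(2), of w] that \<rho> \<rho>0 by (simp add: q_def norm_divide divide_less_eq)
    have qc: "continuous_on (cball 0 1) q" and qh: "q holomorphic_on ball 0 1"
      unfolding q_def using \<rho>0 by (auto intro!: continuous_intros holomorphic_intros kc kh)
    have qz: "q z = 0" by (simp add: q_def k_def b_def[symmetric] disc_aut_def)
    let ?v = "\<lambda>\<theta>. (cmod (G (of_real \<rho> * cis \<theta>)))\<^sup>2"
    have \<rho>w: "cmod (of_real \<rho> * w) < 1" if "cmod w \<le> 1" for w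
      by (rule cmod_scaled_lt_1[OF \<rho>0 \<rho>(2) that])
    have vc: "continuous_on T (\<lambda>x. ?v (u x))" if "continuous_on T u" for T and u :: "'b::topological_space \<Rightarrow> real"
      by (intro continuous_intros continuous_on_compose2[OF Gc] that) (use \<rho>w in auto)
    have le: "2 * pi * (cmod (g (of_real r * cis t)))\<^sup>2 \<le> integral {0..2*pi} (\<lambda>\<theta>. ?v \<theta> * poisson (q (cis t)) \<theta>)" for t
    proof -
      have "2 * pi * (cmod (G (of_real \<rho> * q (cis t))))\<^sup>2 \<le> integral {0..2*pi} (\<lambda>\<theta>. ?v \<theta> * poisson (q (cis t)) \<theta>)"
      proof (rule cmod_square_le_poisson)
        show "continuous_on (cball 0 1) (\<lambda>w. G (of_real \<rho> * w))"
          by (rule continuous_on_compose2[OF Gc]) (use \<rho>w in \<open>auto intro!: continuous_intros\<close>)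
        show "(\<lambda>w. G (of_real \<rho> * w)) holomorphic_on ball 0 1"
          by (rule holomorphic_on_compose_gen[unfolded o_def, OF _ Gh])
             (use \<rho>w in \<open>auto intro!: holomorphic_intros\<close>)
      qed (simp add: q1)
      also have "of_real \<rho> * q (cis t) = k (cis t)" using \<rho>0 by (simp add: q_def)
      also have "G (k (cis t)) = g (of_real r * cis t)"
        unfolding G_def k_def by (simp add: disc_aut_involution[OF b rw])
      finally show ?thesis .
    qed
    have Pc: "continuous_on T (\<lambda>x. poisson (q (cis (u x))) (w x))" if "continuous_on T u" "continuous_on T w"
      for T and u w :: "'b::topological_space \<Rightarrow> real"
      by (intro continuous_on_poisson that continuous_on_compose2[OF qc] continuous_intros) (auto simp: q1)
    have Pz: "continuous_on T (\<lambda>x. poisson z (w x))" if "continuous_on T w" for T and w :: "'b::topological_space \<Rightarrow> real"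
      by (intro continuous_on_poisson that continuous_intros) (use z in auto)
    have gc: "continuous_on {0..2*pi} (\<lambda>t. (cmod (g (of_real r * cis t)))\<^sup>2)"
      using continuous_on_circle[OF holomorphic_on_imp_continuous_on[OF gh]] r by (intro continuous_intros) auto
    have c2: "continuous_on (cbox (0,0) (2*pi,2*pi)) (\<lambda>(t,\<theta>). ?v \<theta> * poisson (q (cis t)) \<theta> * poisson z t)"
      unfolding case_prod_beta by (intro continuous_intros vc Pc Pz)
    have "2 * pi * integral {0..2*pi} (\<lambda>t. (cmod (g (of_real r * cis t)))\<^sup>2 * poisson z t)
        = integral {0..2*pi} (\<lambda>t. 2 * pi * (cmod (g (of_real r * cis t)))\<^sup>2 * poisson z t)"
      by (simp add: mult.assoc)
    also have "\<dots> \<le> integral {0..2*pi} (\<lambda>t. integral {0..2*pi} (\<lambda>\<theta>. ?v \<theta> * poisson (q (cis t)) \<theta> * poisson z t))"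
    proof (rule integral_le)
      show "(\<lambda>t. 2 * pi * (cmod (g (of_real r * cis t)))\<^sup>2 * poisson z t) integrable_on {0..2*pi}"
        by (intro integrable_continuous_real continuous_intros gc Pz)
      have "continuous_on {0..2*pi} (\<lambda>t. integral (cbox 0 (2*pi)) (\<lambda>\<theta>. ?v \<theta> * poisson (q (cis t)) \<theta> * poisson z t))"
        by (rule integral_continuous_on_param) (unfold case_prod_beta, intro continuous_intros vc Pc Pz)
      then show "(\<lambda>t. integral {0..2*pi} (\<lambda>\<theta>. ?v \<theta> * poisson (q (cis t)) \<theta> * poisson z t)) integrable_on {0..2*pi}"
        by (simp add: integrable_continuous_real)
      fix t :: real
      show "2 * pi * (cmod (g (of_real r * cis t)))\<^sup>2 * poisson z t
          \<le> integral {0..2*pi} (\<lambda>\<theta>. ?v \<theta> * poisson (q (cis t)) \<theta> * poisson z t)"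
        using mult_right_mono[OF le[of t] poisson_nonneg[OF z]] by (simp only: integral_mult_left)
    qed
    also have "\<dots> = integral {0..2*pi} (\<lambda>\<theta>. integral {0..2*pi} (\<lambda>t. ?v \<theta> * poisson (q (cis t)) \<theta> * poisson z t))"
      using integral_swap_continuous[OF c2] by simp
    also have "\<dots> = integral {0..2*pi} (\<lambda>\<theta>. ?v \<theta> * (2 * pi))"
    proof (rule integral_cong)
      fix \<theta> :: real
      \<comment> \<open>\<open>poisson (q w) \<theta>\<close> is harmonic in \<open>w\<close>, being
        the real part of \<open>?k w\<close>. Its Poisson integral at \<open>z\<close> is therefore
        a multiple of its value there, namely
        \<open>2 * pi * poisson 0 \<theta> = 2 * pi\<close>.\<close>
      let ?k = "\<lambda>w. (cis \<theta> + q w) / (cis \<theta> - q w)"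
      have "((\<lambda>t. Re (?k (cis t)) * poisson z t) has_integral 2 * pi * Re (?k z)) {0..2*pi}"
      proof (rule poisson_Re)
        show "continuous_on (cball 0 1) ?k"
          using cis_ne[OF q1] by (auto intro!: continuous_intros qc)
        show "?k holomorphic_on ball 0 1"
          using cis_ne[OF q1] by (auto intro!: holomorphic_intros qh simp: less_imp_le)
      qed (rule z)
      then have "((\<lambda>t. poisson (q (cis t)) \<theta> * poisson z t) has_integral 2 * pi) {0..2*pi}"
        using qz by (simp add: poisson_eq_Re q1 del: Re_divide)
      from has_integral_mult_right[OF this, of "?v \<theta>"]
      show "integral {0..2*pi} (\<lambda>t. ?v \<theta> * poisson (q (cis t)) \<theta> * poisson z t) = ?v \<theta> * (2 * pi)"
        by (intro integral_unique) (simp add: mult.assoc)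
    qed
    also have "\<dots> = 2 * pi * circ_int (\<lambda>w. (cmod (G w))\<^sup>2) \<rho>"
      by (simp add: circ_int_def mult.commute)
    finally have 1: "integral {0..2*pi} (\<lambda>t. (cmod (g (of_real r * cis t)))\<^sup>2 * poisson z t) \<le> circ_int (\<lambda>w. (cmod (G w))\<^sup>2) \<rho>"
      by simp
    have nn: "0 \<le> hardy_norm 2 (\<lambda>z. g (disc_aut b z) - g b)"
      by (rule order_trans[OF _ hardy_norm_upper[OF H[OF b], of "1/2"]]) auto
    have "hardy_mean 2 (\<lambda>z. g (disc_aut b z) - g b) \<rho> \<le> hardy_norm 2 (\<lambda>z. g (disc_aut b z) - g b) powr 2"
      by (rule hardy_mean_le_norm[OF H[OF b]]) (use \<rho> \<rho>0 in auto)
    also have "\<dots> \<le> N powr 2"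
      by (rule powr_mono2[OF _ nn N[OF b]]) simp
    also have "\<dots> = N\<^sup>2" using order_trans[OF nn N[OF b]] by simp
    finally have "circ_int (\<lambda>w. (cmod (G w - G 0))\<^sup>2) \<rho> \<le> 2 * pi * N\<^sup>2"
      unfolding G0 unfolding G_def by (simp add: hardy_mean_eq field_simps)
    with 1 show ?thesis
      using circ_int_variance[OF Gh \<rho>0 \<rho>(2)] by (simp add: G0 b_def algebra_simps)
  qed
  then show ?thesis by (intro that[of "N\<^sup>2"]) auto
qed

text \<open>The majorant on the disc of radius \<open>r\<close> is the Poisson integral of the
  values of \<open>|g|^2\<close> on its bounding circle, completed by \<open>herglotz\<close>. A
  single \<open>M\<close> serves all \<open>r\<close>. The bound on the means is the estimate of
  \<open>BMOA_poisson_le\<close> at \<open>z = 0\<close>.\<close>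

lemma BMOA_majorant:
  assumes g: "g \<in> BMOA"
  obtains M where "0 \<le> M"
    "\<And>r. 0 < r \<Longrightarrow> r < 1 \<Longrightarrow> circ_int (\<lambda>z. (cmod (g z))\<^sup>2) r \<le> 2 * pi * ((cmod (g 0))\<^sup>2 + M)"
    "\<And>r. 0 < r \<Longrightarrow> r < 1 \<Longrightarrow> \<exists>H. H holomorphic_on ball 0 r \<and>
       (\<forall>z\<in>ball 0 r. (cmod (g z))\<^sup>2 \<le> Re (H z) \<and> Re (H z) \<le> (cmod (g z))\<^sup>2 + M)"
proof -
  have gh: "g holomorphic_on ball 0 1" using g by (auto simp: BMOA_def)
  obtain M where M: "0 \<le> M" "\<And>r z. 0 < r \<Longrightarrow> r < 1 \<Longrightarrow> cmod z < 1 \<Longrightarrow>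
     integral {0..2*pi} (\<lambda>t. (cmod (g (of_real r * cis t)))\<^sup>2 * poisson z t) \<le> 2 * pi * ((cmod (g (of_real r * z)))\<^sup>2 + M)"
    by (rule BMOA_poisson_le[OF g]) auto
  show ?thesis
  proof (rule that[OF M(1)])
    fix r :: real assume r: "0 < r" "r < 1"
    show "circ_int (\<lambda>z. (cmod (g z))\<^sup>2) r \<le> 2 * pi * ((cmod (g 0))\<^sup>2 + M)"
      using M(2)[OF r, of 0] by (simp add: poisson_0 circ_int_def)
    have rw: "cmod (of_real r * w) < 1" if "cmod w \<le> 1" for w
      by (rule cmod_scaled_lt_1[OF r that])
    have "continuous_on {0..2*pi} (\<lambda>t. (cmod (g (of_real r * cis t)))\<^sup>2)"
      using continuous_on_circle[OF holomorphic_on_imp_continuous_on[OF gh]] r by (intro continuous_intros) auto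
    then obtain H where H: "H holomorphic_on ball 0 1"
      "\<And>z. cmod z < 1 \<Longrightarrow> Re (H z) = integral {0..2*pi} (\<lambda>t. (cmod (g (of_real r * cis t)))\<^sup>2 * poisson z t)"
      by (rule herglotz) auto
    have lt: "cmod (z / of_real r) < 1" if "cmod z < r" for z using that r by (simp add: norm_divide divide_less_eq)
    show "\<exists>H. H holomorphic_on ball 0 r \<and>
       (\<forall>z\<in>ball 0 r. (cmod (g z))\<^sup>2 \<le> Re (H z) \<and> Re (H z) \<le> (cmod (g z))\<^sup>2 + M)"
    proof (intro exI[of _ "\<lambda>z. H (z / of_real r) / (2 * pi)"] conjI ballI)
      have "(\<lambda>z. H (z / of_real r)) holomorphic_on ball 0 r"
        by (rule holomorphic_on_compose_gen[unfolded o_def, OF _ H(1)])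
           (use r lt in \<open>auto intro!: holomorphic_intros\<close>)
      then show "(\<lambda>z. H (z / of_real r) / (2 * pi)) holomorphic_on ball 0 r"
        by (intro holomorphic_intros) auto
    next
      fix z :: complex assume "z \<in> ball 0 r"
      then have z: "cmod (z / of_real r) < 1" using lt by simp
      have e: "of_real r * (z / of_real r) = z" using r by simp
      have R: "Re (H (z / of_real r) / (2 * pi)) = Re (H (z / of_real r)) / (2 * pi)"
        by (rule Re_divide_of_real)
      show "Re (H (z / of_real r) / (2 * pi)) \<le> (cmod (g z))\<^sup>2 + M"
        using M(2)[OF r z] unfolding R H(2)[OF z] e by (simp add: field_simps)
      have "2 * pi * (cmod (g (of_real r * (z / of_real r))))\<^sup>2
          \<le> integral {0..2*pi} (\<lambda>t. (cmod (g (of_real r * cis t)))\<^sup>2 * poisson (z / of_real r) t)"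
      proof (rule cmod_square_le_poisson[OF _ _ z])
        show "continuous_on (cball 0 1) (\<lambda>w. g (of_real r * w))"
          by (rule continuous_on_compose2[OF holomorphic_on_imp_continuous_on[OF gh]]) (use rw in \<open>auto intro!: continuous_intros\<close>)
        show "(\<lambda>w. g (of_real r * w)) holomorphic_on ball 0 1"
          by (rule holomorphic_on_compose_gen[unfolded o_def, OF _ gh])
             (use rw in \<open>auto intro!: holomorphic_intros\<close>)
      qed
      then show "(cmod (g z))\<^sup>2 \<le> Re (H (z / of_real r) / (2 * pi))"
        unfolding R H(2)[OF z] e by (simp add: field_simps)
    qed
  qed
qed

section \<open>The Volterra operator on Hardy spaces\<close>

lemma volterra_primitive:
  assumes f: "f holomorphic_on ball 0 1" and g: "g holomorphic_on ball 0 1"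
  shows "volterra g f holomorphic_on ball 0 1" "z \<in> ball 0 1 \<Longrightarrow> deriv (volterra g f) z = f z * deriv g z"
    "volterra g f 0 = 0"
proof -
  have "(\<lambda>z. f z * deriv g z) holomorphic_on ball 0 1"
    by (intro holomorphic_intros f g) auto
  then obtain G where G: "\<And>x. x \<in> ball 0 1 \<Longrightarrow> (G has_field_derivative f x * deriv g x) (at x within ball 0 1)"
    using holomorphic_convex_primitive'[OF convex_ball open_ball] by blast
  have G': "(G has_field_derivative f x * deriv g x) (at x)" if "x \<in> ball 0 1" for x
    using G[OF that] at_within_open[OF that open_ball] by simp
  have V: "volterra g f z = G z - G 0" if z: "z \<in> ball 0 1" for z
  proof -
    have "((\<lambda>t. f (of_real t * z) * deriv g (of_real t * z) * z) has_integral G (of_real 1 * z) - G (of_real 0 * z)) {0..1}"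
    proof (rule fundamental_theorem_of_calculus)
      fix t :: real assume t: "t \<in> {0..1}"
      have "cmod (of_real t * z) \<le> 1 * cmod z"
        unfolding norm_mult using t by (intro mult_right_mono) auto
      then have "of_real t * z \<in> ball 0 1" using z by simp
      have "((\<lambda>t. of_real t * z) has_vector_derivative z) (at t)"
        by (auto simp: has_vector_derivative_def scaleR_conv_of_real intro!: derivative_eq_intros)
      from field_vector_diff_chain_at[OF this G'[OF \<open>of_real t * z \<in> ball 0 1\<close>]]
      have "((\<lambda>t. G (of_real t * z)) has_vector_derivative z * (f (of_real t * z) * deriv g (of_real t * z))) (at t)"
        by (simp only: o_def)
      then show "((\<lambda>t. G (of_real t * z)) has_vector_derivative f (of_real t * z) * deriv g (of_real t * z) * z) (at t within {0..1})"
        by (simp add: mult.commute has_vector_derivative_at_within)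
    qed simp
    then show ?thesis unfolding volterra_def by (intro integral_unique) simp
  qed
  have D: "(volterra g f has_field_derivative f z * deriv g z) (at z)" if "z \<in> ball 0 1" for z
  proof (rule has_field_derivative_transform_within_open[OF _ open_ball that])
    show "((\<lambda>z. G z - G 0) has_field_derivative f z * deriv g z) (at z)"
      using G'[OF that] by (auto intro!: derivative_eq_intros)
  qed (simp add: V)
  then show "volterra g f holomorphic_on ball 0 1"
    unfolding holomorphic_on_open[OF open_ball] by blast
  show "z \<in> ball 0 1 \<Longrightarrow> deriv (volterra g f) z = f z * deriv g z"
    by (rule DERIV_imp_deriv[OF D])
  show "volterra g f 0 = 0" by (simp add: volterra_def)
qed

lemma volterra_bound:
  assumes f: "f holomorphic_on ball 0 1" and g: "g holomorphic_on ball 0 1" and \<rho>: "\<rho> < 1"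
    and A: "\<And>w. cmod w \<le> \<rho> \<Longrightarrow> cmod (f w) \<le> A" and B: "\<And>w. cmod w \<le> \<rho> \<Longrightarrow> cmod (deriv g w) \<le> B"
    and z: "cmod z \<le> \<rho>"
  shows "cmod (volterra g f z) \<le> A * B"
proof -
  have tz: "cmod (of_real t * z) \<le> cmod z" if "t \<in> {0..1}" for t
    unfolding norm_mult using that by (intro mult_left_le_one_le) auto
  have g': "deriv g holomorphic_on ball 0 1" by (intro holomorphic_deriv g) simp
  have le: "cmod (f (of_real t * z) * deriv g (of_real t * z) * z) \<le> A * B" if t: "t \<in> {0..1}" for t
  proof -
    have "cmod (of_real t * z) \<le> \<rho>" using tz[OF t] z by simp
    then have "cmod (f (of_real t * z)) * cmod (deriv g (of_real t * z)) * cmod z \<le> A * B * 1"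
      using A B z \<rho> order_trans[OF norm_ge_zero A[OF z]] order_trans[OF norm_ge_zero B[OF z]]
      by (intro mult_mono) auto
    then show ?thesis by (simp add: norm_mult)
  qed
  have "cmod (integral {0..1} (\<lambda>t::real. f (of_real t * z) * deriv g (of_real t * z) * z)) \<le> integral {0..1} (\<lambda>t::real. A * B)"
  proof (rule integral_norm_bound_integral)
    show "(\<lambda>t::real. f (of_real t * z) * deriv g (of_real t * z) * z) integrable_on {0..1}"
      by (intro integrable_continuous_real continuous_intros
          continuous_on_compose2[OF holomorphic_on_imp_continuous_on[OF f]]
          continuous_on_compose2[OF holomorphic_on_imp_continuous_on[OF g']])
         (use le_less_trans[OF order_trans[OF tz z] \<rho>] in auto)
  qed (use le in auto)
  then show ?thesis unfolding volterra_def by simp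
qed

lemma volterra_uniform_small:
  assumes f: "\<And>n. f n holomorphic_on ball 0 1" and g: "g holomorphic_on ball 0 1" and \<rho>: "\<rho> < 1"
    and lim: "\<And>K. compact K \<Longrightarrow> K \<subseteq> ball 0 1 \<Longrightarrow> uniform_limit K f (\<lambda>_. 0) sequentially"
    and d: "0 < \<delta>"
  shows "\<forall>\<^sub>F n in sequentially. \<forall>z. cmod z \<le> \<rho> \<longrightarrow> cmod (f n z) \<le> \<delta> \<and> cmod (volterra g (f n) z) \<le> \<delta>"
proof -
  have sub: "cball (0::complex) \<rho> \<subseteq> ball 0 1" using \<rho> by auto
  have g': "deriv g holomorphic_on ball 0 1" by (intro holomorphic_deriv g) simp
  have "bounded (deriv g ` cball 0 \<rho>)"
    by (intro compact_imp_bounded compact_continuous_image compact_cball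
        holomorphic_on_imp_continuous_on holomorphic_on_subset[OF g' sub])
  then obtain B where B: "0 < B" "\<And>w. w \<in> cball 0 \<rho> \<Longrightarrow> cmod (deriv g w) \<le> B"
    unfolding bounded_pos by auto
  define e where "e = min \<delta> (\<delta> / B)"
  have e: "0 < e" "e \<le> \<delta>" "e * B \<le> \<delta>" using d B(1) by (auto simp: e_def min_def field_simps)
  have "\<forall>\<^sub>F n in sequentially. \<forall>z\<in>cball 0 \<rho>. dist (f n z) 0 < e"
    using lim[OF compact_cball sub] e(1) by (rule uniform_limitD)
  then show ?thesis
  proof eventually_elim
    case (elim n)
    have "cmod (volterra g (f n) z) \<le> e * B" if "cmod z \<le> \<rho>" for z
      by (rule volterra_bound[OF f g \<rho>]) (use elim B that in \<open>auto intro: less_imp_le\<close>)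
    moreover have "cmod (f n z) \<le> \<delta>" if "cmod z \<le> \<rho>" for z
      using bspec[OF elim, of z] that e by simp
    ultimately show ?case using e(3) by fastforce
  qed
qed

lemma add_powr_le:
  fixes x y s :: real
  assumes "0 \<le> x" "0 \<le> y" "0 \<le> s"
  shows "(x + y) powr s \<le> 2 powr s * (x powr s + y powr s)"
proof -
  have "(x + y) powr s \<le> (2 * max x y) powr s"
    by (rule powr_mono2) (use assms in auto)
  also have "\<dots> = 2 powr s * max x y powr s" using assms by (simp add: powr_mult)
  also have "\<dots> \<le> 2 powr s * (x powr s + y powr s)"
    by (intro mult_left_mono) (auto simp: max_def)
  finally show ?thesis .
qed

lemma square_powr_half: "((cmod z)\<^sup>2) powr (p / 2) = cmod z powr p"
proof -
  have "(cmod z)\<^sup>2 = cmod z powr 2" by (cases "z = 0") (simp_all add: powr_numeral)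
  then show ?thesis by (simp only: powr_powr) simp
qed

lemma continuous_on_norm_powr:
  assumes "continuous_on S h" "0 < p"
  shows "continuous_on S (\<lambda>z. cmod (h z) powr p)"
  by (rule continuous_on_powr') (use assms in \<open>auto intro!: continuous_intros\<close>)

lemma continuous_on_Q_powr:
  assumes "continuous_on S h"
  shows "continuous_on S (\<lambda>z. ((cmod (h z))\<^sup>2 + 1) powr s)"
  by (intro continuous_intros assms) (auto simp: add_nonneg_eq_0_iff)

lemma circ_int_Q_le:
  assumes h: "h holomorphic_on ball 0 1" and R: "0 < R" "R < 1" and p: "0 < p"
    and B: "circ_int (\<lambda>z. cmod (h z) powr p) R \<le> B"
  shows "circ_int (\<lambda>z. ((cmod (h z))\<^sup>2 + 1) powr (p/2)) R \<le> 2 powr (p/2) * (B + 2 * pi)"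
proof -
  have c: "continuous_on (ball 0 1) h" by (rule holomorphic_on_imp_continuous_on[OF h])
  note cp = continuous_on_norm_powr[OF c p]
  have "circ_int (\<lambda>z. ((cmod (h z))\<^sup>2 + 1) powr (p/2)) R \<le> circ_int (\<lambda>z. 2 powr (p/2) * (cmod (h z) powr p + 1)) R"
  proof (rule circ_int_mono[OF continuous_on_Q_powr[OF c]])
    show "continuous_on (ball 0 1) (\<lambda>z. 2 powr (p/2) * (cmod (h z) powr p + 1))"
      by (intro continuous_intros cp)
    show "((cmod (h z))\<^sup>2 + 1) powr (p/2) \<le> 2 powr (p/2) * (cmod (h z) powr p + 1)" for z
      using add_powr_le[of "(cmod (h z))\<^sup>2" 1 "p/2"] p by (simp add: square_powr_half)
  qed (use R in auto)
  also have "\<dots> = 2 powr (p/2) * (circ_int (\<lambda>z. cmod (h z) powr p) R + 2 * pi)"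
    using circ_int_add[OF cp continuous_on_const, of R 1] R by (simp add: circ_int_cmult circ_int_const)
  also have "\<dots> \<le> 2 powr (p/2) * (B + 2 * pi)" by (intro mult_left_mono add_right_mono B) auto
  finally show ?thesis .
qed

lemma BMOA_volterra_disc:
  assumes f: "f holomorphic_on ball 0 1" and g: "g holomorphic_on ball 0 1"
    and H: "H holomorphic_on ball 0 r" "\<forall>z\<in>ball 0 r. (cmod (g z))\<^sup>2 \<le> Re (H z) \<and> Re (H z) \<le> (cmod (g z))\<^sup>2 + M"
    and r: "r < 1"
  shows "volterra_disc r M f g (volterra g f) H"
proof
  have sub: "ball (0::complex) r \<subseteq> ball 0 1" using r by auto
  show "f holomorphic_on ball 0 r" "g holomorphic_on ball 0 r" "volterra g f holomorphic_on ball 0 r"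
    using holomorphic_on_subset[OF _ sub] f g volterra_primitive(1)[OF f g] by blast+
  show "\<And>z. z \<in> ball 0 r \<Longrightarrow> deriv (volterra g f) z = f z * deriv g z"
    using volterra_primitive(2)[OF f g] sub by blast
qed (use H in auto)

text \<open>The hypothesis on \<open>f\<close> expresses a norm of at most 1 in terms of circle
  integrals. For given \<open>R\<close> the locale is instantiated on a slightly larger disc; its
  constant does not depend on that disc.\<close>

lemma volterra_Hardy_bounded:
  assumes g: "g \<in> BMOA" and p: "0 < p"
  obtains C where "\<And>f R. f holomorphic_on ball 0 1 \<Longrightarrow>
     (\<And>R. 0 < R \<Longrightarrow> R < 1 \<Longrightarrow> circ_int (\<lambda>z. cmod (f z) powr p) R \<le> 2 * pi) \<Longrightarrow> 0 < R \<Longrightarrow> R < 1 \<Longrightarrow>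
     circ_int (\<lambda>z. ((cmod (volterra g f z))\<^sup>2 + 1) powr (p/2)) R \<le> C"
proof -
  have gh: "g holomorphic_on ball 0 1" using g by (auto simp: BMOA_def)
  obtain M where M0: "0 \<le> M"
    and \<Gamma>: "\<And>r. 0 < r \<Longrightarrow> r < 1 \<Longrightarrow> circ_int (\<lambda>z. (cmod (g z))\<^sup>2) r \<le> 2 * pi * ((cmod (g 0))\<^sup>2 + M)"
    and M: "\<And>r. 0 < r \<Longrightarrow> r < 1 \<Longrightarrow> \<exists>H. H holomorphic_on ball 0 r \<and>
       (\<forall>z\<in>ball 0 r. (cmod (g z))\<^sup>2 \<le> Re (H z) \<and> Re (H z) \<le> (cmod (g z))\<^sup>2 + M)"
    by (rule BMOA_majorant[OF g]) (rule that)
  show ?thesis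
  proof (rule that)
    fix f R assume f: "f holomorphic_on ball 0 1"
      and fb: "\<And>R. 0 < R \<Longrightarrow> R < 1 \<Longrightarrow> circ_int (\<lambda>z. cmod (f z) powr p) R \<le> 2 * pi"
      and R: "0 < (R::real)" "R < 1"
    define r where "r = (R + 1) / 2"
    have r: "0 < r" "r < 1" "R < r" using R by (auto simp: r_def)
    obtain H where H: "H holomorphic_on ball 0 r" "\<forall>z\<in>ball 0 r. (cmod (g z))\<^sup>2 \<le> Re (H z) \<and> Re (H z) \<le> (cmod (g z))\<^sup>2 + M"
      using M[OF r(1,2)] by blast
    interpret volterra_disc r M f g "volterra g f" H
      by (rule BMOA_volterra_disc[OF f gh H r(2)])
    have "circ_int (\<lambda>z. ((cmod (volterra g f z))\<^sup>2 + 1) powr (p/2)) R \<le> bound_const (p/2) * circ_int (\<lambda>z. Q z powr (p/2)) R"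
      by (rule volterra_bounded) (use p R r volterra_primitive(3)[OF f gh] in auto)
    also have "\<dots> \<le> bound_const (p/2) * (2 powr (p/2) * (2 * pi + 2 * pi))"
    proof (rule mult_left_mono)
      show "circ_int (\<lambda>z. Q z powr (p/2)) R \<le> 2 powr (p/2) * (2 * pi + 2 * pi)"
        unfolding Q_def by (rule circ_int_Q_le[OF f R p fb[OF R]])
      show "0 \<le> bound_const (p/2)" using p by (auto simp: bound_const_def)
    qed
    finally show "circ_int (\<lambda>z. ((cmod (volterra g f z))\<^sup>2 + 1) powr (p/2)) R
       \<le> volterra_disc.bound_const M (p/2) * (2 powr (p/2) * (2 * pi + 2 * pi))" .
  qed
qed

text \<open>Take \<open>\<rho>\<close> with \<open>m \<rho>\<close> within \<open>e\<close> of the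
  supremum; the conclusion then holds for \<open>R\<close> on either side of
  \<open>\<rho>\<close>.\<close>

lemma increasing_bounded_Cauchy:
  fixes m :: "real \<Rightarrow> real"
  assumes B: "\<And>R. 0 < R \<Longrightarrow> R < 1 \<Longrightarrow> m R \<le> B" and e: "0 < e"
  obtains \<rho> where "0 < \<rho>" "\<rho> < 1" "\<And>R. 0 < R \<Longrightarrow> R < 1 \<Longrightarrow> m R - m \<rho> \<le> e"
proof -
  have bdd: "bdd_above (m ` {0<..<1})" by (rule bdd_aboveI2) (use B in auto)
  have "(SUP R\<in>{0<..<1}. m R) - e < (SUP R\<in>{0<..<1}. m R)" using e by simp
  then obtain \<rho> where \<rho>: "\<rho> \<in> {0<..<1}" "(SUP R\<in>{0<..<1}. m R) - e < m \<rho>"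
    using less_cSUP_iff[OF _ bdd] by (metis dense greaterThanLessThan_empty_iff zero_less_one linorder_not_less)
  have "m R - m \<rho> \<le> e" if "0 < R" "R < 1" for R
    using cSUP_upper[OF _ bdd, of R] that \<rho>(2) by auto
  then show ?thesis using \<rho> that by auto
qed

text \<open>Either \<open>k * x powr (t - s)\<close> is at least 1 and the first summand dominates,
  or \<open>x\<close> is bounded in terms of \<open>k\<close>.\<close>

lemma powr_interpolate:
  fixes s t k x :: real
  assumes "0 < s" "s < t" "0 < k" "1 \<le> x"
  shows "x powr s \<le> k * x powr t + (1/k) powr (s / (t - s))"
proof (cases "1 \<le> k * x powr (t - s)")
  case True
  have "x powr s = x powr s * 1" by simp
  also have "\<dots> \<le> x powr s * (k * x powr (t - s))" by (intro mult_left_mono True) auto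
  also have "\<dots> = k * x powr t" by (simp flip: powr_add)
  finally show ?thesis by (simp add: add_increasing2)
next
  case False
  then have "x powr (t - s) \<le> 1 / k" using assms by (simp add: field_simps)
  then have "(x powr (t - s)) powr (s / (t - s)) \<le> (1 / k) powr (s / (t - s))"
    using assms by (intro powr_mono2) auto
  then show ?thesis using assms by (simp add: powr_powr add_increasing)
qed

text \<open>\<open>volterra_small_growth\<close> with exponents \<open>1/4\<close> and
  \<open>p/2\<close> controls the growth from a circle of radius \<open>\<rho>\<close> near the
  boundary; on the disc inside it \<open>f n\<close> and its transform are uniformly small. The
  exponent \<open>1/2\<close> of \<open>|F|\<close> corresponds to \<open>1/4\<close> for
  \<open>|F|^2\<close>.\<close>

lemma volterra_small_in_measure:
  assumes g: "g \<in> BMOA" and p: "1 \<le> p" and f: "\<And>n. f n holomorphic_on ball 0 1"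
    and fb: "\<And>n R. 0 < R \<Longrightarrow> R < 1 \<Longrightarrow> circ_int (\<lambda>z. cmod (f n z) powr p) R \<le> 2 * pi"
    and lim: "\<And>K. compact K \<Longrightarrow> K \<subseteq> ball 0 1 \<Longrightarrow> uniform_limit K f (\<lambda>_. 0) sequentially"
    and e: "0 < e"
  shows "\<forall>\<^sub>F n in sequentially. \<forall>R. 0 < R \<longrightarrow> R < 1 \<longrightarrow> circ_int (\<lambda>z. cmod (volterra g (f n) z) powr (1/2)) R \<le> e"
proof -
  have gh: "g holomorphic_on ball 0 1" using g by (auto simp: BMOA_def)
  obtain M where M0: "0 \<le> M"
    and \<Gamma>: "\<And>r. 0 < r \<Longrightarrow> r < 1 \<Longrightarrow> circ_int (\<lambda>z. (cmod (g z))\<^sup>2) r \<le> 2 * pi * ((cmod (g 0))\<^sup>2 + M)"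
    and M: "\<And>r. 0 < r \<Longrightarrow> r < 1 \<Longrightarrow> \<exists>H. H holomorphic_on ball 0 r \<and>
       (\<forall>z\<in>ball 0 r. (cmod (g z))\<^sup>2 \<le> Re (H z) \<and> Re (H z) \<le> (cmod (g z))\<^sup>2 + M)"
    by (rule BMOA_majorant[OF g]) (rule that)
  define D where "D = 2 powr (p/2) * (2 * pi + 2 * pi)"
  have D: "0 < D" by (simp add: D_def)
  define K where "K = 4 * D + 6 * pi"
  have K: "0 < K" using D by (auto simp: K_def intro!: add_pos_pos)
  \<comment> \<open>Half of \<open>e\<close> is spent on
    \<open>l powr (1/4) * (4 * D + 6 * pi)\<close>: \<open>4 * D\<close> is the \<open>Q\<close>
    term with \<open>1 / s = 4\<close>, and \<open>6 * pi\<close> bounds the inner part, where the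
    base is at most \<open>3 * l\<close>. The \<open>k\<close> term and the growth of the mean of
    \<open>|g|^2\<close> receive a quarter each. As the factor \<open>l powr (1/4 - 1)\<close> is
    large, \<open>l\<close> is fixed before \<open>k\<close>, \<open>C\<close>, \<open>e'\<close>
    and finally \<open>\<rho>\<close>.\<close>
  define l where "l = (e / (2 * K)) ^ 4"
  have l: "0 < l" using e K by (simp add: l_def)
  have "l powr (1/4) = e / (2 * K)"
  proof -
    have "l = (e / (2 * K)) powr 4" using e K by (simp add: l_def)
    then show ?thesis using e K by (simp only: powr_powr) simp
  qed
  then have l4: "l powr (1/4) * (4 * D + 6 * pi) = e / 2" using K by (simp add: flip: K_def)
  define k where "k = e / 4 / (1/4 * l powr (1/4 - 1) * exp M * D)"
  have k: "0 < k" using e l D by (simp add: k_def)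
  have k': "1/4 * l powr (1/4 - 1) * (k * exp M * D) = e / 4" using l D by (simp add: k_def field_simps)
  define C where "C = (1/k) powr ((1/4) / (p/2 - 1/4))"
  have C: "0 < C" using k by (simp add: C_def)
  define e' where "e' = e / 4 / (1/4 * l powr (1/4 - 1) * C)"
  have e': "0 < e'" "1/4 * l powr (1/4 - 1) * (C * e') = e / 4" using e l C by (auto simp: e'_def field_simps)
  obtain \<rho> where \<rho>: "0 < \<rho>" "\<rho> < 1" "\<And>R. 0 < R \<Longrightarrow> R < 1 \<Longrightarrow>
      circ_int (\<lambda>z. (cmod (g z))\<^sup>2) R - circ_int (\<lambda>z. (cmod (g z))\<^sup>2) \<rho> \<le> e'"
    using increasing_bounded_Cauchy[of "circ_int (\<lambda>z. (cmod (g z))\<^sup>2)", OF \<Gamma> e'(1)] by blast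
  define \<delta> where "\<delta> = min 1 (sqrt l)"
  have \<delta>: "0 < \<delta>" "\<delta> \<le> 1" "\<delta>\<^sup>2 \<le> l"
    using l power_mono[of \<delta> "sqrt l" 2] by (auto simp: \<delta>_def)
  have "\<forall>\<^sub>F n in sequentially. \<forall>z. cmod z \<le> \<rho> \<longrightarrow> cmod (f n z) \<le> \<delta> \<and> cmod (volterra g (f n) z) \<le> \<delta>"
    by (rule volterra_uniform_small[OF f gh \<rho>(2) lim \<delta>(1)])
  then show ?thesis
  proof eventually_elim
    case (elim n)
    let ?F = "volterra g (f n)"
    let ?X = "\<lambda>z. ((cmod (?F z))\<^sup>2 + l * ((cmod (f n z))\<^sup>2 + 1)) powr (1/4)"
    have Fh: "?F holomorphic_on ball 0 1" by (rule volterra_primitive(1)[OF f gh])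
    note cont = holomorphic_on_imp_continuous_on[OF Fh] holomorphic_on_imp_continuous_on[OF f[of n]]
    have pos: "0 < (cmod (?F z))\<^sup>2 + l * ((cmod (f n z))\<^sup>2 + 1)" for z
      using l by (intro add_nonneg_pos mult_pos_pos) auto
    have cX: "continuous_on (ball 0 1) ?X"
      by (intro continuous_intros cont) (use pos less_imp_neq[OF pos] in auto)
    have FX: "circ_int (\<lambda>z. cmod (?F z) powr (1/2)) R \<le> circ_int ?X R" if R: "0 < R" "R < 1" for R
    proof (rule circ_int_mono[OF continuous_on_norm_powr[OF cont(1)] cX])
      fix z
      have "cmod (?F z) powr (1/2) = ((cmod (?F z))\<^sup>2) powr (1/4)"
        using square_powr_half[of "?F z" "1/2"] by simp
      also have "\<dots> \<le> ?X z" by (rule powr_mono2) (use l in auto)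
      finally show "cmod (?F z) powr (1/2) \<le> ?X z" .
    qed (use R in auto)
    have small: "circ_int ?X R \<le> 6 * pi * l powr (1/4)" if R: "0 < R" "R \<le> \<rho>" for R
    proof -
      have "circ_int ?X R \<le> circ_int (\<lambda>_. 3 * l powr (1/4)) R"
      proof (rule circ_int_mono[OF cX continuous_on_const])
        fix z assume z: "cmod z = R"
        then have "cmod (f n z) \<le> \<delta>" "cmod (?F z) \<le> \<delta>" using elim R by auto
        then have "(cmod (f n z))\<^sup>2 \<le> 1" "(cmod (?F z))\<^sup>2 \<le> \<delta>\<^sup>2"
          using \<delta> by (auto intro!: power_mono power_le_one)
        then have "(cmod (?F z))\<^sup>2 + l * ((cmod (f n z))\<^sup>2 + 1) \<le> l + l * (1 + 1)"
          using l \<delta>(3) by (intro add_mono mult_left_mono) auto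
        then have "?X z \<le> (3 * l) powr (1/4)" using l by (intro powr_mono2) auto
        also have "\<dots> = 3 powr (1/4) * l powr (1/4)" using l by (simp add: powr_mult)
        also have "\<dots> \<le> 3 powr 1 * l powr (1/4)" by (intro mult_right_mono powr_mono) auto
        finally show "?X z \<le> 3 * l powr (1/4)" by simp
      qed (use R \<rho> in auto)
      then show ?thesis by (simp add: circ_int_const)
    qed
    have "circ_int ?X R \<le> e" if R: "0 < R" "R < 1" for R
    proof (cases "R \<le> \<rho>")
      case True
      have "6 * pi * l powr (1/4) \<le> l powr (1/4) * (4 * D + 6 * pi)" using D by (simp add: algebra_simps)
      then show ?thesis using small[OF R(1) True] l4 e by linarith
    next
      case False
      define r where "r = (R + 1) / 2"
      have r: "0 < r" "r < 1" "R < r" using R by (auto simp: r_def)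
      obtain H where H: "H holomorphic_on ball 0 r" "\<forall>z\<in>ball 0 r. (cmod (g z))\<^sup>2 \<le> Re (H z) \<and> Re (H z) \<le> (cmod (g z))\<^sup>2 + M"
        using M[OF r(1,2)] by blast
      interpret volterra_disc r M "f n" g ?F H
        by (rule BMOA_volterra_disc[OF f gh H r(2)])
      have Qt: "circ_int (\<lambda>z. Q z powr (p/2)) R \<le> D"
        unfolding Q_def D_def by (rule circ_int_Q_le[OF f R _ fb[OF R]]) (use p in auto)
      have "circ_int (\<lambda>z. Q z powr (1/4)) R \<le> circ_int (\<lambda>z. Q z powr (p/2)) R"
        by (rule circ_int_mono[OF cont_Q_powr cont_Q_powr])
           (use R r p Q_ge_1 in \<open>auto intro!: powr_mono\<close>)
      then have Qs: "circ_int (\<lambda>z. Q z powr (1/4)) R \<le> D" using Qt by simp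
      have "circ_int ?X R - circ_int ?X \<rho> \<le> l powr (1/4) / (1/4) * circ_int (\<lambda>z. Q z powr (1/4)) R
       + 1/4 * l powr (1/4 - 1) * (k * exp M * circ_int (\<lambda>z. Q z powr (p/2)) R
          + C * (circ_int (\<lambda>z. (cmod (g z))\<^sup>2) R - circ_int (\<lambda>z. (cmod (g z))\<^sup>2) \<rho>))"
        using volterra_small_growth[of "1/4" "p/2" l \<rho> R k C] powr_interpolate[of "1/4" "p/2" k] l k C p R r \<rho> False
        by (simp add: Q_def C_def)
      also have "\<dots> \<le> l powr (1/4) / (1/4) * D + 1/4 * l powr (1/4 - 1) * (k * exp M * D + C * e')"
        using Qs Qt \<rho>(3)[OF R] k C by (intro add_mono mult_left_mono) auto
      also have "\<dots> = 4 * D * l powr (1/4) + e / 4 + e / 4"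
        using k' e'(2) by (simp add: algebra_simps)
      finally have "circ_int ?X R \<le> 6 * pi * l powr (1/4) + (4 * D * l powr (1/4) + e / 4 + e / 4)"
        using small[OF \<rho>(1) order_refl] by simp
      also have "\<dots> = e" using l4 by (simp add: algebra_simps)
      finally show ?thesis .
    qed
    then show ?case using FX by (meson order_trans)
  qed
qed

section \<open>Equi-integrability\<close>

text \<open>The Laplacian of \<open>Q\<^sup>s \<cdot> Q / (k + Q)\<close> is bounded by that of \<open>Q\<^sup>s\<close> uniformly in \<open>k\<close>, whereas on a
  fixed disc this function tends to \<open>0\<close> as \<open>k \<rightarrow> \<infinity>\<close>.\<close>
lemma Hardy_equi_integrable:
  assumes h: "h holomorphic_on ball 0 1" and s: "0 < s"
    and B: "\<And>R. 0 < R \<Longrightarrow> R < 1 \<Longrightarrow> circ_int (\<lambda>z. ((cmod (h z))\<^sup>2 + 1) powr s) R \<le> B" and e: "0 < e"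
  obtains k where "0 < k" "\<And>R. 0 < R \<Longrightarrow> R < 1 \<Longrightarrow>
     circ_int (\<lambda>z. ((cmod (h z))\<^sup>2 + 1) powr s * (((cmod (h z))\<^sup>2 + 1) / (k + ((cmod (h z))\<^sup>2 + 1)))) R \<le> e"
proof -
  define Q where "Q z = (cmod (h z))\<^sup>2 + 1" for z
  have Q: "1 \<le> Q z" "0 < Q z" for z by (auto simp: Q_def add_nonneg_pos)
  have hc: "continuous_on (ball 0 1) h" by (rule holomorphic_on_imp_continuous_on[OF h])
  have A: "log_lap (ball 0 1) Q (\<lambda>z. deriv h z * cnj (h z) + 0) (\<lambda>z. (cmod (deriv h z))\<^sup>2 + 0)"
    unfolding Q_def[abs_def] by (intro log_lap_add log_lap_cmod_square log_lap_const h) auto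
  define L where "L z = (cmod (deriv h z))\<^sup>2 + 0" for z
  define a where "a z = deriv h z * cnj (h z) + 0" for z
  have A: "log_lap (ball 0 1) Q a L" using A by (simp add: L_def[abs_def] a_def[abs_def])
  obtain a1 L1 where L1: "has_lap (ball 0 1) (\<lambda>z. Q z powr s) a1 L1"
    "\<And>z. z \<in> ball 0 1 \<Longrightarrow> min s (s\<^sup>2) * (Q z powr (s - 1) * L z) \<le> L1 z"
    by (rule has_lap_powr[OF A Q(2) s]) auto
  \<comment> \<open>With \<open>w = x / (k + x)\<close>, both \<open>w\<close> and
    \<open>x w'\<close> are at most 1 whatever \<open>k\<close> is, and \<open>w''\<close> is
    negative and is dropped. Hence \<open>s + 1\<close> bounds the coefficient from
    \<open>d1\<close> and \<open>s * \<bar>s - 1\<bar> + 2 * s\<close> the one from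
    \<open>d2\<close>, after \<open>|a|^2 <= Q L\<close>. The denominator is the lower factor in
    \<open>has_lap_powr\<close>.\<close>
  define c where "c = (s + 1 + (s * \<bar>s - 1\<bar> + 2 * s)) / min s (s\<^sup>2)"
  have c: "0 < c" using s by (auto simp: c_def intro!: divide_pos_pos add_pos_nonneg)
  have cm: "c * min s (s\<^sup>2) = s + 1 + (s * \<bar>s - 1\<bar> + 2 * s)"
  proof -
    have "min s (s\<^sup>2) \<noteq> 0" using s by (auto simp: min_def)
    then show ?thesis by (simp add: c_def)
  qed
  define U where "U k z = Q z powr s * (Q z / (k + Q z))" for k z
  have growth: "circ_int (U k) R - circ_int (U k) \<rho> \<le>
      c * (circ_int (\<lambda>z. Q z powr s) R - circ_int (\<lambda>z. Q z powr s) \<rho>)"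
    if k: "0 < k" and R: "0 \<le> \<rho>" "\<rho> \<le> R" "R < 1" for k R \<rho>
  proof -
    define d1 where "d1 x = s * x powr (s - 1) * (x / (k + x)) + x powr s * (k / (k + x)\<^sup>2)" for x
    define d2 where "d2 x = s * ((s - 1) * x powr (s - 1 - 1)) * (x / (k + x)) + 2 * (s * x powr (s - 1) * (k / (k + x)\<^sup>2))
       - x powr s * (2 * k / (k + x) ^ 3)" for x
    have kx: "k + x \<noteq> 0" "0 < k + x" if "x \<in> {0<..}" for x using k that by auto
    have U: "has_lap (ball 0 1) (\<lambda>z. Q z powr s * (Q z / (k + Q z))) (\<lambda>z. of_real (d1 (Q z)) * a z)
        (\<lambda>z. d1 (Q z) * L z + d2 (Q z) * (cmod (a z))\<^sup>2)"
    proof (rule has_lap_compose[OF log_lapD(1)[OF A], where T = "{0<..}"])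
      show "Q ` ball 0 1 \<subseteq> {0<..}" using Q by auto
      fix x :: real assume x: "x \<in> {0<..}"
      have w: "((\<lambda>x. x / (k + x)) has_real_derivative k / (k + x)\<^sup>2) (at x)"
        using kx[OF x] by (auto intro!: derivative_eq_intros simp: power2_eq_square)
      have w': "((\<lambda>x. k / (k + x)\<^sup>2) has_real_derivative - (2 * k / (k + x) ^ 3)) (at x)"
      proof -
        have *: "- (k * (2 * y)) / (y\<^sup>2 * y\<^sup>2) = - (2 * k / y ^ 3)" if "y \<noteq> 0" for y
          using that by (simp add: divide_simps) (simp add: eval_nat_numeral)
        have "((\<lambda>x. k / (k + x)\<^sup>2) has_real_derivative - (k * (2 * (k + x))) / ((k + x)\<^sup>2 * (k + x)\<^sup>2)) (at x)"
          using kx[OF x] by (auto intro!: derivative_eq_intros)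
        then show ?thesis unfolding *[OF kx(1)[OF x]] .
      qed
      have P: "((\<lambda>x. x powr t) has_real_derivative t * x powr (t - 1)) (at x)" for t
        using x by (auto intro!: derivative_eq_intros)
      show "((\<lambda>x. x powr s * (x / (k + x))) has_real_derivative d1 x) (at x)"
        unfolding d1_def by (rule DERIV_cong[OF DERIV_mult[OF P w]]) (simp add: algebra_simps)
      show "(d1 has_real_derivative d2 x) (at x)"
        unfolding d1_def d2_def
        by (rule DERIV_cong[OF DERIV_add[OF DERIV_mult[OF DERIV_cmult[OF P] w] DERIV_mult[OF P w']]])
           (simp add: algebra_simps)
    next
      show "continuous_on {0<..} d2" unfolding d2_def
        by (intro continuous_intros) (use kx in auto)
    qed
    have le: "d1 (Q z) * L z + d2 (Q z) * (cmod (a z))\<^sup>2 \<le> c * L1 z" if z: "z \<in> ball 0 1" for z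
    proof -
      let ?x = "Q z"
      have x: "0 < ?x" using Q by simp
      have w: "0 \<le> ?x / (k + ?x)" "?x / (k + ?x) \<le> 1" using k x by auto
      have w': "0 \<le> ?x * (k / (k + ?x)\<^sup>2)" "?x * (k / (k + ?x)\<^sup>2) \<le> 1"
      proof -
        have "?x * k \<le> (k + ?x)\<^sup>2" using k x by (simp add: power2_eq_square algebra_simps)
        then show "?x * (k / (k + ?x)\<^sup>2) \<le> 1" using k x by (simp add: divide_le_eq)
      qed (use k x in auto)
      have p1: "?x powr s = ?x powr (s - 1) * ?x" using powr_add[of ?x "s - 1" 1] x by simp
      have p2: "?x powr (s - 1) = ?x powr (s - 1 - 1) * ?x" using powr_add[of ?x "s - 1 - 1" 1] x by simp
      have "d1 ?x = ?x powr (s - 1) * (s * (?x / (k + ?x)) + ?x * (k / (k + ?x)\<^sup>2))"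
        unfolding d1_def p1 by (simp add: algebra_simps)
      also have "\<dots> \<le> ?x powr (s - 1) * (s * 1 + 1)"
        by (intro mult_left_mono add_mono w w') (use s in auto)
      finally have 1: "d1 ?x \<le> ?x powr (s - 1) * (s + 1)" by simp
      have "d2 ?x \<le> s * ((s - 1) * ?x powr (s - 1 - 1)) * (?x / (k + ?x)) + 2 * (s * ?x powr (s - 1) * (k / (k + ?x)\<^sup>2))"
        using k x by (simp add: d2_def)
      also have "\<dots> = ?x powr (s - 1 - 1) * (s * ((s - 1) * (?x / (k + ?x))) + 2 * s * (?x * (k / (k + ?x)\<^sup>2)))"
        unfolding p2 by (simp add: algebra_simps diff_divide_distrib)
      also have "\<dots> \<le> ?x powr (s - 1 - 1) * (s * \<bar>s - 1\<bar> + 2 * s * 1)"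
      proof (intro mult_left_mono add_mono w')
        have "(s - 1) * (?x / (k + ?x)) \<le> \<bar>s - 1\<bar> * (?x / (k + ?x))" by (intro mult_right_mono w) auto
        also have "\<dots> \<le> \<bar>s - 1\<bar>" using w by (intro mult_left_le) auto
        finally show "(s - 1) * (?x / (k + ?x)) \<le> \<bar>s - 1\<bar>" .
      qed (use s in auto)
      finally have "d2 ?x * (cmod (a z))\<^sup>2 \<le> ?x powr (s - 1 - 1) * (s * \<bar>s - 1\<bar> + 2 * s) * (cmod (a z))\<^sup>2"
        by (intro mult_right_mono) auto
      also have "\<dots> \<le> ?x powr (s - 1 - 1) * (s * \<bar>s - 1\<bar> + 2 * s) * (?x * L z)"
        by (intro mult_left_mono log_lapD(4)[OF A z]) (use s in auto)
      also have "\<dots> = (s * \<bar>s - 1\<bar> + 2 * s) * (?x powr (s - 1) * L z)"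
        unfolding p2 by (simp add: algebra_simps)
      finally have "d1 ?x * L z + d2 ?x * (cmod (a z))\<^sup>2
         \<le> ?x powr (s - 1) * (s + 1) * L z + (s * \<bar>s - 1\<bar> + 2 * s) * (?x powr (s - 1) * L z)"
        using mult_right_mono[OF 1 log_lapD(3)[OF A z]] by simp
      also have "\<dots> = (c * min s (s\<^sup>2)) * (?x powr (s - 1) * L z)"
        unfolding cm by (simp add: algebra_simps)
      also have "\<dots> = c * (min s (s\<^sup>2) * (?x powr (s - 1) * L z))" by simp
      also have "\<dots> \<le> c * L1 z" using L1(2)[OF z] c by simp
      finally show ?thesis .
    qed
    show ?thesis
      using lap_compare[OF U has_lap_cmult[OF L1(1)] le R] by (simp add: circ_int_cmult U_def[abs_def] algebra_simps)
  qed
  \<comment> \<open>\<open>\<rho>\<close> is fixed first, since \<open>c\<close> is independent of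
    \<open>k\<close>: beyond \<open>\<rho>\<close> the growth costs at most \<open>e / 2\<close> for
    all \<open>k\<close>. Then \<open>k\<close> is taken so large that the other half suffices up to
    \<open>\<rho>\<close>, where \<open>h\<close> is bounded.\<close>
  define e' where "e' = e / 2 / c"
  have e': "0 < e'" "c * e' = e / 2" using e c by (auto simp: e'_def)
  obtain \<rho> where \<rho>: "0 < \<rho>" "\<rho> < 1" "\<And>R. 0 < R \<Longrightarrow> R < 1 \<Longrightarrow>
      circ_int (\<lambda>z. Q z powr s) R - circ_int (\<lambda>z. Q z powr s) \<rho> \<le> e'"
    using increasing_bounded_Cauchy[of "circ_int (\<lambda>z. Q z powr s)" B e'] B e'(1) unfolding Q_def by blast
  have "bounded (h ` cball 0 \<rho>)"
    using \<rho> by (intro compact_imp_bounded compact_continuous_image compact_cball continuous_on_subset[OF hc]) auto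
  then obtain q where q: "0 < q" "\<And>w. w \<in> cball 0 \<rho> \<Longrightarrow> cmod (h w) \<le> q"
    unfolding bounded_pos by auto
  define q' where "q' = (q\<^sup>2 + 1) powr s * (q\<^sup>2 + 1)"
  have q': "0 < q'" by (auto simp: q'_def intro!: mult_pos_pos add_nonneg_pos simp: add_nonneg_eq_0_iff)
  define k where "k = q' / (e / (4 * pi))"
  have k: "0 < k" using q' e by (simp add: k_def)
  have cU: "continuous_on (ball 0 1) (U k)"
    unfolding U_def[abs_def] Q_def using k
    by (intro continuous_intros hc) (auto simp: add_nonneg_eq_0_iff add_pos_nonneg less_imp_neq[symmetric])
  have small: "circ_int (U k) R \<le> e / 2" if R: "0 < R" "R \<le> \<rho>" for R
  proof -
    have "circ_int (U k) R \<le> circ_int (\<lambda>_. e / (4 * pi)) R"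
    proof (rule circ_int_mono[OF cU continuous_on_const])
      fix z assume "cmod z = R"
      then have "cmod (h z) \<le> q" using q R by auto
      then have Qq: "Q z \<le> q\<^sup>2 + 1" unfolding Q_def by (intro add_right_mono power_mono) auto
      have "U k z \<le> Q z powr s * (Q z / k)"
        unfolding U_def using k Q[of z] by (intro mult_left_mono divide_left_mono) auto
      also have "\<dots> \<le> (q\<^sup>2 + 1) powr s * ((q\<^sup>2 + 1) / k)"
        using Qq Q[of z] k s by (intro mult_mono powr_mono2 divide_right_mono) auto
      also have "\<dots> = q' / k" by (simp add: q'_def)
      also have "\<dots> = e / (4 * pi)" using q' by (simp add: k_def)
      finally show "U k z \<le> e / (4 * pi)" .
    qed (use R \<rho> in auto)
    then show ?thesis by (simp add: circ_int_const)
  qed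
  have "circ_int (U k) R \<le> e" if R: "0 < R" "R < 1" for R
  proof (cases "R \<le> \<rho>")
    case True
    then show ?thesis using small[OF R(1)] e by simp
  next
    case False
    then have "circ_int (U k) R \<le> circ_int (U k) \<rho> + c * (circ_int (\<lambda>z. Q z powr s) R - circ_int (\<lambda>z. Q z powr s) \<rho>)"
      using growth[OF k, of \<rho> R] R \<rho> by simp
    also have "\<dots> \<le> e / 2 + c * e'"
      by (intro add_mono small mult_left_mono \<rho>(3) R) (use \<rho> c in auto)
    finally show ?thesis using e' by simp
  qed
  then show ?thesis using that[OF k] unfolding U_def Q_def by blast
qed

lemma continuous_on_min_powr:
  assumes "continuous_on S h" "continuous_on S u" "0 < p"
  shows "continuous_on S (\<lambda>z. min (cmod (h z)) (cmod (u z)) powr p)"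
  by (rule continuous_on_powr') (use assms in \<open>auto intro!: continuous_intros\<close>)

text \<open>Where \<open>Q >= k\<close> the cutoff \<open>Q / (k + Q)\<close> is at least
  \<open>1/2\<close>, so twice the equi-integrable quantity dominates \<open>|h|^p\<close>.
  Elsewhere \<open>h\<close> is bounded, and the minimum is controlled by the mean of
  \<open>|F n|^(1/2)\<close>.\<close>

lemma Hardy_min_small:
  assumes h: "h holomorphic_on ball 0 1" and p: "1 \<le> p"
    and B: "\<And>R. 0 < R \<Longrightarrow> R < 1 \<Longrightarrow> circ_int (\<lambda>z. ((cmod (h z))\<^sup>2 + 1) powr (p/2)) R \<le> B"
    and F: "\<And>n. F n holomorphic_on ball 0 1"
    and lim: "\<And>e. 0 < e \<Longrightarrow> \<forall>\<^sub>F n in sequentially. \<forall>R. 0 < R \<longrightarrow> R < 1 \<longrightarrow> circ_int (\<lambda>z. cmod (F n z) powr (1/2)) R \<le> e"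
    and e: "0 < e"
  shows "\<forall>\<^sub>F n in sequentially. \<forall>R. 0 < R \<longrightarrow> R < 1 \<longrightarrow>
     circ_int (\<lambda>z. min (cmod (h z)) (cmod (F n z)) powr p) R \<le> e"
proof -
  define Q where "Q z = (cmod (h z))\<^sup>2 + 1" for z
  have Q: "1 \<le> Q z" "0 < Q z" "(cmod (h z))\<^sup>2 \<le> Q z" for z by (auto simp: Q_def add_nonneg_pos)
  have hc: "continuous_on (ball 0 1) h" by (rule holomorphic_on_imp_continuous_on[OF h])
  have p2: "0 < p / 2" using p by simp
  have e4: "0 < e / 4" using e by simp
  obtain k where k: "0 < k" "\<And>R. 0 < R \<Longrightarrow> R < 1 \<Longrightarrow>
     circ_int (\<lambda>z. Q z powr (p/2) * (Q z / (k + Q z))) R \<le> e / 4"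
    using Hardy_equi_integrable[OF h p2 B e4] unfolding Q_def by blast
  define c where "c = k powr ((p - 1/2) / 2)"
  have c: "0 < c" using k by (simp add: c_def)
  have "\<forall>\<^sub>F n in sequentially. \<forall>R. 0 < R \<longrightarrow> R < 1 \<longrightarrow> circ_int (\<lambda>z. cmod (F n z) powr (1/2)) R \<le> e / 2 / c"
    by (rule lim) (use e c in auto)
  then show ?thesis
  proof (eventually_elim, intro allI impI)
    fix n R assume *: "\<forall>R. 0 < R \<longrightarrow> R < 1 \<longrightarrow> circ_int (\<lambda>z. cmod (F n z) powr (1/2)) R \<le> e / 2 / c"
      and R: "0 < R" "R < (1::real)"
    have Fc: "continuous_on (ball 0 1) (F n)" by (rule holomorphic_on_imp_continuous_on[OF F])
    let ?U = "\<lambda>z. 2 * (Q z powr (p/2) * (Q z / (k + Q z)))" and ?V = "\<lambda>z. c * cmod (F n z) powr (1/2)"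
    have cU: "continuous_on (ball 0 1) ?U"
      unfolding Q_def using k
      by (intro continuous_intros hc) (auto simp: add_nonneg_eq_0_iff add_pos_nonneg less_imp_neq[symmetric])
    have cV: "continuous_on (ball 0 1) ?V"
      by (intro continuous_on_mult_left continuous_on_norm_powr Fc) simp
    have "circ_int (\<lambda>z. min (cmod (h z)) (cmod (F n z)) powr p) R \<le> circ_int (\<lambda>z. ?U z + ?V z) R"
    proof (rule circ_int_mono[OF continuous_on_min_powr[OF hc Fc] continuous_on_add[OF cU cV]])
      fix z
      show "min (cmod (h z)) (cmod (F n z)) powr p \<le> ?U z + ?V z"
      proof (cases "k \<le> Q z")
        case True
        have "min (cmod (h z)) (cmod (F n z)) powr p \<le> cmod (h z) powr p"
          using p by (intro powr_mono2) auto
        also have "\<dots> = ((cmod (h z))\<^sup>2) powr (p / 2)" by (simp only: square_powr_half)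
        also have "\<dots> \<le> Q z powr (p/2)" using p Q by (intro powr_mono2) auto
        also have "\<dots> = Q z powr (p/2) * 1" by simp
        \<comment> \<open>This is where \<open>k <= Q\<close> is used: the bracket is at least
          1.\<close>
        also have "\<dots> \<le> Q z powr (p/2) * (2 * (Q z / (k + Q z)))"
          using True k Q[of z] by (intro mult_left_mono) (auto simp: field_simps)
        finally show ?thesis using c by (simp add: add_increasing2 mult.left_commute)
      next
        case False
        define x where "x = min (cmod (h z)) (cmod (F n z))"
        have x: "0 \<le> x" by (simp add: x_def)
        have "x powr p = x powr (p - 1/2) * x powr (1/2)" by (simp flip: powr_add)
        also have "\<dots> \<le> c * cmod (F n z) powr (1/2)"
        proof (rule mult_mono)
          have "x powr (p - 1/2) \<le> cmod (h z) powr (p - 1/2)"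
            unfolding x_def using p by (intro powr_mono2) auto
          also have "\<dots> = ((cmod (h z))\<^sup>2) powr ((p - 1/2) / 2)" by (simp only: square_powr_half)
          also have "\<dots> \<le> c" unfolding c_def
            using False Q(3)[of z] p by (intro powr_mono2) auto
          finally show "x powr (p - 1/2) \<le> c" .
          show "x powr (1/2) \<le> cmod (F n z) powr (1/2)"
            unfolding x_def by (intro powr_mono2) auto
        qed (use c in auto)
        finally show ?thesis using k Q[of z] by (simp add: x_def add_increasing)
      qed
    qed (use p R in auto)
    also have "\<dots> = 2 * circ_int (\<lambda>z. Q z powr (p/2) * (Q z / (k + Q z))) R + c * circ_int (\<lambda>z. cmod (F n z) powr (1/2)) R"
      using circ_int_add[OF cU cV] R by (simp only: circ_int_cmult)
    also have "\<dots> \<le> 2 * (e / 4) + c * (e / 2 / c)"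
      using * R c by (intro add_mono mult_left_mono k(2)) auto
    also have "\<dots> = e" using c by simp
    finally show "circ_int (\<lambda>z. min (cmod (h z)) (cmod (F n z)) powr p) R \<le> e" .
  qed
qed

text \<open>\<open>|h|^p\<close> need not be smooth at zeros of \<open>h\<close>, so monotonicity is
  proved for \<open>(|h|^2 + e)^(p/2)\<close> and \<open>e\<close> tends to 0 along
  \<open>1 / (n + 1)\<close>.\<close>

lemma circ_int_norm_powr_mono:
  assumes h: "h holomorphic_on ball 0 1" and p: "0 < p" and R: "0 \<le> \<rho>" "\<rho> \<le> R" "R < 1"
  shows "circ_int (\<lambda>z. cmod (h z) powr p) \<rho> \<le> circ_int (\<lambda>z. cmod (h z) powr p) R"
proof -
  have hc: "continuous_on (ball 0 1) h" by (rule holomorphic_on_imp_continuous_on[OF h])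
  let ?Q = "\<lambda>e z. (cmod (h z))\<^sup>2 + e"
  define \<phi> where "\<phi> e = integral (cbox 0 (2*pi)) (\<lambda>t. ?Q e (of_real R * cis t) powr (p/2))" for e
  have "continuous_on {0..1} \<phi>" unfolding \<phi>_def
  proof (rule integral_continuous_on_param)
    have *: "continuous_on ({0..1} \<times> cbox 0 (2*pi)) (\<lambda>x::real\<times>real. h (of_real R * cis (snd x)))"
      by (rule continuous_on_compose2[OF hc]) (use R in \<open>auto intro!: continuous_intros simp: norm_mult\<close>)
    show "continuous_on ({0..1} \<times> cbox 0 (2*pi)) (\<lambda>(e,t). ?Q e (of_real R * cis t) powr (p/2))"
      unfolding case_prod_beta
      by (rule continuous_on_powr') (use p * in \<open>auto intro!: continuous_intros\<close>)
  qed
  then have "((\<lambda>n. \<phi> (inverse (real (Suc n)))) \<longlonglongrightarrow> \<phi> 0)"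
    by (rule continuous_on_tendsto_compose[OF _ LIMSEQ_inverse_real_of_nat])
       (auto intro!: always_eventually simp: divide_simps)
  moreover have "circ_int (\<lambda>z. cmod (h z) powr p) \<rho> \<le> \<phi> e" if e: "0 < e" for e
  proof -
    have A: "log_lap (ball 0 1) (?Q e) (\<lambda>z. deriv h z * cnj (h z) + 0) (\<lambda>z. (cmod (deriv h z))\<^sup>2 + 0)"
      using e by (intro log_lap_add log_lap_cmod_square log_lap_const h) auto
    have pos: "0 < ?Q e z" for z using e by (simp add: add_nonneg_pos)
    have p2: "0 < p / 2" using p by simp
    obtain a L where L: "has_lap (ball 0 1) (\<lambda>z. ?Q e z powr (p/2)) a L"
      "\<And>z. z \<in> ball 0 1 \<Longrightarrow> min (p/2) ((p/2)\<^sup>2) * (?Q e z powr (p/2 - 1) * ((cmod (deriv h z))\<^sup>2 + 0)) \<le> L z"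
      by (rule has_lap_powr[OF A pos p2]) auto
    have L0: "0 \<le> L z" if "z \<in> ball 0 1" for z
      by (rule order_trans[OF _ L(2)[OF that]]) (use p in auto)
    have "circ_int (\<lambda>z. cmod (h z) powr p) \<rho> \<le> circ_int (\<lambda>z. ?Q e z powr (p/2)) \<rho>"
    proof (rule circ_int_mono[OF continuous_on_norm_powr[OF hc p] has_lap_continuous(1)[OF L(1)]])
      show "cmod (h z) powr p \<le> ?Q e z powr (p/2)" for z
        unfolding square_powr_half[symmetric] by (rule powr_mono2) (use p e in auto)
    qed (use R in auto)
    also have "\<dots> \<le> circ_int (\<lambda>z. ?Q e z powr (p/2)) R"
      by (rule circ_int_mono_lap[OF L(1) L0 R])
    finally show ?thesis by (simp add: \<phi>_def circ_int_def)
  qed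
  ultimately have "circ_int (\<lambda>z. cmod (h z) powr p) \<rho> \<le> \<phi> 0"
    by (intro LIMSEQ_le_const) auto
  then show ?thesis by (simp add: \<phi>_def circ_int_def square_powr_half)
qed

section \<open>Almost disjoint sequences\<close>

lemma circ_int_sum:
  fixes A :: "'i \<Rightarrow> complex \<Rightarrow> real"
  assumes "finite I" "\<And>i. i \<in> I \<Longrightarrow> continuous_on (ball 0 r) (A i)" "0 \<le> R" "R < r"
  shows "circ_int (\<lambda>z. \<Sum>i\<in>I. A i z) R = (\<Sum>i\<in>I. circ_int (A i) R)"
  unfolding circ_int_def
  by (rule integral_sum) (use assms circ_int_integrable in blast)+

text \<open>\<open>add_powr_le\<close> iterated, splitting off one term at a time: the term of index
  \<open>k\<close> pays the factor \<open>2 powr p\<close> at most \<open>k + 1\<close> times. The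
  weights do not depend on \<open>n\<close>; later they are beaten by the choice of the
  subsequence.\<close>

lemma sum_powr_le_weighted:
  fixes t :: "nat \<Rightarrow> real"
  assumes "\<And>k. 0 \<le> t k" "0 < p"
  shows "(\<Sum>k<n. t k) powr p \<le> (\<Sum>k<n. 2 powr (p * (real k + 1)) * t k powr p)"
  using assms(1)
proof (induction n arbitrary: t)
  case (Suc n)
  have "(\<Sum>k<Suc n. t k) powr p = (t 0 + (\<Sum>k<n. t (Suc k))) powr p"
    by (simp only: sum.lessThan_Suc_shift)
  also have "\<dots> \<le> 2 powr p * (t 0 powr p + (\<Sum>k<n. t (Suc k)) powr p)"
    by (rule add_powr_le) (use Suc.prems assms(2) in \<open>auto intro: sum_nonneg\<close>)
  also have "\<dots> \<le> 2 powr p * (t 0 powr p + (\<Sum>k<n. 2 powr (p * (real k + 1)) * t (Suc k) powr p))"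
    by (intro mult_left_mono add_left_mono Suc.IH Suc.prems) auto
  also have "\<dots> = (\<Sum>k<Suc n. 2 powr (p * (real k + 1)) * t k powr p)"
    unfolding sum.lessThan_Suc_shift distrib_left sum_distrib_left
    by (simp add: mult.assoc[symmetric] algebra_simps flip: powr_add)
  finally show ?case .
qed auto

lemma sum_powr_le_powr_sum:
  fixes y :: "'i \<Rightarrow> real"
  assumes "finite I" "\<And>i. i \<in> I \<Longrightarrow> 0 \<le> y i" "1 \<le> p"
  shows "(\<Sum>i\<in>I. y i powr p) \<le> (\<Sum>i\<in>I. y i) powr p"
proof -
  let ?Y = "\<Sum>i\<in>I. y i"
  have split: "x powr p = x powr (p - 1) * x" if "0 \<le> x" for x :: real
    using that assms(3) powr_add[of x "p - 1" 1] by simp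
  have "(\<Sum>i\<in>I. y i powr p) \<le> (\<Sum>i\<in>I. ?Y powr (p - 1) * y i)"
  proof (rule sum_mono)
    fix i assume i: "i \<in> I"
    have "y i \<le> ?Y" by (rule member_le_sum) (use assms i in auto)
    then have "y i powr (p - 1) * y i \<le> ?Y powr (p - 1) * y i"
      using assms i by (intro mult_right_mono powr_mono2) auto
    then show "y i powr p \<le> ?Y powr (p - 1) * y i" using split assms(2)[OF i] by simp
  qed
  also have "\<dots> = ?Y powr p" using split[of ?Y] assms by (simp add: sum_nonneg sum_distrib_left)
  finally show ?thesis .
qed

text \<open>A pointwise measure of the failure of disjointness: it vanishes for nonnegative
  \<open>x\<close> exactly when at most one of the first \<open>N\<close> entries is
  nonzero.\<close>

definition overlap :: "(nat \<Rightarrow> real) \<Rightarrow> nat \<Rightarrow> real" where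
  "overlap x N = (\<Sum>j<N. \<Sum>i<j. min (x i) (x j))"

lemma overlap_nonneg: "(\<And>j. 0 \<le> x j) \<Longrightarrow> 0 \<le> overlap x N"
  unfolding overlap_def by (auto intro!: sum_nonneg)

text \<open>Induction keeping a champion \<open>J\<close>. When an entry arrives, the smaller of it
  and the champion joins the rest, and this smaller value is one of the minima that the arrival adds
  to the overlap.\<close>

lemma overlap_dominant:
  assumes x: "\<And>j. 0 \<le> x j"
  shows "\<exists>J<Suc N. (\<Sum>j\<in>{..<Suc N} - {J}. x j) \<le> overlap x (Suc N)"
proof (induction N)
  case 0
  show ?case by (intro exI[of _ 0]) (simp add: overlap_def lessThan_Suc)
next
  case (Suc N)
  then obtain J where J: "J < Suc N" "(\<Sum>j\<in>{..<Suc N} - {J}. x j) \<le> overlap x (Suc N)" by blast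
  let ?n = "Suc N"
  have ov: "overlap x (Suc ?n) = overlap x ?n + (\<Sum>i<?n. min (x i) (x ?n))" by (simp add: overlap_def)
  have m: "min (x J) (x ?n) \<le> (\<Sum>i<?n. min (x i) (x ?n))"
    by (rule member_le_sum[of J]) (use J x in auto)
  show ?case
  proof (cases "x ?n \<le> x J")
    case True
    have "{..<Suc ?n} - {J} = insert ?n ({..<?n} - {J})" using J by auto
    then have "(\<Sum>j\<in>{..<Suc ?n} - {J}. x j) = x ?n + (\<Sum>j\<in>{..<?n} - {J}. x j)" by simp
    moreover have "min (x J) (x ?n) = x ?n" using True by simp
    ultimately have "(\<Sum>j\<in>{..<Suc ?n} - {J}. x j) \<le> overlap x (Suc ?n)" using J(2) m ov by linarith
    then show ?thesis using J(1) less_SucI by blast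
  next
    case False
    have "{..<Suc ?n} - {?n} = {..<?n}" by auto
    then have "(\<Sum>j\<in>{..<Suc ?n} - {?n}. x j) = x J + (\<Sum>j\<in>{..<?n} - {J}. x j)"
      using sum.remove[of "{..<?n}" J x] J by simp
    moreover have "min (x J) (x ?n) = x J" using False by simp
    ultimately have "(\<Sum>j\<in>{..<Suc ?n} - {?n}. x j) \<le> overlap x (Suc ?n)" using J(2) m ov by linarith
    then show ?thesis by blast
  qed
qed

lemma overlap_powr_le:
  assumes x: "\<And>j. 0 \<le> x j" and p: "0 < p"
  shows "overlap x N powr p \<le> (\<Sum>j<N. \<Sum>i<j. 4 powr (p * (real j + 1)) * min (x i) (x j) powr p)"
proof -
  have "overlap x N powr p \<le> (\<Sum>j<N. 2 powr (p * (real j + 1)) * (\<Sum>i<j. min (x i) (x j)) powr p)"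
    unfolding overlap_def by (rule sum_powr_le_weighted[OF _ p]) (use x in \<open>auto intro!: sum_nonneg\<close>)
  also have "\<dots> \<le> (\<Sum>j<N. 2 powr (p * (real j + 1)) * (\<Sum>i<j. 2 powr (p * (real i + 1)) * min (x i) (x j) powr p))"
    by (intro sum_mono mult_left_mono sum_powr_le_weighted[OF _ p]) (use x in auto)
  \<comment> \<open>Since \<open>i < j\<close>, the inner weight is enlarged to the outer one; their
    product is the power of 4.\<close>
  also have "\<dots> \<le> (\<Sum>j<N. 2 powr (p * (real j + 1)) * (\<Sum>i<j. 2 powr (p * (real j + 1)) * min (x i) (x j) powr p))"
    by (intro sum_mono mult_left_mono mult_right_mono powr_mono) (use p in auto)
  also have "\<dots> = (\<Sum>j<N. \<Sum>i<j. 4 powr (p * (real j + 1)) * min (x i) (x j) powr p)"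
  proof (intro sum.cong refl)
    fix j
    have "2 powr (p * (real j + 1)) * 2 powr (p * (real j + 1)) = (4::real) powr (p * (real j + 1))"
      by (simp flip: powr_mult)
    then show "2 powr (p * (real j + 1)) * (\<Sum>i<j. 2 powr (p * (real j + 1)) * min (x i) (x j) powr p)
       = (\<Sum>i<j. 4 powr (p * (real j + 1)) * min (x i) (x j) powr p)"
      by (simp add: sum_distrib_left mult.assoc[symmetric])
  qed
  finally show ?thesis .
qed

text \<open>At the given point keep the dominant term \<open>J\<close>; by
  \<open>overlap_dominant\<close> the others add up to at most \<open>A * Z\<close>. The index
  \<open>J\<close> varies with the point, but the final bounds no longer mention it, so they can be
  integrated.\<close>

lemma almost_disjoint_sum:
  fixes h \<alpha> :: "nat \<Rightarrow> complex" and N :: nat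
  assumes A: "\<And>j. cmod (\<alpha> j) \<le> A" and p: "1 \<le> p"
  defines "Z \<equiv> overlap (\<lambda>j. cmod (h j)) N"
  shows "cmod (\<Sum>j<N. \<alpha> j * h j) powr p \<le> 2 powr p * ((\<Sum>j<N. cmod (\<alpha> j) powr p * cmod (h j) powr p) + A powr p * Z powr p)"
    and "(\<Sum>j<N. cmod (\<alpha> j) powr p * cmod (h j) powr p)
       \<le> 2 powr p * cmod (\<Sum>j<N. \<alpha> j * h j) powr p + (2 powr p + 1) * (A powr p * Z powr p)"
proof -
  have A0: "0 \<le> A" using order_trans[OF norm_ge_zero A] .
  have Z0: "0 \<le> Z" unfolding Z_def by (rule overlap_nonneg) simp
  have AZ: "(A * Z) powr p = A powr p * Z powr p" using A0 Z0 by (simp add: powr_mult)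
  let ?S = "\<Sum>j<N. \<alpha> j * h j" and ?y = "\<lambda>j. cmod (\<alpha> j) * cmod (h j)"
  have y: "?y j powr p = cmod (\<alpha> j) powr p * cmod (h j) powr p" for j by (simp add: powr_mult)
  have "cmod ?S powr p \<le> 2 powr p * ((\<Sum>j<N. ?y j powr p) + (A * Z) powr p) \<and>
      (\<Sum>j<N. ?y j powr p) \<le> 2 powr p * cmod ?S powr p + (2 powr p + 1) * (A * Z) powr p"
  proof (cases N)
    case (Suc n)
    obtain J where J: "J < N" "(\<Sum>j\<in>{..<N} - {J}. cmod (h j)) \<le> Z"
      using overlap_dominant[of "\<lambda>j. cmod (h j)" n] unfolding Z_def Suc by auto
    have split: "(\<Sum>j<N. u j) = u J + (\<Sum>j\<in>{..<N} - {J}. u j)" for u :: "nat \<Rightarrow> 'b::ab_group_add"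
      using J by (simp add: sum.remove)
    have rest: "(\<Sum>j\<in>{..<N} - {J}. ?y j) \<le> A * Z"
    proof -
      have "(\<Sum>j\<in>{..<N} - {J}. ?y j) \<le> (\<Sum>j\<in>{..<N} - {J}. A * cmod (h j))"
        by (intro sum_mono mult_right_mono A) auto
      also have "\<dots> = A * (\<Sum>j\<in>{..<N} - {J}. cmod (h j))" by (simp add: sum_distrib_left)
      also have "\<dots> \<le> A * Z" by (intro mult_left_mono J A0)
      finally show ?thesis .
    qed
    have rest': "cmod (\<Sum>j\<in>{..<N} - {J}. \<alpha> j * h j) \<le> A * Z"
      using order_trans[OF norm_sum, of "\<lambda>j. \<alpha> j * h j" "{..<N} - {J}"] rest by (simp add: norm_mult)
    have S: "?S = \<alpha> J * h J + (\<Sum>j\<in>{..<N} - {J}. \<alpha> j * h j)" by (rule split)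
    have "cmod ?S \<le> ?y J + A * Z"
      unfolding S by (rule order_trans[OF norm_triangle_ineq]) (use rest' in \<open>simp add: norm_mult\<close>)
    then have "cmod ?S powr p \<le> (?y J + A * Z) powr p" using p by (intro powr_mono2) auto
    also have "\<dots> \<le> 2 powr p * (?y J powr p + (A * Z) powr p)"
      by (rule add_powr_le) (use A0 Z0 p in auto)
    also have "\<dots> \<le> 2 powr p * ((\<Sum>j<N. ?y j powr p) + (A * Z) powr p)"
      by (intro mult_left_mono add_right_mono member_le_sum) (use J in auto)
    finally have 1: "cmod ?S powr p \<le> 2 powr p * ((\<Sum>j<N. ?y j powr p) + (A * Z) powr p)" .
    have "?y J = cmod (?S - (\<Sum>j\<in>{..<N} - {J}. \<alpha> j * h j))" unfolding S by (simp add: norm_mult)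
    also have "\<dots> \<le> cmod ?S + A * Z" by (rule order_trans[OF norm_triangle_ineq4]) (use rest' in simp)
    finally have "?y J powr p \<le> (cmod ?S + A * Z) powr p" using p by (intro powr_mono2) auto
    also have "\<dots> \<le> 2 powr p * (cmod ?S powr p + (A * Z) powr p)"
      by (rule add_powr_le) (use A0 Z0 p in auto)
    finally have 2: "?y J powr p \<le> 2 powr p * (cmod ?S powr p + (A * Z) powr p)" .
    have "(\<Sum>j\<in>{..<N} - {J}. ?y j powr p) \<le> (\<Sum>j\<in>{..<N} - {J}. ?y j) powr p"
      by (rule sum_powr_le_powr_sum) (use p in auto)
    also have "\<dots> \<le> (A * Z) powr p" by (rule powr_mono2) (use p rest in \<open>auto intro!: sum_nonneg\<close>)
    finally have "(\<Sum>j<N. ?y j powr p) \<le> 2 powr p * (cmod ?S powr p + (A * Z) powr p) + (A * Z) powr p"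
      unfolding split[of "\<lambda>j. ?y j powr p"] using 2 by simp
    then show ?thesis using 1 by (simp add: algebra_simps)
  qed auto
  then show "cmod ?S powr p \<le> 2 powr p * ((\<Sum>j<N. cmod (\<alpha> j) powr p * cmod (h j) powr p) + A powr p * Z powr p)"
    "(\<Sum>j<N. cmod (\<alpha> j) powr p * cmod (h j) powr p) \<le> 2 powr p * cmod ?S powr p + (2 powr p + 1) * (A powr p * Z powr p)"
    unfolding y AZ by auto
qed

text \<open>On a fixed circle all but finitely many terms are dominated by a geometric series, so
  the partial sums are uniformly bounded there and dominated convergence applies.\<close>

lemma circle_series_limit:
  fixes h :: "nat \<Rightarrow> complex \<Rightarrow> complex"
  assumes hol: "\<And>j. h j holomorphic_on ball 0 1" and p: "0 < p" and A: "\<And>j. cmod (\<alpha> j) \<le> A"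
    and small: "\<And>j z. cmod z \<le> 1 - 1 / (real j + 2) \<Longrightarrow> cmod (h j z) \<le> (1/2) ^ j"
    and R: "0 < R" "R < 1"
  shows "(\<lambda>N. circ_int (\<lambda>z. cmod (\<Sum>j<N. \<alpha> j * h j z) powr p) R) \<longlonglongrightarrow> circ_int (\<lambda>z. cmod (\<Sum>j. \<alpha> j * h j z) powr p) R"
proof -
  have A0: "0 \<le> A" using order_trans[OF norm_ge_zero A] .
  have hc: "continuous_on (ball 0 1) (h j)" for j by (rule holomorphic_on_imp_continuous_on[OF hol])
  have "\<exists>K. \<forall>z\<in>sphere 0 R. cmod (h j z) \<le> K" for j
  proof -
    have "bounded (h j ` sphere 0 R)"
      using R by (intro compact_imp_bounded compact_continuous_image compact_sphere continuous_on_subset[OF hc]) auto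
    then show ?thesis unfolding bounded_iff by auto
  qed
  then obtain K where K: "\<And>j z. z \<in> sphere 0 R \<Longrightarrow> cmod (h j z) \<le> K j" by metis
  \<comment> \<open>From \<open>j0\<close> on, \<open>1 / (real j + 2) <= 1 - R\<close>, so the
    circle lies in the region where \<open>h j\<close> is at most \<open>(1/2) ^ j\<close>.\<close>
  obtain j0 where j0: "1 / (1 - R) \<le> real j0" using real_arch_simple by blast
  define m where "m j = A * (if j < j0 then K j else (1/2) ^ j)" for j
  have le: "cmod (\<alpha> j * h j z) \<le> m j" if z: "cmod z = R" for j z
  proof -
    have "cmod (h j z) \<le> (if j < j0 then K j else (1/2) ^ j)"
    proof (cases "j < j0")
      case False
      have "1 / (1 - R) \<le> real j + 2" using j0 False by simp
      then have "1 / (real j + 2) \<le> 1 - R" using R by (simp add: field_simps)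
      then show ?thesis using small[of z j] z False by simp
    qed (use K z in auto)
    then show ?thesis unfolding m_def norm_mult by (intro mult_mono A A0) auto
  qed
  have sm: "summable m"
  proof -
    have "summable (\<lambda>j. A * (1/2) ^ j)" by (intro summable_mult summable_geometric) simp
    moreover have "\<forall>\<^sub>F j in sequentially. m j = A * (1/2) ^ j"
      using eventually_ge_at_top[of j0] by eventually_elim (simp add: m_def)
    ultimately show ?thesis by (simp add: summable_cong)
  qed
  have m0: "0 \<le> m j" for j
    using le[of "of_real R" j] R order_trans[OF norm_ge_zero] by (auto simp del: norm_mult)
  have s: "summable (\<lambda>j. \<alpha> j * h j z)" if "cmod z = R" for z
    by (rule summable_comparison_test[OF _ sm]) (use le[OF that] in auto)
  have lim: "(\<lambda>N. \<Sum>j<N. \<alpha> j * h j z) \<longlonglongrightarrow> (\<Sum>j. \<alpha> j * h j z)" if "cmod z = R" for z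
    by (rule summable_LIMSEQ[OF s[OF that]])
  have cR: "cmod (of_real R * cis t) = R" for t using R by (simp add: norm_mult)
  have bound: "cmod (\<Sum>j<N. \<alpha> j * h j z) \<le> suminf m" if z: "cmod z = R" for N z
  proof -
    have "cmod (\<Sum>j<N. \<alpha> j * h j z) \<le> (\<Sum>j<N. m j)"
      by (rule order_trans[OF norm_sum sum_mono]) (rule le[OF z])
    also have "\<dots> \<le> suminf m" by (rule sum_le_suminf[OF sm]) (use m0 in auto)
    finally show ?thesis .
  qed
  show ?thesis unfolding circ_int_def
  proof (rule dominated_convergence(2))
    fix N
    have "continuous_on (ball 0 1) (\<lambda>z. cmod (\<Sum>j<N. \<alpha> j * h j z) powr p)"
      by (intro continuous_on_norm_powr continuous_intros hc p)
    then show "(\<lambda>t. cmod (\<Sum>j<N. \<alpha> j * h j (of_real R * cis t)) powr p) integrable_on {0..2*pi}"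
      using circ_int_integrable[of 1 "\<lambda>z. cmod (\<Sum>j<N. \<alpha> j * h j z) powr p" R] R by simp
  next
    show "(\<lambda>t::real. suminf m powr p) integrable_on {0..2*pi}" by (rule integrable_const_ivl)
  next
    fix N and t :: real
    show "norm (cmod (\<Sum>j<N. \<alpha> j * h j (of_real R * cis t)) powr p) \<le> suminf m powr p"
      using bound[OF cR] p by (auto intro!: powr_mono2)
  next
    fix t :: real
    show "(\<lambda>N. cmod (\<Sum>j<N. \<alpha> j * h j (of_real R * cis t)) powr p) \<longlonglongrightarrow> cmod (\<Sum>j. \<alpha> j * h j (of_real R * cis t)) powr p"
      by (rule tendsto_powr') (use p in \<open>auto intro!: tendsto_norm lim cR\<close>)
  qed
qed

text \<open>The bounds of \<open>almost_disjoint_sum\<close> are integrated over circles for finite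
  sums and passed to the limit. The overlap error is at most \<open>\<eta>\<close> times the
  \<open>p\<close>-th power sum \<open>\<sigma>\<close> of the coefficients, and in the lower
  estimate it is absorbed by the contribution of the individual terms, which is at least
  \<open>\<beta> * \<sigma>\<close>.\<close>

lemma ell_p_equivalence:
  fixes h :: "nat \<Rightarrow> complex \<Rightarrow> complex"
  assumes hol: "\<And>j. h j holomorphic_on ball 0 1" and p: "1 \<le> p" and \<beta>: "0 < \<beta>"
    and B: "\<And>j R. 0 < R \<Longrightarrow> R < 1 \<Longrightarrow> circ_int (\<lambda>z. cmod (h j z) powr p) R \<le> B"
    and lower: "\<And>j. \<exists>R. 0 < R \<and> R < 1 \<and> \<beta> \<le> circ_int (\<lambda>z. cmod (h j z) powr p) R"
    and small: "\<And>j z. cmod z \<le> 1 - 1 / (real j + 2) \<Longrightarrow> cmod (h j z) \<le> (1/2) ^ j"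
    and disj: "\<And>i j R. i < j \<Longrightarrow> 0 < R \<Longrightarrow> R < 1 \<Longrightarrow>
       circ_int (\<lambda>z. min (cmod (h i z)) (cmod (h j z)) powr p) R
         \<le> \<beta> / (2 * (2 powr p + 1)) / (4 powr (p * (real j + 1)) * (real j + 1) * 2 ^ Suc j)"
  shows "\<exists>c>0. \<forall>\<alpha>::nat \<Rightarrow> complex.
           summable (\<lambda>j. cmod (\<alpha> j) powr p) \<longrightarrow>
             inverse c * (\<Sum>j. cmod (\<alpha> j) powr p) powr (1/p) \<le> hardy_norm p (\<lambda>z. \<Sum>j. \<alpha> j * h j z)
           \<and> hardy_norm p (\<lambda>z. \<Sum>j. \<alpha> j * h j z) \<le> c * (\<Sum>j. cmod (\<alpha> j) powr p) powr (1/p)"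
proof -
  \<comment> \<open>Tuned so that the error \<open>(2 powr p + 1) * \<eta> * \<sigma>\<close> in the
    lower estimate equals half of \<open>\<beta> * \<sigma>\<close>.\<close>
  define \<eta> where "\<eta> = \<beta> / (2 * (2 powr p + 1))"
  have p0: "0 < p" using p by simp
  have pos: "0 < 2 powr p + (1::real)" by (intro add_pos_pos) auto
  have "q * (\<beta> / (2 * q)) = \<beta> / 2" if "0 < q" for q using that by simp
  from this[OF pos] have \<eta>2: "(2 powr p + 1) * \<eta> = \<beta> / 2" unfolding \<eta>_def .
  have \<eta>: "0 < \<eta>" using \<beta> pos unfolding \<eta>_def by (intro divide_pos_pos mult_pos_pos) auto
  have hc: "continuous_on (ball 0 1) (h j)" for j by (rule holomorphic_on_imp_continuous_on[OF hol])
  have B0: "0 \<le> B"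
    using order_trans[OF circ_int_nonneg[OF continuous_on_norm_powr[OF hc p0], of "1/2"] B[of "1/2"]] by auto
  let ?Z = "\<lambda>N z. overlap (\<lambda>j. cmod (h j z)) N powr p"
  have Zc: "continuous_on (ball 0 1) (?Z N)" for N
    unfolding overlap_def
    by (rule continuous_on_powr') (use p0 in \<open>auto intro!: continuous_intros hc sum_nonneg\<close>)
  have W: "circ_int (?Z N) R \<le> \<eta>" if R: "0 < R" "R < 1" for N R
  proof -
    let ?m = "\<lambda>i j z. min (cmod (h i z)) (cmod (h j z)) powr p"
    have mc: "continuous_on (ball 0 1) (?m i j)" for i j by (rule continuous_on_min_powr[OF hc hc p0])
    have "circ_int (?Z N) R \<le> circ_int (\<lambda>z. \<Sum>j<N. \<Sum>i<j. 4 powr (p * (real j + 1)) * ?m i j z) R"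
      by (rule circ_int_mono[OF Zc]) (use R p0 in \<open>auto intro!: continuous_on_sum continuous_on_mult_left mc overlap_powr_le\<close>)
    also have "\<dots> = (\<Sum>j<N. \<Sum>i<j. 4 powr (p * (real j + 1)) * circ_int (?m i j) R)"
      using R by (simp add: circ_int_sum[of _ 1] continuous_on_sum continuous_on_mult_left mc circ_int_cmult)
    also have "\<dots> \<le> (\<Sum>j<N. \<eta> * (1/2) ^ Suc j)"
    proof (rule sum_mono)
      fix j
      have "(\<Sum>i<j. 4 powr (p * (real j + 1)) * circ_int (?m i j) R)
          \<le> (\<Sum>i<j. 4 powr (p * (real j + 1)) * (\<eta> / (4 powr (p * (real j + 1)) * (real j + 1) * 2 ^ Suc j)))"
        by (intro sum_mono mult_left_mono) (use disj R in \<open>auto simp: \<eta>_def\<close>)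
      \<comment> \<open>In the threshold of \<open>disj\<close> the power of 4 cancels the weight
        from \<open>overlap_powr_le\<close>, \<open>real j + 1\<close> pays for the \<open>j\<close>
        inner terms, and \<open>2 ^ Suc j\<close> makes the outer sum at most 1.\<close>
      also have "\<dots> = real j / (real j + 1) * (\<eta> * (1/2) ^ Suc j)"
      proof -
        have "n * (X * (\<eta> / (X * u * v))) = n / u * (\<eta> * (1 / v))" if "X \<noteq> 0" "u \<noteq> 0" "v \<noteq> 0" for n X u v :: real
          using that by (simp add: field_simps)
        from this[of "4 powr (p * (real j + 1))" "real j + 1" "2 ^ Suc j" "real j"] show ?thesis
          by (simp add: power_one_over)
      qed
      also have "\<dots> \<le> 1 * (\<eta> * (1/2) ^ Suc j)"
        using \<eta> by (intro mult_right_mono) auto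
      finally show "(\<Sum>i<j. 4 powr (p * (real j + 1)) * circ_int (?m i j) R) \<le> \<eta> * (1/2) ^ Suc j" by simp
    qed
    also have "\<dots> = \<eta> * (\<Sum>j<N. (1/2) ^ Suc j)" by (simp add: sum_distrib_left)
    also have "\<dots> \<le> \<eta> * 1"
    proof (intro mult_left_mono)
      have "(\<Sum>j<N. (1/2::real) ^ Suc j) = 1 - (1/2) ^ N" by (induction N) auto
      then show "(\<Sum>j<N. (1/2::real) ^ Suc j) \<le> 1" by simp
    qed (use \<eta> in auto)
    finally show ?thesis by simp
  qed
  define c1 where "c1 = 2 powr p * (2 * pi) / (\<beta> / 2)"
  define c2 where "c2 = 2 powr p * (B + \<eta>) / (2 * pi)"
  have c: "0 < c1" "0 < c2" using \<beta> \<eta> B0 by (auto simp: c1_def c2_def intro!: divide_pos_pos mult_pos_pos)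
  define c where "c = max (c1 powr (1/p)) (c2 powr (1/p))"
  have c0: "0 < c" using c by (simp add: c_def less_max_iff_disj)
  have main: "(\<Sum>j. cmod (\<alpha> j) powr p) powr (1/p) \<le> c * hardy_norm p (\<lambda>z. \<Sum>j. \<alpha> j * h j z) \<and>
      hardy_norm p (\<lambda>z. \<Sum>j. \<alpha> j * h j z) \<le> c * (\<Sum>j. cmod (\<alpha> j) powr p) powr (1/p)"
    if sum\<alpha>: "summable (\<lambda>j. cmod (\<alpha> j) powr p)" for \<alpha> :: "nat \<Rightarrow> complex"
  proof -
    define \<sigma> where "\<sigma> = (\<Sum>j. cmod (\<alpha> j) powr p)"
    define S where "S z = (\<Sum>j. \<alpha> j * h j z)" for z
    define A where "A = \<sigma> powr (1/p)"
    have \<sigma>0: "0 \<le> \<sigma>" unfolding \<sigma>_def by (rule suminf_nonneg[OF sum\<alpha>]) auto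
    have part: "(\<Sum>j<N. cmod (\<alpha> j) powr p) \<le> \<sigma>" for N
      unfolding \<sigma>_def by (rule sum_le_suminf[OF sum\<alpha>]) auto
    have Ap: "A powr p = \<sigma>" using \<sigma>0 p0 by (simp add: A_def powr_powr)
    have A: "cmod (\<alpha> j) \<le> A" for j
    proof -
      have "cmod (\<alpha> j) powr p \<le> (\<Sum>j<Suc j. cmod (\<alpha> j) powr p)" by (simp add: sum_nonneg)
      then have "cmod (\<alpha> j) powr p \<le> \<sigma>" using part[of "Suc j"] by linarith
      then have "(cmod (\<alpha> j) powr p) powr (1/p) \<le> A" unfolding A_def using p0 by (intro powr_mono2) auto
      then show ?thesis using p0 by (simp add: powr_powr)
    qed
    let ?T = "\<lambda>N R. circ_int (\<lambda>z. cmod (\<Sum>j<N. \<alpha> j * h j z) powr p) R"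
    let ?X = "\<lambda>j R. circ_int (\<lambda>z. cmod (h j z) powr p) R"
    have cT: "continuous_on (ball 0 1) (\<lambda>z. cmod (\<Sum>j<N. \<alpha> j * h j z) powr p)" for N
      by (intro continuous_on_norm_powr continuous_intros hc p0)
    have cX: "continuous_on (ball 0 1) (\<lambda>z. \<Sum>j<N. cmod (\<alpha> j) powr p * cmod (h j z) powr p)" for N
      by (intro continuous_on_sum continuous_on_mult_left continuous_on_norm_powr hc p0)
    have iX: "circ_int (\<lambda>z. \<Sum>j<N. cmod (\<alpha> j) powr p * cmod (h j z) powr p) R = (\<Sum>j<N. cmod (\<alpha> j) powr p * ?X j R)"
      if "0 < R" "R < 1" for N R
      using that by (simp add: circ_int_sum[of _ 1] continuous_on_mult_left continuous_on_norm_powr hc p0 circ_int_cmult)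
    have lim: "(\<lambda>N. ?T N R) \<longlonglongrightarrow> circ_int (\<lambda>z. cmod (S z) powr p) R" if R: "0 < R" "R < 1" for R
      unfolding S_def by (rule circle_series_limit[OF hol p0 A small R])
    have up: "circ_int (\<lambda>z. cmod (S z) powr p) R \<le> 2 powr p * (B + \<eta>) * \<sigma>" if R: "0 < R" "R < 1" for R
    proof (rule LIMSEQ_le_const2[OF lim[OF R]], intro exI allI impI)
      fix N
      have "?T N R \<le> circ_int (\<lambda>z. 2 powr p * ((\<Sum>j<N. cmod (\<alpha> j) powr p * cmod (h j z) powr p) + \<sigma> * ?Z N z)) R"
        using almost_disjoint_sum(1)[OF A p, where N = N] R
        by (intro circ_int_mono[OF cT] continuous_on_mult_left continuous_on_add cX Zc) (auto simp: Ap)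
      also have "\<dots> = 2 powr p * ((\<Sum>j<N. cmod (\<alpha> j) powr p * ?X j R) + \<sigma> * circ_int (?Z N) R)"
        using circ_int_add[OF cX continuous_on_mult_left[OF Zc], of R N \<sigma> N] R by (simp add: circ_int_cmult iX)
      also have "\<dots> \<le> 2 powr p * ((\<Sum>j<N. cmod (\<alpha> j) powr p * B) + \<sigma> * \<eta>)"
        using R \<sigma>0 by (intro mult_left_mono add_mono sum_mono B W) auto
      also have "(\<Sum>j<N. cmod (\<alpha> j) powr p * B) \<le> \<sigma> * B"
        unfolding sum_distrib_right[symmetric] by (rule mult_right_mono[OF part B0])
      finally show "?T N R \<le> 2 powr p * (B + \<eta>) * \<sigma>" by (simp add: algebra_simps)
    qed
    \<comment> \<open>Two cutoffs are needed: \<open>N\<close> tends to infinity on a fixed circle,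
      while \<open>n\<close> stays fixed because the radius will depend on \<open>n\<close>.\<close>
    have low: "(\<Sum>j<n. cmod (\<alpha> j) powr p * ?X j R) \<le> 2 powr p * circ_int (\<lambda>z. cmod (S z) powr p) R + \<beta> / 2 * \<sigma>"
      if R: "0 < R" "R < 1" for R n
    proof (rule LIMSEQ_le_const[where X = "\<lambda>N. 2 powr p * ?T N R + \<beta> / 2 * \<sigma>"], goal_cases)
      case 1
      show ?case by (intro tendsto_intros lim R)
    next
      case 2
      show ?case
      proof (intro exI[of _ n] allI impI)
        fix N assume N: "n \<le> N"
        have "(\<Sum>j<n. cmod (\<alpha> j) powr p * ?X j R) \<le> (\<Sum>j<N. cmod (\<alpha> j) powr p * ?X j R)"
          using N R by (intro sum_mono2 mult_nonneg_nonneg circ_int_nonneg[OF continuous_on_norm_powr[OF hc p0]]) auto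
        also have "\<dots> = circ_int (\<lambda>z. \<Sum>j<N. cmod (\<alpha> j) powr p * cmod (h j z) powr p) R"
          by (simp only: iX[OF R])
        also have "\<dots> \<le> circ_int (\<lambda>z. 2 powr p * cmod (\<Sum>j<N. \<alpha> j * h j z) powr p + (2 powr p + 1) * \<sigma> * ?Z N z) R"
          using almost_disjoint_sum(2)[OF A p, where N = N] R
          by (intro circ_int_mono[OF cX] continuous_on_mult_left continuous_on_add cT Zc) (auto simp: Ap mult.assoc)
        also have "\<dots> = 2 powr p * ?T N R + (2 powr p + 1) * \<sigma> * circ_int (?Z N) R"
          using circ_int_add[OF continuous_on_mult_left[OF cT] continuous_on_mult_left[OF Zc], of R "2 powr p" N "(2 powr p + 1) * \<sigma>" N] R
          by (simp only: circ_int_cmult)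
        also have "\<dots> \<le> 2 powr p * ?T N R + (2 powr p + 1) * \<sigma> * \<eta>"
          using R \<sigma>0 pos by (intro add_left_mono mult_left_mono W) auto
        also have "(2 powr p + 1) * \<sigma> * \<eta> = \<beta> / 2 * \<sigma>" using \<eta>2 by (simp add: mult.commute mult.left_commute)
        finally show "(\<Sum>j<n. cmod (\<alpha> j) powr p * ?X j R) \<le> 2 powr p * ?T N R + \<beta> / 2 * \<sigma>" .
      qed
    qed
    have mean_le: "hardy_mean p S R powr (1/p) \<le> c * \<sigma> powr (1/p)" if R: "R \<in> {0<..<1}" for R
    proof -
      have "hardy_mean p S R \<le> c2 * \<sigma>"
        using divide_right_mono[OF up[of R], of "2 * pi"] R by (simp add: hardy_mean_eq c2_def)
      then have "hardy_mean p S R powr (1/p) \<le> (c2 * \<sigma>) powr (1/p)"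
        using p0 by (intro powr_mono2 hardy_mean_nonneg) auto
      also have "\<dots> = c2 powr (1/p) * \<sigma> powr (1/p)" using c \<sigma>0 by (simp add: powr_mult)
      also have "\<dots> \<le> c * \<sigma> powr (1/p)" by (intro mult_right_mono) (auto simp: c_def)
      finally show ?thesis .
    qed
    have ub: "hardy_norm p S \<le> c * \<sigma> powr (1/p)"
      unfolding hardy_norm_def by (rule cSUP_least) (use mean_le in auto)
    \<comment> \<open>\<open>hardy_norm\<close> is a real supremum and is informative only for a
      bounded family; boundedness for \<open>S\<close> comes from the upper estimate.\<close>
    have bdd: "bdd_above ((\<lambda>R. hardy_mean p S R powr (1/p)) ` {0<..<1})"
      by (rule bdd_aboveI2[OF mean_le])
    define H where "H = hardy_norm p S"
    have H0: "0 \<le> H"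
      unfolding H_def hardy_norm_def by (rule order_trans[OF _ cSUP_upper[OF _ bdd, of "1/2"]]) auto
    have T_le: "circ_int (\<lambda>z. cmod (S z) powr p) R \<le> 2 * pi * H powr p" if R: "0 < R" "R < 1" for R
    proof -
      have "hardy_mean p S R powr (1/p) \<le> H"
        unfolding H_def hardy_norm_def by (rule cSUP_upper[OF _ bdd]) (use R in auto)
      then have "(hardy_mean p S R powr (1/p)) powr p \<le> H powr p" using p0 by (intro powr_mono2) auto
      then have "hardy_mean p S R \<le> H powr p" using p0 hardy_mean_nonneg[of p S R] by (simp add: powr_powr)
      then show ?thesis by (simp add: hardy_mean_eq field_simps)
    qed
    have "\<beta> * (\<Sum>j<n. cmod (\<alpha> j) powr p) \<le> 2 powr p * (2 * pi * H powr p) + \<beta> / 2 * \<sigma>" for n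
    proof -
      obtain \<rho> where \<rho>: "\<And>j. 0 < \<rho> j \<and> \<rho> j < 1 \<and> \<beta> \<le> ?X j (\<rho> j)" using lower by metis
      \<comment> \<open>One circle for the first \<open>n\<close> terms: means increase with the
        radius, so the largest of the individual radii works for all of them. The entry
        \<open>1/2\<close> keeps the set nonempty for \<open>n = 0\<close>.\<close>
      define R where "R = Max (insert (1/2) (\<rho> ` {..<n}))"
      have R: "0 < R" "R < 1" unfolding R_def using \<rho> by (auto simp: Max_gr_iff Max_less_iff)
      have X: "\<beta> \<le> ?X j R" if "j < n" for j
      proof -
        have "\<rho> j \<le> R" unfolding R_def using that by (intro Max_ge) auto
        then have "?X j (\<rho> j) \<le> ?X j R"
          using circ_int_norm_powr_mono[OF hol p0, of "\<rho> j" R j] \<rho>[of j] R by simp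
        then show ?thesis using \<rho>[of j] by linarith
      qed
      have "\<beta> * (\<Sum>j<n. cmod (\<alpha> j) powr p) = (\<Sum>j<n. cmod (\<alpha> j) powr p * \<beta>)"
        by (simp add: sum_distrib_left mult.commute)
      also have "\<dots> \<le> (\<Sum>j<n. cmod (\<alpha> j) powr p * ?X j R)"
        by (intro sum_mono mult_left_mono X) auto
      also have "\<dots> \<le> 2 powr p * circ_int (\<lambda>z. cmod (S z) powr p) R + \<beta> / 2 * \<sigma>" by (rule low[OF R])
      also have "\<dots> \<le> 2 powr p * (2 * pi * H powr p) + \<beta> / 2 * \<sigma>"
        by (intro add_right_mono mult_left_mono T_le R) auto
      finally show ?thesis .
    qed
    moreover have "(\<lambda>n. \<beta> * (\<Sum>j<n. cmod (\<alpha> j) powr p)) \<longlonglongrightarrow> \<beta> * \<sigma>"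
      unfolding \<sigma>_def by (intro tendsto_intros summable_LIMSEQ sum\<alpha>)
    ultimately have "\<beta> * \<sigma> \<le> 2 powr p * (2 * pi * H powr p) + \<beta> / 2 * \<sigma>"
      by (intro LIMSEQ_le_const2) auto
    then have "\<beta> / 2 * \<sigma> \<le> 2 powr p * (2 * pi) * H powr p" by (simp add: mult.assoc)
    then have "\<sigma> \<le> c1 * H powr p" using \<beta> by (simp add: c1_def field_simps)
    then have "\<sigma> powr (1/p) \<le> (c1 * H powr p) powr (1/p)" using \<sigma>0 p0 by (intro powr_mono2) auto
    also have "\<dots> = c1 powr (1/p) * H" using c H0 p0 by (simp add: powr_mult powr_powr)
    also have "\<dots> \<le> c * H" using H0 by (intro mult_right_mono) (auto simp: c_def)
    finally show ?thesis using ub unfolding H_def \<sigma>_def S_def[abs_def] by simp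
  qed
  show ?thesis
  proof (intro exI[of _ c] conjI allI impI c0)
    fix \<alpha> :: "nat \<Rightarrow> complex" assume s: "summable (\<lambda>j. cmod (\<alpha> j) powr p)"
    show "inverse c * (\<Sum>j. cmod (\<alpha> j) powr p) powr (1/p) \<le> hardy_norm p (\<lambda>z. \<Sum>j. \<alpha> j * h j z)"
      using main[OF s] c0 by (simp add: field_simps)
    show "hardy_norm p (\<lambda>z. \<Sum>j. \<alpha> j * h j z) \<le> c * (\<Sum>j. cmod (\<alpha> j) powr p) powr (1/p)"
      using main[OF s] by simp
  qed
qed

section \<open>Gliding hump: choice of the subsequence\<close>

theorem theorem3p1:
  fixes g :: "complex \<Rightarrow> complex" and p :: real and f :: "nat \<Rightarrow> complex \<Rightarrow> complex"
  assumes "g \<in> BMOA"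
    and "1 \<le> p"
    and "\<And>n. in_Hardy p (f n)"
    and "\<And>n. hardy_norm p (f n) = 1"
    and "\<And>K. compact K \<Longrightarrow> K \<subseteq> ball 0 1 \<Longrightarrow> uniform_limit K f (\<lambda>_. 0) sequentially"
    and "liminf (\<lambda>n. ereal (hardy_norm p (volterra g (f n)))) > 0"
  shows "\<exists>r::nat \<Rightarrow> nat. strict_mono r \<and> (\<exists>c>0. \<forall>\<alpha>::nat \<Rightarrow> complex.
           summable (\<lambda>j. cmod (\<alpha> j) powr p) \<longrightarrow>
             inverse c * (\<Sum>j. cmod (\<alpha> j) powr p) powr (1/p)
               \<le> hardy_norm p (\<lambda>z. \<Sum>j. \<alpha> j * volterra g (f (r j)) z)
           \<and> hardy_norm p (\<lambda>z. \<Sum>j. \<alpha> j * volterra g (f (r j)) z)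
               \<le> c * (\<Sum>j. cmod (\<alpha> j) powr p) powr (1/p))"
proof -
  note g = assms(1) and p = assms(2) and lim = assms(5)
  have p0: "0 < p" using p by simp
  have gh: "g holomorphic_on ball 0 1" using g by (auto simp: BMOA_def)
  have fh: "f n holomorphic_on ball 0 1" for n using assms(3)[of n] by (simp add: in_Hardy_def)
  have fb: "circ_int (\<lambda>z. cmod (f n z) powr p) R \<le> 2 * pi" if "0 < R" "R < 1" for n R
    using hardy_mean_le_norm[OF assms(3) p0 that, of n] by (simp add: assms(4) hardy_mean_eq)
  define h where "h n = volterra g (f n)" for n
  have hh: "h n holomorphic_on ball 0 1" for n unfolding h_def by (rule volterra_primitive(1)[OF fh gh])
  have hc: "continuous_on (ball 0 1) (h n)" for n by (rule holomorphic_on_imp_continuous_on[OF hh])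
  obtain B where B: "\<And>n R. 0 < R \<Longrightarrow> R < 1 \<Longrightarrow> circ_int (\<lambda>z. ((cmod (h n z))\<^sup>2 + 1) powr (p/2)) R \<le> B"
    using volterra_Hardy_bounded[OF g p0] fh fb unfolding h_def by metis
  have hB: "circ_int (\<lambda>z. cmod (h n z) powr p) R \<le> B" if R: "0 < R" "R < 1" for n R
  proof (rule order_trans[OF circ_int_mono B[OF R]])
    show "cmod (h n z) powr p \<le> ((cmod (h n z))\<^sup>2 + 1) powr (p/2)" for z
      unfolding square_powr_half[symmetric] using p0 by (intro powr_mono2) auto
  qed (use R in \<open>auto intro!: continuous_on_norm_powr continuous_on_Q_powr hc p0\<close>)
  have hH: "in_Hardy p (h n)" for n
    unfolding in_Hardy_def hardy_mean_eq
    by (intro conjI hh bdd_aboveI2[where M = "B / (2 * pi)"] divide_right_mono hB) auto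
  have meas: "\<forall>\<^sub>F n in sequentially. \<forall>R. 0 < R \<longrightarrow> R < 1 \<longrightarrow> circ_int (\<lambda>z. cmod (h n z) powr (1/2)) R \<le> e"
    if "0 < e" for e
    unfolding h_def by (rule volterra_small_in_measure[OF g p fh fb lim that])
  have overlap_small: "\<forall>\<^sub>F n in sequentially. \<forall>R. 0 < R \<longrightarrow> R < 1 \<longrightarrow>
       circ_int (\<lambda>z. min (cmod (h m z)) (cmod (h n z)) powr p) R \<le> e" if "0 < e" for m e
    by (rule Hardy_min_small[OF hh p B hh meas that])
  obtain c0 where c0: "0 < ereal c0" "ereal c0 < liminf (\<lambda>n. ereal (hardy_norm p (h n)))"
    using ereal_dense2[OF assms(6)] unfolding h_def by blast
  \<comment> \<open>The bound \<open>c0\<close> on the norm restated for circle integrals, which are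
    not divided by \<open>2 * pi\<close>.\<close>
  define \<beta> where "\<beta> = 2 * pi * c0 powr p"
  have \<beta>: "0 < \<beta>" using c0 by (simp add: \<beta>_def)
  have low: "\<forall>\<^sub>F n in sequentially. \<exists>R. 0 < R \<and> R < 1 \<and> \<beta> \<le> circ_int (\<lambda>z. cmod (h n z) powr p) R"
    using less_LiminfD[OF c0(2)]
  proof eventually_elim
    case (elim n)
    then have "c0 < hardy_norm p (h n)" by simp
    then obtain R where R: "0 < R" "R < 1" "c0 < hardy_mean p (h n) R powr (1/p)"
      unfolding hardy_norm_def using in_Hardy_bdd[OF hH p0, of n] by (subst (asm) less_cSUP_iff) auto
    have "c0 powr p \<le> (hardy_mean p (h n) R powr (1/p)) powr p"
      using R c0 p0 by (intro powr_mono2) auto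
    also have "\<dots> = hardy_mean p (h n) R" using p0 hardy_mean_nonneg[of p "h n" R] by (simp add: powr_powr)
    finally show ?case using R(1,2) by (auto simp: \<beta>_def hardy_mean_eq field_simps)
  qed
  define \<delta> where "\<delta> j = \<beta> / (2 * (2 powr p + 1)) / (4 powr (p * (real j + 1)) * (real j + 1) * 2 ^ Suc j)" for j
  have \<delta>: "0 < \<delta> j" for j
  proof -
    have "0 < 2 powr p + (1::real)" "0 < real j + 1" by (auto intro!: add_pos_pos)
    then show ?thesis unfolding \<delta>_def using \<beta> by (intro divide_pos_pos mult_pos_pos) auto
  qed
  define P where "P j n \<longleftrightarrow> (\<exists>R. 0 < R \<and> R < 1 \<and> \<beta> \<le> circ_int (\<lambda>z. cmod (h n z) powr p) R) \<and>
     (\<forall>z. cmod z \<le> 1 - 1 / (real j + 2) \<longrightarrow> cmod (h n z) \<le> (1/2) ^ j)" for j n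
  \<comment> \<open>Smallness is required against all \<open>m <= x\<close>, not just against
    \<open>x\<close>: as the chosen indices increase, the condition on consecutive indices then
    covers every earlier one. The threshold is \<open>\<delta> (Suc j)\<close> because
    \<open>y\<close> will be the entry at position \<open>Suc j\<close>.\<close>
  define D where "D j x y \<longleftrightarrow> x < y \<and> (\<forall>m\<le>x. \<forall>R. 0 < R \<longrightarrow> R < 1 \<longrightarrow>
     circ_int (\<lambda>z. min (cmod (h m z)) (cmod (h y z)) powr p) R \<le> \<delta> (Suc j))" for j x y
  have evP: "\<forall>\<^sub>F n in sequentially. P j n" for j
  proof -
    have "\<forall>\<^sub>F n in sequentially. \<forall>z. cmod z \<le> 1 - 1 / (real j + 2) \<longrightarrow>
        cmod (f n z) \<le> (1/2) ^ j \<and> cmod (volterra g (f n) z) \<le> (1/2) ^ j"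
      by (rule volterra_uniform_small[OF fh gh _ lim]) auto
    with low show ?thesis by eventually_elim (auto simp: P_def h_def)
  qed
  have evD: "\<forall>\<^sub>F y in sequentially. D j x y" for j x
  proof -
    have "\<forall>\<^sub>F y in sequentially. \<forall>m\<in>{..x}. \<forall>R. 0 < R \<longrightarrow> R < 1 \<longrightarrow>
        circ_int (\<lambda>z. min (cmod (h m z)) (cmod (h y z)) powr p) R \<le> \<delta> (Suc j)"
      by (intro eventually_ball_finite ballI overlap_small \<delta>) auto
    with eventually_gt_at_top[of x] show ?thesis by eventually_elim (auto simp: D_def)
  qed
  have "\<exists>r. \<forall>j. P j (r j) \<and> D j (r j) (r (Suc j))"
  proof (rule dependent_nat_choice)
    show "\<exists>x. P 0 x" using eventually_happens[OF evP] by simp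
    show "\<exists>y. P (Suc j) y \<and> D j x y" for x j
      using eventually_happens[OF eventually_conj[OF evP evD]] by simp
  qed
  then obtain r where r: "\<And>j. P j (r j)" "\<And>j. D j (r j) (r (Suc j))" by blast
  have mono: "strict_mono r" using r(2) by (intro strict_monoI_Suc) (simp add: D_def)
  have "\<exists>c>0. \<forall>\<alpha>::nat \<Rightarrow> complex.
           summable (\<lambda>j. cmod (\<alpha> j) powr p) \<longrightarrow>
             inverse c * (\<Sum>j. cmod (\<alpha> j) powr p) powr (1/p) \<le> hardy_norm p (\<lambda>z. \<Sum>j. \<alpha> j * h (r j) z)
           \<and> hardy_norm p (\<lambda>z. \<Sum>j. \<alpha> j * h (r j) z) \<le> c * (\<Sum>j. cmod (\<alpha> j) powr p) powr (1/p)"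
  proof (rule ell_p_equivalence[OF hh p \<beta> hB])
    show "\<exists>R. 0 < R \<and> R < 1 \<and> \<beta> \<le> circ_int (\<lambda>z. cmod (h (r j) z) powr p) R" for j
      using r(1)[of j] by (simp add: P_def)
    show "cmod (h (r j) z) \<le> (1/2) ^ j" if "cmod z \<le> 1 - 1 / (real j + 2)" for j z
      using r(1)[of j] that by (simp add: P_def)
    fix i j :: nat and R assume ij: "i < j" and R: "0 < R" "R < (1::real)"
    then obtain j' where j': "j = Suc j'" by (cases j) auto
    then have "r i \<le> r j'" using ij mono by (simp add: strict_mono_less_eq)
    then show "circ_int (\<lambda>z. min (cmod (h (r i) z)) (cmod (h (r j) z)) powr p) R
         \<le> \<beta> / (2 * (2 powr p + 1)) / (4 powr (p * (real j + 1)) * (real j + 1) * 2 ^ Suc j)"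
      using r(2)[of j'] R unfolding D_def \<delta>_def j' by blast
  qed
  then show ?thesis using mono unfolding h_def by blast
qed

end
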